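(* Let $p_1,p_2,q_1,q_2,\alpha,\beta\in(0,\infty)$ and let $(X_n)_{n\ge0}$ be a standard random sequence. Then $\mathcal R:\mathcal F_\alpha^{p_1,q_1}\hookrightarrow\mathcal F_\beta^{p_2,q_2}$ (that is, $\mathcal Rf\in\mathcal F_\beta^{p_2,q_2}$ almost surely for every $f\in\mathcal F_\alpha^{p_1,q_1}$) if and only if either (i) $\alpha<\beta$, or (ii) $\alpha=\beta$, $q_1\le q_2$, and $\frac1{p_1}+\frac1{q_2}-\frac1{q_1}\le\frac12$.
   Context: A standard random sequence $(X_n)_{n\ge0}$ is one of: a sequence of i.i.d. Bernoulli variables ($\mathbb P(X_n=1)=\mathbb P(X_n=-1)=\frac12$); a sequence of i.i.d. Steinhaus variables (uniformly distributed on the unit circle); a sequence of i.i.d. real Gaussian $N(0,1)$ variables. For an entire function $f(z)=\sum_{n\ge0}a_nz^n$, its randomization is $(\mathcal Rf)(z):=\sum_{n\ge0}a_nX_nz^n$. For an entire function $f$, $r\ge0$ and $0<p<\infty$, $M_p(f,r):=\left(\frac1{2\pi}\int_0^{2\pi}|f(re^{i\theta})|^p\,d\theta\right)^{1/p}$. For $\alpha>0$, $0<p,q<\infty$, $\mathcal F_\alpha^{p,q}$ is the space of entire functions $f$ with $\|f\|_{\mathcal F_\alpha^{p,q}}:=\left(\int_0^\infty M_p(f,r)^q\,\alpha q\,e^{-\frac{\alpha q}{2}r^2}r\,dr\right)^{1/q}<\infty$. *)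

theory Defs
  imports "HOL-Complex_Analysis.Complex_Analysis" "HOL-Probability.Probability"
begin

section \<open>Mixed-norm Fock spaces\<close>

definition integral_mean :: "real \<Rightarrow> (complex \<Rightarrow> complex) \<Rightarrow> real \<Rightarrow> real" where
  "integral_mean p f r =
     (1 / (2 * pi) * (LBINT t:{0..2 * pi}. norm (f (of_real r * cis t)) powr p)) powr (1 / p)"

definition fock_integral :: "real \<Rightarrow> real \<Rightarrow> real \<Rightarrow> (complex \<Rightarrow> complex) \<Rightarrow> ennreal" where
  "fock_integral \<alpha> p q f =
     (\<integral>\<^sup>+ r\<in>{0..}. ennreal (integral_mean p f r powr q
        * (\<alpha> * q * exp (- (\<alpha> * q / 2) * r\<^sup>2) * r)) \<partial>lborel)"

text \<open>The norm is \<open>[0, \<infinity>]\<close>-valued, so that its finiteness is a genuine condition.\<close>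

definition fock_norm :: "real \<Rightarrow> real \<Rightarrow> real \<Rightarrow> (complex \<Rightarrow> complex) \<Rightarrow> ennreal" where
  "fock_norm \<alpha> p q f =
     (if fock_integral \<alpha> p q f = \<infinity> then \<infinity>
      else ennreal (enn2real (fock_integral \<alpha> p q f) powr (1 / q)))"

definition fock_space :: "real \<Rightarrow> real \<Rightarrow> real \<Rightarrow> (complex \<Rightarrow> complex) set" where
  "fock_space \<alpha> p q = {f. f holomorphic_on UNIV \<and> fock_norm \<alpha> p q f < \<infinity>}"


section \<open>Standard random sequences\<close>

text \<open>All three kinds of variables are regarded as complex-valued, so the laws below are Borel
  probability measures on the complex plane.\<close>

definition bernoulli_law :: "complex measure" where
  "bernoulli_law = distr (measure_pmf (pmf_of_set {1, - 1})) borel (\<lambda>x. x)"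

definition steinhaus_law :: "complex measure" where
  "steinhaus_law = distr (uniform_measure lborel {0..2 * pi}) borel cis"

definition gaussian_law :: "complex measure" where
  "gaussian_law = distr (density lborel std_normal_density) borel complex_of_real"

definition iid_sequence :: "'w measure \<Rightarrow> (nat \<Rightarrow> 'w \<Rightarrow> complex) \<Rightarrow> complex measure \<Rightarrow> bool" where
  "iid_sequence M X \<mu> \<longleftrightarrow>
     prob_space.indep_vars M (\<lambda>_. borel) X UNIV \<and> (\<forall>n. distr M borel (X n) = \<mu>)"

definition standard_random_sequence :: "'w measure \<Rightarrow> (nat \<Rightarrow> 'w \<Rightarrow> complex) \<Rightarrow> bool" where
  "standard_random_sequence M X \<longleftrightarrow>
     iid_sequence M X bernoulli_law \<or> iid_sequence M X steinhaus_law \<or> iid_sequence M X gaussian_law"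


section \<open>Randomization\<close>

definition taylor_coeff :: "(complex \<Rightarrow> complex) \<Rightarrow> nat \<Rightarrow> complex" where
  "taylor_coeff f n = (deriv ^^ n) f 0 / fact n"

definition randomization ::
    "(nat \<Rightarrow> 'w \<Rightarrow> complex) \<Rightarrow> (complex \<Rightarrow> complex) \<Rightarrow> 'w \<Rightarrow> complex \<Rightarrow> complex" where
  "randomization X f \<omega> z = (\<Sum>n. taylor_coeff f n * X n \<omega> * z ^ n)"

text \<open>Since \<open>suminf\<close> has an unspecified value on divergent series, convergence of the random series
  on the whole plane is required explicitly. The exceptional null set may depend on \<open>f\<close>.\<close>

definition randomly_embeds :: "'w measure \<Rightarrow> (nat \<Rightarrow> 'w \<Rightarrow> complex) \<Rightarrow>
    (complex \<Rightarrow> complex) set \<Rightarrow> (complex \<Rightarrow> complex) set \<Rightarrow> bool" where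
  "randomly_embeds M X A B \<longleftrightarrow>
     (\<forall>f\<in>A. AE \<omega> in M. (\<forall>z. summable (\<lambda>n. taylor_coeff f n * X n \<omega> * z ^ n)) \<and>
                      randomization X f \<omega> \<in> B)"

end

theory Submission
  imports Defs
begin

text \<open>Let \<open>\<sigma>(r)\<close> be the mean square of \<open>f\<close> over the circle of radius \<open>r\<close>. For fixed \<open>r\<close> the
  randomized mean of order \<open>p\<close> is comparable to \<open>\<sigma>(r)\<close>: subgaussian moment bounds give the upper estimate
  in expectation, and a Paley--Zygmund argument the lower one with a probability that does not depend on
  \<open>f\<close> and \<open>r\<close>. Hence \<open>\<R>f\<close> lies in \<open>F(\<beta>, p\<^sub>2, q\<^sub>2)\<close> almost surely iff \<open>f\<close> lies in \<open>F(\<beta>, 2, q\<^sub>2)\<close>, and the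
  question becomes when \<open>F(\<alpha>, p\<^sub>1, q\<^sub>1)\<close> is contained in \<open>F(\<beta>, 2, q\<^sub>2)\<close>.

  With the Gaussian weight included, the coefficients of \<open>f\<close> that matter at radius \<open>r\<close> have indices within
  \<open>O(r)\<close> of \<open>\<alpha> r\<^sup>2\<close>. So Cauchy--Schwarz and Parseval bound the maximum of \<open>f\<close> on the circle by \<open>r powr (1 / 2)\<close> times
  the mean square at neighbouring radii; interpolation then bounds the mean square by \<open>r powr (1 / p - 1 / 2)\<close>
  times an average of the \<open>p\<close>-means over \<open>{r - 1..r + 1}\<close>, which yields sufficiency. The condition is
  sharp for sums of monomials and of the kernels \<open>exp (\<alpha> R z)\<close>.\<close>

section \<open>Circle means of everywhere convergent power series\<close>

text \<open>The critical line arises as follows. Put \<lambda> = 1 / p - 1 / 2 with p at most 2. The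
  weighted mean square at r, to the power q, is at most r powr (q \<lambda>) times a window integral
  of p-means. Since the radial measure carries a factor r, a finite norm alone gives the growth r
  powr (q \<lambda> - 1). Raising the second bound to the power (q' - q) / q and multiplying by the
  first leaves the exponent q' (\<lambda> - 1 / q + 1 / q') of r, nonpositive exactly in case (ii).
  For sharpness, a monomial whose weighted profile peaks at radius R with height 1 has width of
  order 1, hence norm of order R powr (1 / q) for every p; this tests q. A normalized kernel at R in
  addition occupies only an arc of relative length 1 / R, hence has norm of order R powr (1 / q - 1
  / p); this tests p. On the random side, almost sure finiteness gives no finite expectation, so the
  lower estimate needs a probability bound that is uniform in the radius.\<close>

definition circ :: "real measure" where
  "circ = uniform_measure lborel {0..2 * pi}"

lemma circ_density: "circ = density lborel (\<lambda>t. ennreal (indicator {0..2 * pi} t / (2 * pi)))"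
  unfolding circ_def uniform_measure_def
  by (intro arg_cong[where f = "density lborel"] ext)
     (auto simp: indicator_def ennreal_divide_numeral divide_ennreal ennreal_1[symmetric] simp del: ennreal_1)

lemma sets_circ [simp, measurable_cong]: "sets circ = sets borel"
  by (simp add: circ_def)

lemma space_circ [simp]: "space circ = UNIV"
  by (simp add: circ_def)

lemma prob_space_circ: "prob_space circ"
  unfolding circ_def by (rule prob_space_uniform_measure) auto

interpretation circ: prob_space circ
  by (rule prob_space_circ)

lemma integral_circ:
  fixes g :: "real \<Rightarrow> 'a::{banach, second_countable_topology}"
  assumes [measurable]: "g \<in> borel_measurable borel"
  shows "(\<integral>t. g t \<partial>circ) = (1 / (2 * pi)) *\<^sub>R (LBINT t:{0..2 * pi}. g t)"
proof -
  have "(\<integral>t. g t \<partial>circ) = (\<integral>t. (indicator {0..2 * pi} t / (2 * pi)) *\<^sub>R g t \<partial>lborel)"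
    unfolding circ_density by (rule integral_density) auto
  also have "\<dots> = (\<integral>t. (1 / (2 * pi)) *\<^sub>R (indicator {0..2 * pi} t *\<^sub>R g t) \<partial>lborel)"
    by (intro Bochner_Integration.integral_cong) auto
  also have "\<dots> = (1 / (2 * pi)) *\<^sub>R (LBINT t:{0..2 * pi}. g t)"
    unfolding set_lebesgue_integral_def by (rule integral_scaleR_right)
  finally show ?thesis .
qed

lemma integrable_circ:
  fixes g :: "real \<Rightarrow> 'a::{banach, second_countable_topology}"
  assumes [measurable]: "g \<in> borel_measurable borel" and "\<And>t. norm (g t) \<le> B"
  shows "integrable circ g"
  using assms by (intro circ.integrable_const_bound[where B = B]) auto

lemma integrable_circ_continuous:
  fixes g :: "real \<Rightarrow> 'a::{euclidean_space}"
  assumes "continuous_on UNIV g"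
  shows "integrable circ g"
proof -
  have [measurable]: "g \<in> borel_measurable borel"
    using assms by (rule borel_measurable_continuous_onI)
  have "compact (g ` {0..2 * pi})"
    by (rule compact_continuous_image[OF continuous_on_subset[OF assms]]) auto
  then obtain B where B: "\<And>t. t \<in> {0..2 * pi} \<Longrightarrow> norm (g t) \<le> B"
    by (metis bounded_iff compact_imp_bounded imageI)
  \<comment> \<open>The bound holds only on one period, which carries all the mass.\<close>
  have "AE t in circ. norm (g t) \<le> B"
    unfolding circ_def by (rule AE_uniform_measureI) (use B in auto)
  then show ?thesis by (intro circ.integrable_const_bound) auto
qed

lemma circ_integral_cis:
  assumes "k \<noteq> (0::int)"
  shows "(\<integral>t. cis (of_int k * t) \<partial>circ) = 0"
proof -
  let ?F = "\<lambda>t. cis (of_int k * t) / (\<i> * of_int k)"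
  have "(LBINT t:{0..2 * pi}. cis (of_int k * t)) = ?F (2 * pi) - ?F 0"
    unfolding set_lebesgue_integral_def
  proof (rule integral_FTC_atLeastAtMost)
    show "(?F has_vector_derivative cis (of_int k * x)) (at x within {0..2 * pi})" for x
      using assms unfolding cis_conv_exp
      by (auto intro!: derivative_eq_intros has_vector_derivative_real_field simp: field_simps)
  qed (auto intro!: continuous_intros)
  also have "\<dots> = 0"
    using cis_multiple_2pi[of "of_int k"] by (simp add: mult_ac)
  finally show ?thesis
    by (subst integral_circ) (auto intro!: borel_measurable_continuous_onI continuous_intros)
qed

lemma circ_orthogonality:
  "(\<integral>t. cis (real m * t) * cnj (cis (real n * t)) \<partial>circ) = (if m = n then 1 else 0)"
proof -
  have *: "cis (real m * t) * cnj (cis (real n * t)) = cis (of_int (int m - int n) * t)" for t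
    by (simp add: cis_cnj cis_mult algebra_simps)
  show ?thesis
    using circ_integral_cis[of "int m - int n"] circ.prob_space unfolding * by auto
qed

text \<open>The coefficients are kept apart from \<open>taylor_coeff\<close>, so that the random
  series with coefficients \<open>taylor_coeff f n * X n \<omega>\<close> and the superposed test
  functions are covered without identifying derivatives at 0.\<close>

definition everywhere_sums :: "(nat \<Rightarrow> complex) \<Rightarrow> (complex \<Rightarrow> complex) \<Rightarrow> bool" where
  "everywhere_sums c f \<longleftrightarrow> (\<forall>z. (\<lambda>n. c n * z ^ n) sums f z)"

lemma everywhere_sums_taylor:
  assumes "f holomorphic_on UNIV"
  shows "everywhere_sums (taylor_coeff f) f"
  unfolding everywhere_sums_def
proof
  fix z
  show "(\<lambda>n. taylor_coeff f n * z ^ n) sums f z"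
    using holomorphic_power_series[of f 0 "norm z + 1" z] holomorphic_on_subset[OF assms]
    by (auto simp: taylor_coeff_def)
qed

lemma everywhere_sums_holomorphic:
  assumes "everywhere_sums c f"
  shows "f holomorphic_on UNIV"
proof -
  have "f holomorphic_on ball 0 r" for r
    by (rule power_series_holomorphic[of 0 r c]) (use assms in \<open>auto simp: everywhere_sums_def\<close>)
  then have "f field_differentiable at z" for z
    using holomorphic_on_imp_differentiable_at[of f "ball 0 (norm z + 1)" z] by auto
  then show ?thesis by (simp add: holomorphic_on_def field_differentiable_at_within)
qed

lemma everywhere_sums_norm_summable:
  assumes "everywhere_sums c f" "r \<ge> 0"
  shows "summable (\<lambda>n. norm (c n) * r ^ n)"
proof -
  \<comment> \<open>Convergence at the larger radius \<open>r + 1\<close> forces absolute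
    convergence at \<open>r\<close>.\<close>
  have "summable (\<lambda>n. c n * of_real (r + 1) ^ n)"
    using assms by (auto simp: everywhere_sums_def sums_iff)
  then have "summable (\<lambda>n. norm (c n * of_real r ^ n))"
    by (rule powser_insidea) (use assms in auto)
  then show ?thesis using assms by (simp add: norm_mult norm_power)
qed

lemma summable_square_of_summable:
  fixes a :: "nat \<Rightarrow> real"
  assumes "summable a" "\<And>n. a n \<ge> 0"
  shows "summable (\<lambda>n. (a n)\<^sup>2)"
proof (rule summable_comparison_test'[where N = 0])
  show "summable (\<lambda>n. suminf a * a n)"
    using assms by (intro summable_mult)
  show "norm ((a n)\<^sup>2) \<le> suminf a * a n" for n
    using sum_le_suminf[of a "{n}"] assms by (auto simp: power2_eq_square intro!: mult_right_mono)
qed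

text \<open>Working with the Parseval sum instead of \<open>integral_mean 2\<close> makes comparison
  coefficient by coefficient possible; \<open>integral_mean_2\<close> identifies the two.\<close>

definition rms :: "(nat \<Rightarrow> complex) \<Rightarrow> real \<Rightarrow> real" where
  "rms c r = sqrt (\<Sum>n. (norm (c n) * r ^ n)\<^sup>2)"

lemma everywhere_sums_square_summable:
  assumes "everywhere_sums c f" "r \<ge> 0"
  shows "summable (\<lambda>n. (norm (c n) * r ^ n)\<^sup>2)"
  using assms by (intro summable_square_of_summable everywhere_sums_norm_summable) auto

lemma rms_nonneg:
  assumes "everywhere_sums c f" "r \<ge> 0"
  shows "rms c r \<ge> 0"
  using suminf_nonneg[OF everywhere_sums_square_summable[OF assms]] by (simp add: rms_def)

lemma rms_square:
  assumes "everywhere_sums c f" "r \<ge> 0"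
  shows "(rms c r)\<^sup>2 = (\<Sum>n. (norm (c n) * r ^ n)\<^sup>2)"
  using suminf_nonneg[OF everywhere_sums_square_summable[OF assms]] by (simp add: rms_def)

lemma norm_eval_le:
  assumes "everywhere_sums c f"
  shows "norm (f z) \<le> (\<Sum>n. norm (c n) * norm z ^ n)"
proof -
  have "summable (\<lambda>n. norm (c n * z ^ n))"
    using everywhere_sums_norm_summable[OF assms, of "norm z"] by (simp add: norm_mult norm_power)
  from summable_norm[OF this] show ?thesis
    using assms by (simp add: everywhere_sums_def sums_iff norm_mult norm_power)
qed

lemma everywhere_sums_continuous:
  assumes "everywhere_sums c f"
  shows "continuous_on UNIV f"
  using assms everywhere_sums_holomorphic holomorphic_on_imp_continuous_on by blast

lemma everywhere_sums_measurable:
  assumes "everywhere_sums c f"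
  shows "f \<in> borel_measurable borel"
  by (rule borel_measurable_continuous_onI[OF everywhere_sums_continuous[OF assms]])

lemma continuous_on_circle:
  assumes "continuous_on UNIV (f :: complex \<Rightarrow> complex)"
  shows "continuous_on UNIV (\<lambda>t. f (of_real r * cis t))"
  by (rule continuous_on_compose2[OF assms]) (auto intro!: continuous_intros)

lemma circle_power_mult: "(of_real r * cis t) ^ n = of_real r ^ n * cis (real n * t)"
  by (simp add: power_mult_distrib Complex.DeMoivre)

lemma parseval_finite:
  "(\<integral>t. (norm (\<Sum>n<N. d n * cis (real n * t)))\<^sup>2 \<partial>circ) = (\<Sum>n<N. (norm (d n))\<^sup>2)"
proof -
  have int: "integrable circ (\<lambda>t. cis (real m * t) * cnj (cis (real n * t)))" for m n
    by (rule integrable_circ_continuous) (auto intro!: continuous_intros)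
  have "complex_of_real (\<integral>t. (norm (\<Sum>n<N. d n * cis (real n * t)))\<^sup>2 \<partial>circ)
      = (\<integral>t. complex_of_real ((norm (\<Sum>n<N. d n * cis (real n * t)))\<^sup>2) \<partial>circ)"
    by (rule integral_complex_of_real[symmetric])
  also have "\<dots> = (\<integral>t. (\<Sum>m<N. \<Sum>n<N. d m * cnj (d n) * (cis (real m * t) * cnj (cis (real n * t)))) \<partial>circ)"
    by (intro Bochner_Integration.integral_cong refl)
       (simp add: complex_norm_square sum_product mult_ac del: of_real_power)
  also have "\<dots> = (\<Sum>m<N. \<Sum>n<N. d m * cnj (d n) * (if m = n then 1 else 0))"
    using int by (simp add: circ_orthogonality)
  also have "\<dots> = (\<Sum>m<N. d m * cnj (d m))"
    by (intro sum.cong refl) (simp add: sum.delta' if_distrib[of "\<lambda>x. _ * x"] cong: if_cong)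
  also have "\<dots> = complex_of_real (\<Sum>n<N. (norm (d n))\<^sup>2)"
    by (simp add: complex_norm_square del: of_real_power)
  finally show ?thesis by (simp only: of_real_eq_iff)
qed

text \<open>Dominated convergence from trigonometric polynomials: the absolutely convergent sum of
  the \<open>norm (d n)\<close> bounds all partial sums at once.\<close>

lemma parseval:
  assumes f: "everywhere_sums c f" and r: "r \<ge> 0"
  shows "(\<integral>t. (norm (f (of_real r * cis t)))\<^sup>2 \<partial>circ) = (rms c r)\<^sup>2"
proof -
  define d where "d n = c n * of_real r ^ n" for n
  have d: "norm (d n) = norm (c n) * r ^ n" for n
    using r by (simp add: d_def norm_mult norm_power)
  define s where "s N t = (\<Sum>n<N. d n * cis (real n * t))" for N t
  have lim: "(\<lambda>N. s N t) \<longlonglongrightarrow> f (of_real r * cis t)" for t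
    using spec[OF f[unfolded everywhere_sums_def sums_def], of "of_real r * cis t"]
    by (simp add: s_def d_def circle_power_mult mult.assoc)
  have summ: "summable (\<lambda>n. norm (d n))"
    using everywhere_sums_norm_summable[OF f r] by (simp add: d)
  have bound: "norm (s N t) \<le> (\<Sum>n. norm (d n))" for N t
  proof -
    have "norm (s N t) \<le> (\<Sum>n<N. norm (d n))"
      unfolding s_def by (rule order_trans[OF norm_sum]) (simp add: norm_mult)
    also have "\<dots> \<le> (\<Sum>n. norm (d n))"
      by (rule sum_le_suminf[OF summ]) auto
    finally show ?thesis .
  qed
  have [measurable]: "s N \<in> borel_measurable borel" for N
    unfolding s_def by (intro borel_measurable_continuous_onI continuous_intros)
  have [measurable]: "(\<lambda>t. f (of_real r * cis t)) \<in> borel_measurable borel"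
    by (rule borel_measurable_continuous_onI[OF continuous_on_circle[OF everywhere_sums_continuous[OF f]]])
  have "(\<lambda>N. \<integral>t. (norm (s N t))\<^sup>2 \<partial>circ) \<longlonglongrightarrow> (\<integral>t. (norm (f (of_real r * cis t)))\<^sup>2 \<partial>circ)"
  proof (rule integral_dominated_convergence[where w = "\<lambda>_. (\<Sum>n. norm (d n))\<^sup>2"])
    show "AE x in circ. (\<lambda>i. (norm (s i x))\<^sup>2) \<longlonglongrightarrow> (norm (f (of_real r * cis x)))\<^sup>2"
      using lim by (auto intro!: tendsto_intros)
    show "AE x in circ. norm ((norm (s i x))\<^sup>2) \<le> (\<Sum>n. norm (d n))\<^sup>2" for i
      using bound by (auto intro!: power_mono)
  qed auto
  moreover have "(\<lambda>N. \<integral>t. (norm (s N t))\<^sup>2 \<partial>circ) \<longlonglongrightarrow> (\<Sum>n. (norm (c n) * r ^ n)\<^sup>2)"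
    using summable_LIMSEQ[OF everywhere_sums_square_summable[OF f r]]
    unfolding s_def parseval_finite d .
  ultimately show ?thesis
    unfolding rms_square[OF f r] by (rule LIMSEQ_unique)
qed

section \<open>Monotonicity and interpolation of p-means on a circle\<close>

lemma borel_measurable_circle:
  assumes [measurable]: "f \<in> borel_measurable borel"
  shows "(\<lambda>t. norm (f (complex_of_real r * cis t)) powr p) \<in> borel_measurable borel"
proof -
  have [measurable]: "cis \<in> borel_measurable borel"
    by (intro borel_measurable_continuous_onI continuous_intros)
  show ?thesis by measurable
qed

lemma integral_mean_circ:
  assumes "f \<in> borel_measurable borel"
  shows "integral_mean p f r = (\<integral>t. norm (f (of_real r * cis t)) powr p \<partial>circ) powr (1 / p)"
  by (simp add: integral_circ[OF borel_measurable_circle[OF assms]] integral_mean_def)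

lemma integral_mean_nonneg [simp]: "integral_mean p f r \<ge> 0"
  by (simp add: integral_mean_def)

lemma integral_mean_powr:
  assumes "f \<in> borel_measurable borel" "p > 0"
  shows "integral_mean p f r powr p = (\<integral>t. norm (f (of_real r * cis t)) powr p \<partial>circ)"
  using assms by (simp add: integral_mean_circ powr_powr)

lemma integrable_circle_powr:
  fixes f :: "complex \<Rightarrow> complex"
  assumes "continuous_on UNIV f" "p > 0"
  shows "integrable circ (\<lambda>t. norm (f (complex_of_real r * cis t)) powr p)"
proof (rule integrable_circ_continuous, rule continuous_on_powr')
  show "continuous_on UNIV (\<lambda>t. norm (f (complex_of_real r * cis t)))"
    by (rule continuous_on_norm[OF continuous_on_circle[OF assms(1)]])
qed (use assms in auto)

lemma integral_mean_2:
  assumes f: "everywhere_sums c f" and r: "r \<ge> 0"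
  shows "integral_mean 2 f r = rms c r"
proof -
  have "f \<in> borel_measurable borel"
    using everywhere_sums_continuous[OF f] by (rule borel_measurable_continuous_onI)
  then have "integral_mean 2 f r powr 2 = (rms c r)\<^sup>2"
    using parseval[OF f r] by (subst integral_mean_powr) simp_all
  then have "(integral_mean 2 f r)\<^sup>2 = (rms c r)\<^sup>2" by simp
  then show ?thesis
    by (rule power2_eq_imp_eq) (simp_all add: rms_nonneg[OF f r])
qed

lemma young_powr:
  fixes y \<theta> :: real
  assumes "y \<ge> 0" "0 < \<theta>" "\<theta> \<le> 1"
  shows "y powr \<theta> \<le> \<theta> * y + (1 - \<theta>)"
proof (cases "y = 0")
  case False
  then show ?thesis using Youngs_inequality_0[of \<theta> "1 - \<theta>" y 1] assms by simp
qed (use assms in auto)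

text \<open>Normalize by the \<open>s\<close>-mean and apply the weighted arithmetic-geometric
  inequality \<open>young_powr\<close> pointwise; integration turns its right-hand side into at most
  1.\<close>

lemma integral_mean_mono:
  assumes f: "continuous_on UNIV f" and p: "0 < p" "p \<le> s"
  shows "integral_mean p f r \<le> integral_mean s f r"
proof -
  have s: "s > 0" using p by linarith
  have meas: "f \<in> borel_measurable borel"
    using f by (rule borel_measurable_continuous_onI)
  define g where "g t = norm (f (of_real r * cis t))" for t
  define A where "A = (\<integral>t. g t powr s \<partial>circ)"
  have int: "integrable circ (\<lambda>t. g t powr u)" if "u > 0" for u
    unfolding g_def using integrable_circle_powr[OF f that] .
  have A0: "A \<ge> 0" unfolding A_def by (rule Bochner_Integration.integral_nonneg) auto
  have key: "(\<integral>t. g t powr p \<partial>circ) \<le> B powr (p / s)" if B: "B \<ge> A" "B > 0" for B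
  proof -
    have pt: "g t powr p \<le> B powr (p / s) * ((p / s) * (g t powr s / B) + (1 - p / s))" for t
    proof -
      have "(g t powr s / B) powr (p / s) \<le> (p / s) * (g t powr s / B) + (1 - p / s)"
        using p s B by (intro young_powr) auto
      moreover have "(g t powr s / B) powr (p / s) = g t powr p / B powr (p / s)"
        using s B by (simp add: powr_divide powr_powr)
      ultimately show ?thesis using B by (simp add: field_simps)
    qed
    have "(\<integral>t. g t powr p \<partial>circ)
        \<le> (\<integral>t. B powr (p / s) * ((p / s) * (g t powr s / B) + (1 - p / s)) \<partial>circ)"
      by (rule integral_mono) (use int p s pt in auto)
    also have "\<dots> = B powr (p / s) * ((p / s) * (A / B) + (1 - p / s))"
      using int[OF s] circ.prob_space by (simp add: A_def)
    also have "\<dots> \<le> B powr (p / s) * ((p / s) * 1 + (1 - p / s))"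
      using B p s by (intro mult_left_mono add_right_mono) auto
    finally show ?thesis by simp
  qed
  have "(\<integral>t. g t powr p \<partial>circ) \<le> A powr (p / s)"
  proof (cases "A = 0")
    case True
    have "(\<integral>t. g t powr p \<partial>circ) \<le> 0 + e" if "e > 0" for e
      using key[of "e powr (s / p)"] that p s by (simp add: True powr_powr)
    then have "(\<integral>t. g t powr p \<partial>circ) \<le> 0" by (rule field_le_epsilon)
    then show ?thesis by (simp add: True)
  qed (use key[of A] A0 in auto)
  then have "(\<integral>t. g t powr p \<partial>circ) powr (1 / p) \<le> (A powr (p / s)) powr (1 / p)"
    using p by (intro powr_mono2) (auto intro!: Bochner_Integration.integral_nonneg)
  then show ?thesis
    using p s by (simp add: integral_mean_circ[OF meas] g_def A_def powr_powr)
qed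

text \<open>In \<open>g powr 2 = g powr (2 - p) * g powr p\<close> the first factor is replaced by
  its maximum; \<open>p \<le> 2\<close> keeps that exponent nonnegative.\<close>

lemma rms_interpolation:
  assumes f: "everywhere_sums c f" and r: "r \<ge> 0" and p: "0 < p" "p \<le> 2"
    and H: "\<And>t. norm (f (of_real r * cis t)) \<le> H"
  shows "(rms c r)\<^sup>2 \<le> H powr (2 - p) * integral_mean p f r powr p"
proof -
  have cont: "continuous_on UNIV f" by (rule everywhere_sums_continuous[OF f])
  define g where "g t = norm (f (of_real r * cis t))" for t
  have int: "integrable circ (\<lambda>t. g t powr u)" if "u > 0" for u
    unfolding g_def using integrable_circle_powr[OF cont that] .
  have pt: "g t powr 2 \<le> H powr (2 - p) * g t powr p" for t
  proof (cases "g t = 0")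
    case False
    then have g: "g t > 0" by (simp add: g_def)
    have "g t powr 2 = g t powr (2 - p) * g t powr p"
      by (simp flip: powr_add)
    also have "\<dots> \<le> H powr (2 - p) * g t powr p"
      using p g H[of t] by (intro mult_right_mono powr_mono2) (auto simp: g_def)
    finally show ?thesis .
  qed (use p in auto)
  have "(rms c r)\<^sup>2 = (\<integral>t. g t powr 2 \<partial>circ)"
    using parseval[OF f r] by (simp add: g_def)
  also have "\<dots> \<le> (\<integral>t. H powr (2 - p) * g t powr p \<partial>circ)"
    by (rule integral_mono) (use int p pt in auto)
  also have "\<dots> = H powr (2 - p) * integral_mean p f r powr p"
    using p by (simp add: integral_mean_powr borel_measurable_continuous_onI[OF cont] g_def)
  finally show ?thesis .
qed

lemma borel_measurable_integral_mean:
  assumes [measurable]: "f \<in> borel_measurable borel"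
  shows "integral_mean p f \<in> borel_measurable borel"
proof -
  have [measurable]: "cis \<in> borel_measurable borel"
    by (intro borel_measurable_continuous_onI continuous_intros)
  show ?thesis
    unfolding integral_mean_def[abs_def] set_lebesgue_integral_def by measurable
qed

section \<open>Local comparison of mean square and p-means\<close>

text \<open>In the variable \<open>r\<^sup>2\<close> the Parseval sum is a power series with
  infinite radius of convergence. Continuity lets the maximum in the local comparison be
  attained.\<close>

lemma continuous_on_rms:
  assumes f: "everywhere_sums c f"
  shows "continuous_on {0..} (rms c)"
proof -
  have summ: "summable (\<lambda>n. (norm (c n))\<^sup>2 * y ^ n)" for y :: real
  proof (rule summable_norm_cancel)
    have "sqrt \<bar>y\<bar> ^ (n * 2) = \<bar>y\<bar> ^ n" for n
      by (simp add: mult.commute[of n] power_mult)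
    then show "summable (\<lambda>n. norm ((norm (c n))\<^sup>2 * y ^ n))"
      using everywhere_sums_square_summable[OF f, of "sqrt \<bar>y\<bar>"]
      by (simp add: power_mult_distrib norm_mult norm_power abs_mult power_abs flip: power_mult)
  qed
  have "continuous_on UNIV (\<lambda>y. \<Sum>n. (norm (c n))\<^sup>2 * y ^ n)"
    using isCont_powser_converges_everywhere[OF summ] by (simp add: continuous_at_imp_continuous_on)
  then have "continuous_on {0..} (\<lambda>r::real. \<Sum>n. (norm (c n))\<^sup>2 * (r\<^sup>2) ^ n)"
    by (rule continuous_on_compose2) (auto intro!: continuous_intros)
  moreover have "(\<Sum>n. (norm (c n))\<^sup>2 * (r\<^sup>2) ^ n) = (\<Sum>n. (norm (c n) * r ^ n)\<^sup>2)" for r :: real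
    by (simp add: power_mult_distrib mult.commute flip: power_mult)
  ultimately show ?thesis
    unfolding rms_def[abs_def] by (intro continuous_on_real_sqrt) simp
qed

abbreviation gauss :: "real \<Rightarrow> real \<Rightarrow> real" where
  "gauss \<alpha> r \<equiv> exp (- (\<alpha> / 2) * r\<^sup>2)"

abbreviation gauss_mean :: "real \<Rightarrow> real \<Rightarrow> (complex \<Rightarrow> complex) \<Rightarrow> real \<Rightarrow> real" where
  "gauss_mean \<alpha> p f r \<equiv> integral_mean p f r * gauss \<alpha> r"

abbreviation gauss_rms :: "real \<Rightarrow> (nat \<Rightarrow> complex) \<Rightarrow> real \<Rightarrow> real" where
  "gauss_rms \<alpha> c r \<equiv> rms c r * gauss \<alpha> r"

text \<open>The weighted power peaks at \<open>r\<^sup>2 = n / \<alpha>\<close>; a step of size \<open>h\<close> towards the peak gains a factor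
  exponential in the distance from it.\<close>

lemma weighted_power_shift:
  fixes \<alpha> h r :: real
  assumes \<alpha>: "\<alpha> > 0" and h: "0 < h" "h \<le> 1" and r: "r \<ge> 2"
  shows "r ^ n * gauss \<alpha> r
    \<le> exp (3 * \<alpha>) * exp (- (h / (2 * r)) * \<bar>real n - \<alpha> * r\<^sup>2\<bar>)
        * ((r + h) ^ n * gauss \<alpha> (r + h) + (r - h) ^ n * gauss \<alpha> (r - h))"
proof -
  define x where "x = h / r"
  have x: "0 < x" "x \<le> 1 / 2" and rx: "r * x = h"
    using h r by (auto simp: x_def field_simps)
  have h2: "h\<^sup>2 \<le> 1" using h by (simp add: power_le_one)
  \<comment> \<open>Serves both directions, \<open>s = h\<close> and \<open>s = - h\<close>: after
    taking logarithms the claim is the nonnegativity of a single exponent.\<close>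
  have shift: "r ^ n * gauss \<alpha> r
      \<le> exp (3 * \<alpha>) * exp (- (h / (2 * r)) * \<bar>real n - \<alpha> * r\<^sup>2\<bar>) * ((r + s) ^ n * gauss \<alpha> (r + s))"
    if s: "r + s > 0" and le: "0 \<le> 3 * \<alpha> - x / 2 * \<bar>real n - \<alpha> * r\<^sup>2\<bar> + real n * ln (1 + s / r) - (\<alpha> / 2) * (2 * r * s + s\<^sup>2)" for s
  proof -
    have pos: "1 + s / r > 0" using s r by (simp add: field_simps)
    have eq: "(r + s) ^ n = r ^ n * exp (real n * ln (1 + s / r))"
    proof -
      have "r + s = r * (1 + s / r)" using r by (simp add: field_simps)
      then have "(r + s) ^ n = r ^ n * (1 + s / r) ^ n" by (simp add: power_mult_distrib)
      then show ?thesis using pos by (simp add: exp_of_nat_mult)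
    qed
    have hx: "h / (2 * r) = x / 2" by (simp add: x_def)
    have "r ^ n * gauss \<alpha> r \<le> r ^ n * (gauss \<alpha> r *
       exp (3 * \<alpha> - x / 2 * \<bar>real n - \<alpha> * r\<^sup>2\<bar> + real n * ln (1 + s / r) - (\<alpha> / 2) * (2 * r * s + s\<^sup>2)))"
      using le r by (intro mult_left_mono) auto
    also have "\<dots> = exp (3 * \<alpha>) * exp (- (h / (2 * r)) * \<bar>real n - \<alpha> * r\<^sup>2\<bar>) * ((r + s) ^ n * gauss \<alpha> (r + s))"
      unfolding eq hx by (simp add: mult_ac power2_sum algebra_simps flip: exp_add)
    finally show ?thesis .
  qed
  have nonneg: "(r + h) ^ n * gauss \<alpha> (r + h) \<ge> 0" "(r - h) ^ n * gauss \<alpha> (r - h) \<ge> 0"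
    using r h by auto
  define A where "A = \<alpha> * h\<^sup>2"
  have A: "0 \<le> A" "A \<le> \<alpha>" using h2 \<alpha> by (auto simp: A_def)
  have r2: "\<alpha> * r\<^sup>2 * x = \<alpha> * r * h" "\<alpha> * r\<^sup>2 * x\<^sup>2 = A"
    by (auto simp: A_def power2_eq_square rx[symmetric])
  have r2: "\<alpha> * (x * r\<^sup>2) = \<alpha> * (h * r)" "\<alpha> * (r\<^sup>2 * x\<^sup>2) = A"
    using r2 by (simp_all add: mult_ac)
  show ?thesis
  \<comment> \<open>The peak lies at or outside radius \<open>r\<close> in the first case and inside
    it in the second, so the step goes outward or inward.\<close>
  proof (cases "real n \<ge> \<alpha> * r\<^sup>2")
    case True
    have L: "x - x\<^sup>2 \<le> ln (1 + x)" using x by (intro ln_one_plus_pos_lower_bound) auto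
    moreover have "x * x \<le> 1 / 2 * x" using x by (intro mult_right_mono) auto
    ultimately have L': "x / 2 \<le> ln (1 + x)" by (simp add: power2_eq_square)
    \<comment> \<open>Split \<open>n\<close> into \<open>\<alpha> * r\<^sup>2\<close> and the
      excess. The first part needs the second-order bound on the logarithm, because its linear term
      has to cancel against the weight; for the excess the slope 1/2 suffices, and it becomes the
      exponential gain.\<close>
    have "\<alpha> * r\<^sup>2 * (x - x\<^sup>2) + (real n - \<alpha> * r\<^sup>2) * (x / 2) \<le> \<alpha> * r\<^sup>2 * ln (1 + x) + (real n - \<alpha> * r\<^sup>2) * ln (1 + x)"
      using L L' True \<alpha> by (intro add_mono mult_left_mono) auto
    then have "\<alpha> * r * h - A + (real n - \<alpha> * r\<^sup>2) * (x / 2) \<le> real n * ln (1 + x)"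
      using r2 \<alpha> by (simp add: algebra_simps)
    moreover have "(\<alpha> / 2) * (2 * r * h + h\<^sup>2) = \<alpha> * r * h + A / 2"
      by (simp add: A_def algebra_simps)
    moreover have "x / 2 * \<bar>real n - \<alpha> * r\<^sup>2\<bar> = (real n - \<alpha> * r\<^sup>2) * (x / 2)"
      using True by simp
    ultimately have "0 \<le> 3 * \<alpha> - x / 2 * \<bar>real n - \<alpha> * r\<^sup>2\<bar> + real n * ln (1 + x) - (\<alpha> / 2) * (2 * r * h + h\<^sup>2)"
      using A by linarith
    then have "r ^ n * gauss \<alpha> r
      \<le> exp (3 * \<alpha>) * exp (- (h / (2 * r)) * \<bar>real n - \<alpha> * r\<^sup>2\<bar>) * ((r + h) ^ n * gauss \<alpha> (r + h))"
      using shift[of h] h r by (simp add: x_def)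
    also have "\<dots> \<le> exp (3 * \<alpha>) * exp (- (h / (2 * r)) * \<bar>real n - \<alpha> * r\<^sup>2\<bar>)
        * ((r + h) ^ n * gauss \<alpha> (r + h) + (r - h) ^ n * gauss \<alpha> (r - h))"
      using nonneg by (intro mult_left_mono) auto
    finally show ?thesis .
  next
    case False
    have L: "- x - 2 * x\<^sup>2 \<le> ln (1 - x)" using x by (intro ln_one_minus_pos_lower_bound) auto
    have L': "x / 2 \<le> - ln (1 - x)" using ln_le_minus_one[of "1 - x"] x by simp
    have "\<alpha> * r\<^sup>2 * (- x - 2 * x\<^sup>2) + (\<alpha> * r\<^sup>2 - real n) * (x / 2) \<le> \<alpha> * r\<^sup>2 * ln (1 - x) + (\<alpha> * r\<^sup>2 - real n) * (- ln (1 - x))"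
      using L L' False \<alpha> by (intro add_mono mult_left_mono) auto
    then have "- (\<alpha> * r * h) - 2 * A + (\<alpha> * r\<^sup>2 - real n) * (x / 2) \<le> real n * ln (1 - x)"
      using r2 \<alpha> by (simp add: algebra_simps)
    moreover have "(\<alpha> / 2) * (2 * r * (- h) + (- h)\<^sup>2) = - (\<alpha> * r * h) + A / 2"
      by (simp add: A_def algebra_simps)
    moreover have "x / 2 * \<bar>real n - \<alpha> * r\<^sup>2\<bar> = (\<alpha> * r\<^sup>2 - real n) * (x / 2)"
      using False by simp
    \<comment> \<open>The loss here is \<open>5 / 2 * A\<close>, against \<open>3 / 2 * A\<close> in
      the outward case, and \<open>A \<le> \<alpha>\<close>; the factor
      \<open>exp (3 * \<alpha>)\<close> covers both.\<close>
    ultimately have "0 \<le> 3 * \<alpha> - x / 2 * \<bar>real n - \<alpha> * r\<^sup>2\<bar> + real n * ln (1 - x) - (\<alpha> / 2) * (2 * r * (- h) + (- h)\<^sup>2)"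
      using A by linarith
    then have "r ^ n * gauss \<alpha> r
      \<le> exp (3 * \<alpha>) * exp (- (h / (2 * r)) * \<bar>real n - \<alpha> * r\<^sup>2\<bar>) * ((r - h) ^ n * gauss \<alpha> (r - h))"
      using shift[of "- h"] h r by (simp add: x_def)
    also have "\<dots> \<le> exp (3 * \<alpha>) * exp (- (h / (2 * r)) * \<bar>real n - \<alpha> * r\<^sup>2\<bar>)
        * ((r + h) ^ n * gauss \<alpha> (r + h) + (r - h) ^ n * gauss \<alpha> (r - h))"
      using nonneg by (intro mult_left_mono) auto
    finally show ?thesis .
  qed
qed

text \<open>Rounding \<open>\<nu>\<close> down to the integer \<open>m\<close> costs a factor of at
  most \<open>exp u \<le> 3\<close>, and each of the two one-sided geometric series sums to at most
  \<open>2 / u\<close>; together this is 12 over \<open>u\<close>.\<close>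

lemma sum_two_sided_geometric:
  fixes u \<nu> :: real
  assumes u: "0 < u" "u \<le> 1" and \<nu>: "\<nu> \<ge> 0"
  shows "(\<Sum>n<N. exp (- u * \<bar>real n - \<nu>\<bar>)) \<le> 12 / u"
proof -
  define m where "m = nat \<lfloor>\<nu>\<rfloor>"
  have m: "real m \<le> \<nu>" "\<nu> \<le> real m + 1"
    using \<nu> by (auto simp: m_def)
  define x where "x = exp (- u)"
  have x: "0 < x" "x < 1" using u by (auto simp: x_def)
  have "x \<le> 1 / (1 + u)"
    using exp_ge_add_one_self[of u] u by (simp add: x_def exp_minus field_simps)
  also have "\<dots> \<le> 1 - u / 2"
    using u mult_left_mono[of u 1 u] by (simp add: field_simps)
  finally have x1: "1 / (1 - x) \<le> 2 / u"
    using u x by (simp add: field_simps)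
  have geom: "(\<Sum>i<k. x ^ i) \<le> 2 / u" for k
  proof -
    have "(\<Sum>i<k. x ^ i) \<le> (\<Sum>i. x ^ i)"
      using x by (intro sum_le_suminf summable_geometric) auto
    also have "\<dots> = 1 / (1 - x)" using x by (intro suminf_geometric) auto
    finally show ?thesis using x1 by simp
  qed
  have lower: "exp (- u * \<bar>real n - \<nu>\<bar>) \<le> exp u * x ^ (m - Suc n)" if "n < m" for n
  proof -
    have "- u * \<bar>real n - \<nu>\<bar> \<le> u + real (m - Suc n) * (- u)"
    proof -
      have "u * (real n - \<nu>) \<le> u * (real n - real m + 2)"
        using u m by (intro mult_left_mono) auto
      then show ?thesis using that m by (simp add: of_nat_diff abs_if algebra_simps)
    qed
    then have "exp (- u * \<bar>real n - \<nu>\<bar>) \<le> exp (u + real (m - Suc n) * (- u))" by simp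
    also have "\<dots> = exp u * x ^ (m - Suc n)"
      unfolding x_def exp_add exp_of_nat_mult ..
    finally show ?thesis .
  qed
  have upper: "exp (- u * \<bar>real (i + m) - \<nu>\<bar>) \<le> exp u * x ^ i" for i
  proof -
    have "- u * \<bar>real (i + m) - \<nu>\<bar> \<le> u + real i * (- u)"
    proof -
      have "u * (real i - 1) \<le> u * \<bar>real (i + m) - \<nu>\<bar>"
        using u m by (intro mult_left_mono) auto
      then show ?thesis by (simp add: algebra_simps)
    qed
    then have "exp (- u * \<bar>real (i + m) - \<nu>\<bar>) \<le> exp (u + real i * (- u))" by simp
    also have "\<dots> = exp u * x ^ i"
      unfolding x_def exp_add exp_of_nat_mult ..
    finally show ?thesis .
  qed
  \<comment> \<open>The range is enlarged to all indices below \<open>m\<close> and \<open>N\<close>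
    indices from \<open>m\<close> on, which covers \<open>{..<N}\<close> whichever of
    \<open>m\<close> and \<open>N\<close> is larger.\<close>
  have "(\<Sum>n<N. exp (- u * \<bar>real n - \<nu>\<bar>)) \<le> (\<Sum>n\<in>{..<m} \<union> {0 + m..<N + m}. exp (- u * \<bar>real n - \<nu>\<bar>))"
    by (rule sum_mono2) auto
  also have "\<dots> = (\<Sum>n<m. exp (- u * \<bar>real n - \<nu>\<bar>)) + (\<Sum>i\<in>{0..<N}. exp (- u * \<bar>real (i + m) - \<nu>\<bar>))"
    using sum.shift_bounds_nat_ivl[of "\<lambda>n. exp (- u * \<bar>real n - \<nu>\<bar>)" 0 m N]
    by (subst sum.union_disjoint) auto
  also have "\<dots> \<le> (\<Sum>n<m. exp u * x ^ (m - Suc n)) + (\<Sum>i\<in>{0..<N}. exp u * x ^ i)"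
    using lower upper by (intro add_mono sum_mono) auto
  also have "\<dots> = exp u * ((\<Sum>i<m. x ^ i) + (\<Sum>i<N. x ^ i))"
    by (simp add: sum_distrib_left distrib_left sum.nat_diff_reindex[of "\<lambda>i. exp u * x ^ i"] atLeast0LessThan)
  also have "\<dots> \<le> 3 * (2 / u + 2 / u)"
  proof (intro mult_mono add_mono geom)
    have "exp u \<le> exp 1" using u by simp
    then show "exp u \<le> 3" using exp_le by linarith
  qed (use x in \<open>auto intro!: add_nonneg_nonneg sum_nonneg\<close>)
  finally show ?thesis by simp
qed


lemma weighted_coefficient_shift:
  fixes \<alpha> h r :: real
  assumes "\<alpha> > 0" "0 < h" "h \<le> 1" "r \<ge> 2"
  shows "norm (c n) * r ^ n * gauss \<alpha> r
    \<le> exp (3 * \<alpha>) * exp (- (h / (2 * r)) * \<bar>real n - \<alpha> * r\<^sup>2\<bar>)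
        * (norm (c n) * (r + h) ^ n * gauss \<alpha> (r + h)
           + norm (c n) * (r - h) ^ n * gauss \<alpha> (r - h))"
  using mult_left_mono[OF weighted_power_shift[OF assms, of n] norm_ge_zero[of "c n"]]
  by (simp add: algebra_simps)

lemma weighted_rms_sums:
  assumes f: "everywhere_sums c f" and r: "r \<ge> 0"
  shows "(\<lambda>n. (norm (c n) * r ^ n * gauss \<alpha> r)\<^sup>2) sums (gauss_rms \<alpha> c r)\<^sup>2"
  using sums_mult2[OF summable_sums[OF everywhere_sums_square_summable[OF f r]], of "(gauss \<alpha> r)\<^sup>2"]
  by (simp add: rms_square[OF f r] power_mult_distrib)

text \<open>The first estimate discards the decay factor. The second is Cauchy--Schwarz between that
  factor and the shifted coefficients, so \<open>r / h\<close> counts the indices that matter; its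
  left side dominates \<open>f\<close> on the whole circle. The constant 24 is 12 from the geometric
  sum times 2 from the square of a sum.\<close>

lemma weighted_rms_shift:
  fixes \<alpha> h r :: real
  assumes f: "everywhere_sums c f" and \<alpha>: "\<alpha> > 0" and h: "0 < h" "h \<le> 1" and r: "r \<ge> 2"
  defines "G \<equiv> \<lambda>r. gauss_rms \<alpha> c r"
  shows "(G r)\<^sup>2 \<le> 2 * exp (6 * \<alpha>) * ((G (r + h))\<^sup>2 + (G (r - h))\<^sup>2)"
    and "((\<Sum>n. norm (c n) * r ^ n) * gauss \<alpha> r)\<^sup>2
           \<le> 24 * exp (6 * \<alpha>) * (r / h) * ((G (r + h))\<^sup>2 + (G (r - h))\<^sup>2)"
proof -
  define b where "b r n = norm (c n) * r ^ n * gauss \<alpha> r" for r n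
  define e where "e n = exp (- (h / (2 * r)) * \<bar>real n - \<alpha> * r\<^sup>2\<bar>)" for n
  define x where "x n = b (r + h) n + b (r - h) n" for n
  have b0: "b s n \<ge> 0" if "s \<ge> 0" for s n using that by (simp add: b_def)
  have x0: "x n \<ge> 0" for n unfolding x_def using b0 h r by (intro add_nonneg_nonneg) auto
  have e: "0 < e n" "e n \<le> 1" for n using h r by (auto simp: e_def)
  have sq: "(exp (3 * \<alpha>))\<^sup>2 = exp (6 * \<alpha>)"
    by (simp flip: exp_double)
  have bx: "b r n \<le> exp (3 * \<alpha>) * (e n * x n)" for n
    using weighted_coefficient_shift[OF \<alpha> h r, of c n] by (simp add: b_def e_def x_def mult.assoc)
  have bsums: "(\<lambda>n. (b s n)\<^sup>2) sums (G s)\<^sup>2" if "s \<ge> 0" for s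
    unfolding b_def G_def by (rule weighted_rms_sums[OF f that])
  have xsq: "(x n)\<^sup>2 \<le> 2 * ((b (r + h) n)\<^sup>2 + (b (r - h) n)\<^sup>2)" for n
    using sum_squares_ge_zero[of "b (r + h) n - b (r - h) n" 0] unfolding x_def
    by (simp add: power2_eq_square algebra_simps)
  define T where "T = (G (r + h))\<^sup>2 + (G (r - h))\<^sup>2"
  have Tsums: "(\<lambda>n. 2 * ((b (r + h) n)\<^sup>2 + (b (r - h) n)\<^sup>2)) sums (2 * T)"
    unfolding T_def using h r by (intro sums_mult sums_add bsums) auto
  have T0: "T \<ge> 0" by (simp add: T_def)
  have "(b r n)\<^sup>2 \<le> exp (6 * \<alpha>) * (2 * ((b (r + h) n)\<^sup>2 + (b (r - h) n)\<^sup>2))" for n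
  proof -
    have "b r n \<le> exp (3 * \<alpha>) * x n"
      using bx[of n] e[of n] x0[of n] mult_right_mono[of "e n" 1 "x n"] by (smt (verit) exp_gt_zero mult_left_mono)
    then have "(b r n)\<^sup>2 \<le> (exp (3 * \<alpha>) * x n)\<^sup>2"
      using b0[of r n] r by (intro power_mono) auto
    also have "\<dots> = exp (6 * \<alpha>) * (x n)\<^sup>2" by (simp add: power_mult_distrib sq)
    also have "\<dots> \<le> exp (6 * \<alpha>) * (2 * ((b (r + h) n)\<^sup>2 + (b (r - h) n)\<^sup>2))"
      using xsq by (intro mult_left_mono) auto
    finally show ?thesis .
  qed
  from sums_le[OF this bsums sums_mult[OF Tsums]] r
  show "(G r)\<^sup>2 \<le> 2 * exp (6 * \<alpha>) * ((G (r + h))\<^sup>2 + (G (r - h))\<^sup>2)"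
    by (simp add: T_def algebra_simps)
  have part: "(\<Sum>n<N. b r n)\<^sup>2 \<le> 24 * exp (6 * \<alpha>) * (r / h) * T" for N
  proof -
    have "(\<Sum>n<N. b r n) \<le> (\<Sum>n<N. exp (3 * \<alpha>) * (e n * x n))"
      using bx by (intro sum_mono)
    then have "(\<Sum>n<N. b r n)\<^sup>2 \<le> (exp (3 * \<alpha>) * (\<Sum>n<N. e n * x n))\<^sup>2"
      using b0 r by (intro power_mono sum_nonneg) (auto simp: sum_distrib_left)
    also have "\<dots> = exp (6 * \<alpha>) * (\<Sum>n<N. e n * x n)\<^sup>2" by (simp add: power_mult_distrib sq)
    also have "\<dots> \<le> exp (6 * \<alpha>) * ((\<Sum>n<N. (e n)\<^sup>2) * (\<Sum>n<N. (x n)\<^sup>2))"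
      by (intro mult_left_mono Cauchy_Schwarz_ineq_sum) auto
    also have "\<dots> \<le> exp (6 * \<alpha>) * ((12 / (h / r)) * (2 * T))"
    proof (intro mult_left_mono mult_mono)
      \<comment> \<open>Squaring doubles the exponent, hence the 2 in \<open>h / (2 * r)\<close>:
        the two-sided sum is applied with parameter \<open>h / r \<le> 1\<close>.\<close>
      have "(e n)\<^sup>2 = exp (- (h / r) * \<bar>real n - \<alpha> * r\<^sup>2\<bar>)" for n
        unfolding e_def by (simp flip: exp_double)
      then show "(\<Sum>n<N. (e n)\<^sup>2) \<le> 12 / (h / r)"
        using sum_two_sided_geometric[of "h / r" "\<alpha> * r\<^sup>2" N] h r \<alpha> by (simp add: field_simps)
      have "(\<Sum>n<N. (x n)\<^sup>2) \<le> (\<Sum>n<N. 2 * ((b (r + h) n)\<^sup>2 + (b (r - h) n)\<^sup>2))"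
        by (intro sum_mono xsq)
      also have "\<dots> \<le> 2 * T"
        using Tsums sum_le_suminf[OF sums_summable[OF Tsums], of "{..<N}"] by (simp add: sums_iff)
      finally show "(\<Sum>n<N. (x n)\<^sup>2) \<le> 2 * T" .
    qed (use h r T0 in \<open>auto intro!: sum_nonneg\<close>)
    finally show ?thesis by (simp add: mult_ac)
  qed
  have "(\<lambda>n. b r n) sums ((\<Sum>n. norm (c n) * r ^ n) * gauss \<alpha> r)"
    unfolding b_def using r by (intro sums_mult2 summable_sums everywhere_sums_norm_summable[OF f]) auto
  then have "(\<lambda>N. (\<Sum>n<N. b r n)\<^sup>2) \<longlonglongrightarrow> ((\<Sum>n. norm (c n) * r ^ n) * gauss \<alpha> r)\<^sup>2"
    unfolding sums_def by (rule tendsto_power)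
  then show "((\<Sum>n. norm (c n) * r ^ n) * gauss \<alpha> r)\<^sup>2
           \<le> 24 * exp (6 * \<alpha>) * (r / h) * ((G (r + h))\<^sup>2 + (G (r - h))\<^sup>2)"
    by (rule LIMSEQ_le_const2) (use part T_def in auto)
qed

lemma weighted_interpolation:
  assumes f: "everywhere_sums c f" and r: "r \<ge> 0" and p: "0 < p" "p \<le> 2"
  shows "(gauss_rms \<alpha> c r)\<^sup>2
    \<le> ((\<Sum>n. norm (c n) * r ^ n) * gauss \<alpha> r) powr (2 - p)
        * gauss_mean \<alpha> p f r powr p"
proof -
  define E where "E = gauss \<alpha> r"
  define H where "H = (\<Sum>n. norm (c n) * r ^ n)"
  have H0: "H \<ge> 0"
    unfolding H_def using r by (intro suminf_nonneg everywhere_sums_norm_summable[OF f]) auto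
  have H: "norm (f (of_real r * cis t)) \<le> H" for t
    using norm_eval_le[OF f, of "of_real r * cis t"] r by (simp add: H_def norm_mult)
  have E: "E\<^sup>2 = E powr (2 - p) * E powr p" "E > 0"
    by (simp_all add: E_def flip: powr_add)
  have "(rms c r * E)\<^sup>2 \<le> (H powr (2 - p) * integral_mean p f r powr p) * E\<^sup>2"
    unfolding power_mult_distrib by (intro mult_right_mono rms_interpolation[OF f r p H]) auto
  also have "\<dots> = (H * E) powr (2 - p) * (integral_mean p f r * E) powr p"
    using H0 E by (simp add: powr_mult)
  finally show ?thesis by (simp add: E_def H_def)
qed

lemma powr_add_le:
  fixes x y t :: real
  assumes "x \<ge> 0" "y \<ge> 0" "t > 0"
  shows "(x + y) powr t \<le> 2 powr t * (x powr t + y powr t)"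
proof -
  have "(x + y) powr t \<le> (2 * max x y) powr t"
    using assms by (intro powr_mono2) auto
  also have "\<dots> = 2 powr t * max x y powr t"
    using assms by (simp add: powr_mult)
  also have "\<dots> \<le> 2 powr t * (x powr t + y powr t)"
    by (intro mult_left_mono) (auto simp: max_def)
  finally show ?thesis .
qed


text \<open>Maximising \<open>(1 - \<bar>v\<bar>) powr \<kappa> * G (r + v)\<close> lets the local sup of \<open>G\<close> absorb itself, so that only
  values of the \<open>p\<close>-means remain on the right; \<open>\<kappa>\<close> is chosen to make the powers of \<open>d\<close> match.\<close>

lemma local_rms_bound_pointwise:
  fixes \<alpha> p q :: real
  assumes \<alpha>: "\<alpha> > 0" and p: "0 < p" "p \<le> 2" and q: "q > 0"
  defines "F \<equiv> \<lambda>f s. gauss_mean \<alpha> p f s"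
  shows "\<exists>C>0. \<forall>c f r. everywhere_sums c f \<longrightarrow> r \<ge> 4 \<longrightarrow>
    (\<exists>\<rho> d. 0 < d \<and> d \<le> 1 \<and> \<bar>\<rho> - r\<bar> \<le> 1 - d \<and>
      (\<forall>h. 0 < h \<longrightarrow> h < d / 2 \<longrightarrow>
        gauss_rms \<alpha> c r powr q
          \<le> C * r powr (q * (1 / p - 1 / 2)) * d * (F f (\<rho> + h) powr q + F f (\<rho> - h) powr q)))"
proof -
  define lam where "lam = 1 / p - 1 / 2"
  \<comment> \<open>With this exponent \<open>\<kappa> * q = q * lam + 1\<close>: the power
    \<open>q * lam\<close> of \<open>d\<close> cancels the loss from interpolation, and one factor
    \<open>d\<close> is left to pay for averaging over steps below \<open>d / 2\<close>.\<close>
  define \<kappa> where "\<kappa> = lam + 1 / q"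
  have lam0: "lam \<ge> 0" using p by (simp add: lam_def field_simps)
  have \<kappa>0: "\<kappa> > 0" using lam0 q by (simp add: \<kappa>_def add_nonneg_pos)
  \<comment> \<open>The 16 comes from a radius of at most \<open>2 * r\<close> with step
    \<open>d / 4\<close>, which gives \<open>8 * r / d\<close>, and from two equal summands;
    \<open>4 powr \<kappa>\<close> is the loss in comparing with the maximum.\<close>
  define C3 where "C3 = sqrt (24 * exp (6 * \<alpha>) * 16 * (4 powr \<kappa>)\<^sup>2)"
  have C3: "C3 > 0" by (simp add: C3_def)
  define C1 where "C1 = 2 * exp (6 * \<alpha>) * C3 powr (2 - p)"
  have C1: "C1 > 0" using C3 by (simp add: C1_def)
  define C where "C = C1 powr (q / p) * 2 powr (q / p)"
  have C: "C > 0" using C1 by (simp add: C_def)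
  show ?thesis
  proof (rule exI[of _ C], intro conjI C allI impI)
    fix c f and r :: real
    assume f: "everywhere_sums c f" and r: "r \<ge> 4"
    define G where "G = (\<lambda>r. gauss_rms \<alpha> c r)"
    have G0: "G s \<ge> 0" if "s \<ge> 0" for s
      using rms_nonneg[OF f that] by (simp add: G_def)
    show "\<exists>\<rho> d. 0 < d \<and> d \<le> 1 \<and> \<bar>\<rho> - r\<bar> \<le> 1 - d \<and>
      (\<forall>h. 0 < h \<longrightarrow> h < d / 2 \<longrightarrow>
        gauss_rms \<alpha> c r powr q
          \<le> C * r powr (q * (1 / p - 1 / 2)) * d * (F f (\<rho> + h) powr q + F f (\<rho> - h) powr q))"
    proof (cases "G r = 0")
      case True
      then show ?thesis
        using C r by (intro exI[of _ r] exI[of _ 1]) (auto simp: G_def F_def)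
    next
      case False
      then have Gr: "G r > 0" using G0[of r] r by auto
      define \<phi> where "\<phi> = (\<lambda>v. (1 - \<bar>v\<bar>) powr \<kappa> * G (r + v))"
      have "continuous_on {-1..1} (\<lambda>v. rms c (r + v))"
        using r by (intro continuous_on_compose2[OF continuous_on_rms[OF f]]) (auto intro!: continuous_intros)
      then have "continuous_on {-1..1} \<phi>"
        unfolding \<phi>_def G_def using \<kappa>0 by (intro continuous_intros continuous_on_powr') auto
      then obtain v where v: "v \<in> {-1..1}" and vmax: "\<And>w. w \<in> {-1..1} \<Longrightarrow> \<phi> w \<le> \<phi> v"
        using continuous_attains_sup[of "{-1..1::real}" \<phi>] by auto
      define d where "d = 1 - \<bar>v\<bar>"
      define g where "g = G (r + v)"
      have Grv: "G r \<le> d powr \<kappa> * g"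
        using vmax[of 0] by (simp add: \<phi>_def d_def g_def)
      have d: "0 < d" "d \<le> 1"
      proof -
        show "d \<le> 1" by (simp add: d_def)
        have "d \<noteq> 0" using Grv Gr by auto
        then show "0 < d" using v by (auto simp: d_def)
      qed
      have g: "g > 0" using Grv Gr d by (smt (verit) mult_nonneg_nonpos powr_ge_zero)
      \<comment> \<open>Where the tent \<open>1 - \<bar>w\<bar>\<close> is at least a quarter of its
        height \<open>d\<close> at the maximizer, \<open>G\<close> can exceed \<open>g\<close> by a
        bounded factor only.\<close>
      have Gw: "G (r + w) \<le> 4 powr \<kappa> * g" if w: "d / 4 \<le> 1 - \<bar>w\<bar>" for w
      proof -
        have "(d / 4) powr \<kappa> * G (r + w) \<le> (1 - \<bar>w\<bar>) powr \<kappa> * G (r + w)"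
          using w d \<kappa>0 r by (intro mult_right_mono powr_mono2 G0) auto
        also have "\<dots> \<le> d powr \<kappa> * g"
        proof -
          have "\<bar>w\<bar> \<le> 1" using w d by linarith
          then have "w \<in> {-1..1}" by (simp add: abs_le_iff)
          from vmax[OF this] show ?thesis by (simp add: \<phi>_def d_def g_def)
        qed
        finally have "d powr \<kappa> * G (r + w) \<le> d powr \<kappa> * (4 powr \<kappa> * g)"
          using d by (simp add: powr_divide field_simps)
        then show ?thesis using d by (simp add: mult_le_cancel_left_pos)
      qed
      define \<rho> where "\<rho> = r + v"
      have vd: "\<bar>v\<bar> = 1 - d" by (simp add: d_def)
      \<comment> \<open>From tent height at least \<open>d / 2\<close> a step of size
        \<open>d / 4\<close> ends at height at least \<open>d / 4\<close>, where \<open>Gw\<close>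
        applies; so the maximum of \<open>f\<close> on the circle is controlled by
        \<open>g\<close>.\<close>
      have near: "(G \<rho>')\<^sup>2 \<le> (C3 * (r / d) powr (1 / 2) * g) powr (2 - p) * F f \<rho>' powr p"
        if \<rho>': "\<rho>' = r + w" "\<bar>w\<bar> \<le> 1 - d / 2" for \<rho>' w
      proof -
        define H where "H = (\<Sum>n. norm (c n) * \<rho>' ^ n) * gauss \<alpha> \<rho>'"
        have \<rho>'r: "3 \<le> \<rho>'" "\<rho>' \<le> 2 * r" using \<rho>' d r by auto
        have H0: "H \<ge> 0"
          unfolding H_def using \<rho>'r everywhere_sums_norm_summable[OF f, of \<rho>']
          by (intro mult_nonneg_nonneg suminf_nonneg) auto
        have "H\<^sup>2 \<le> 24 * exp (6 * \<alpha>) * (\<rho>' / (d / 4)) * ((G (\<rho>' + d / 4))\<^sup>2 + (G (\<rho>' - d / 4))\<^sup>2)"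
          unfolding H_def G_def using \<rho>'r d by (intro weighted_rms_shift(2)[OF f \<alpha>]) auto
        also have "\<dots> \<le> 24 * exp (6 * \<alpha>) * ((2 * r) / (d / 4)) * ((4 powr \<kappa> * g)\<^sup>2 + (4 powr \<kappa> * g)\<^sup>2)"
        proof (intro mult_mono add_mono power_mono divide_right_mono)
          show "G (\<rho>' + d / 4) \<le> 4 powr \<kappa> * g"
          proof -
            have "d / 4 \<le> 1 - \<bar>w + d / 4\<bar>" using \<rho>' d by linarith
            from Gw[OF this] show ?thesis by (simp add: \<rho>' add.assoc)
          qed
          show "G (\<rho>' - d / 4) \<le> 4 powr \<kappa> * g"
          proof -
            have "d / 4 \<le> 1 - \<bar>w - d / 4\<bar>" using \<rho>' d by linarith
            from Gw[OF this] show ?thesis by (simp add: \<rho>' add_diff_eq)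
          qed
        qed (use \<rho>'r d r g in \<open>auto intro!: G0\<close>)
        also have "\<dots> = C3\<^sup>2 * (r / d) * g\<^sup>2"
          by (simp add: C3_def power_mult_distrib)
        also have "\<dots> = (C3 * sqrt (r / d) * g)\<^sup>2"
          using r d by (simp add: power_mult_distrib)
        finally have "H \<le> C3 * sqrt (r / d) * g"
          by (rule power2_le_imp_le) (use C3 g r d in auto)
        then have HC: "H \<le> C3 * (r / d) powr (1 / 2) * g"
          using r d by (simp add: powr_half_sqrt)
        have "(G \<rho>')\<^sup>2 \<le> H powr (2 - p) * F f \<rho>' powr p"
          unfolding G_def H_def F_def by (rule weighted_interpolation[OF f _ p]) (use \<rho>'r in auto)
        also have "\<dots> \<le> (C3 * (r / d) powr (1 / 2) * g) powr (2 - p) * F f \<rho>' powr p"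
          using HC H0 p by (intro mult_right_mono powr_mono2) auto
        finally show ?thesis .
      qed
      have main: "G r powr q \<le> C * r powr (q * lam) * d * (F f (\<rho> + h) powr q + F f (\<rho> - h) powr q)"
        if h: "0 < h" "h < d / 2" for h
      proof -
        define S where "S = F f (\<rho> + h) powr p + F f (\<rho> - h) powr p"
        have S0: "S \<ge> 0" by (simp add: S_def)
        \<comment> \<open>The shift estimate without the factor \<open>r / h\<close> is used, so
          that \<open>h\<close> may be arbitrarily small.\<close>
        have "g\<^sup>2 \<le> 2 * exp (6 * \<alpha>) * ((G (\<rho> + h))\<^sup>2 + (G (\<rho> - h))\<^sup>2)"
          unfolding g_def \<rho>_def[symmetric] unfolding G_def
          using h d r vd by (intro weighted_rms_shift(1)[OF f \<alpha>]) (auto simp: \<rho>_def)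
        also have "\<dots> \<le> 2 * exp (6 * \<alpha>) * ((C3 * (r / d) powr (1 / 2) * g) powr (2 - p) * F f (\<rho> + h) powr p
              + (C3 * (r / d) powr (1 / 2) * g) powr (2 - p) * F f (\<rho> - h) powr p)"
          using h vd near[of "\<rho> + h" "v + h"] near[of "\<rho> - h" "v - h"]
          by (intro mult_left_mono add_mono) (auto simp: \<rho>_def)
        also have "\<dots> = 2 * exp (6 * \<alpha>) * (C3 * (r / d) powr (1 / 2) * g) powr (2 - p) * S"
          by (simp add: S_def algebra_simps)
        also have "(C3 * (r / d) powr (1 / 2) * g) powr (2 - p)
            = C3 powr (2 - p) * (r / d) powr (p * lam) * g powr (2 - p)"
        proof -
          have "1 / 2 * (2 - p) = p * lam" using p by (simp add: lam_def field_simps)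
          then show ?thesis using C3 r d g by (simp add: powr_mult powr_powr)
        qed
        \<comment> \<open>Absorption: on the right \<open>g\<close> occurs only to the power
          \<open>2 - p\<close>, which cancels because \<open>g\<close> is positive.\<close>
        finally have "g powr (2 - p) * g powr p \<le> g powr (2 - p) * (C1 * (r / d) powr (p * lam) * S)"
          using g by (simp add: C1_def mult_ac flip: powr_add)
        then have "g powr p \<le> C1 * (r / d) powr (p * lam) * S"
          using g by (simp add: mult_le_cancel_left_pos)
        then have "(g powr p) powr (q / p) \<le> (C1 * (r / d) powr (p * lam) * S) powr (q / p)"
          using p q by (intro powr_mono2) auto
        then have "g powr q \<le> C1 powr (q / p) * (r / d) powr (q * lam) * S powr (q / p)"
          using p q C1 S0 r d by (simp add: powr_mult powr_powr mult.commute[of lam])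
        also have "S powr (q / p) \<le> 2 powr (q / p) * ((F f (\<rho> + h) powr p) powr (q / p) + (F f (\<rho> - h) powr p) powr (q / p))"
          unfolding S_def using p q by (intro powr_add_le) auto
        finally have gq: "g powr q \<le> C * (r / d) powr (q * lam) * (F f (\<rho> + h) powr q + F f (\<rho> - h) powr q)"
          using p C1 r d by (simp add: C_def powr_powr mult_ac mult_left_mono)
        have "G r powr q \<le> (d powr \<kappa> * g) powr q"
          using Grv Gr q by (intro powr_mono2) auto
        also have "\<dots> = d powr (\<kappa> * q) * g powr q"
          using d g by (simp add: powr_mult powr_powr)
        also have "\<dots> \<le> d powr (\<kappa> * q) * (C * (r / d) powr (q * lam) * (F f (\<rho> + h) powr q + F f (\<rho> - h) powr q))"
          using gq by (intro mult_left_mono) auto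
        also have "d powr (\<kappa> * q) = d powr (q * lam) * d"
        proof -
          have "\<kappa> * q = q * lam + 1" using q by (simp add: \<kappa>_def field_simps)
          then show ?thesis using d by (simp add: powr_add)
        qed
        also have "d powr (q * lam) * d * (C * (r / d) powr (q * lam) * (F f (\<rho> + h) powr q + F f (\<rho> - h) powr q))
          = C * r powr (q * lam) * d * (F f (\<rho> + h) powr q + F f (\<rho> - h) powr q)"
          using d r by (simp add: powr_divide)
        finally show ?thesis .
      qed
      show ?thesis
        using main d vd by (intro exI[of _ \<rho>] exI[of _ d]) (auto simp: \<rho>_def G_def lam_def)
    qed
  qed
qed

lemma nn_integral_shift_reflect:
  fixes \<phi> :: "real \<Rightarrow> ennreal"
  assumes [measurable]: "\<phi> \<in> borel_measurable borel" and s: "s = 1 \<or> s = -1"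
    and sub: "\<And>h. 0 < h \<Longrightarrow> h < e \<Longrightarrow> \<rho> + s * h \<in> {a..b}"
  shows "(\<integral>\<^sup>+h\<in>{0<..<e}. \<phi> (\<rho> + s * h) \<partial>lborel) \<le> (\<integral>\<^sup>+x\<in>{a..b}. \<phi> x \<partial>lborel)"
proof -
  have "(\<integral>\<^sup>+h\<in>{0<..<e}. \<phi> (\<rho> + s * h) \<partial>lborel) \<le> (\<integral>\<^sup>+h. \<phi> (\<rho> + s * h) * indicator {a..b} (\<rho> + s * h) \<partial>lborel)"
    using sub by (intro nn_integral_mono) (auto simp: indicator_def)
  also have "\<dots> = (\<integral>\<^sup>+x\<in>{a..b}. \<phi> x \<partial>lborel)"
    using s by (subst nn_integral_real_affine[of "\<lambda>x. \<phi> x * indicator {a..b} x" s \<rho>]) auto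
  finally show ?thesis .
qed

text \<open>Integrate the pointwise estimate over \<open>h\<close> in \<open>{0<..<d / 2}\<close>:
  the length \<open>d / 2\<close> on the left cancels the factor \<open>d\<close> on the right, so
  the unknown \<open>d\<close> disappears. The radii \<open>\<rho> + h\<close> and
  \<open>\<rho> - h\<close> stay in \<open>{r - 1..r + 1}\<close>, and each contributes one window
  integral.\<close>

lemma local_rms_bound:
  fixes \<alpha> p q :: real
  assumes \<alpha>: "\<alpha> > 0" and p: "0 < p" "p \<le> 2" and q: "q > 0"
  shows "\<exists>C>0. \<forall>c f r. everywhere_sums c f \<longrightarrow> r \<ge> 4 \<longrightarrow>
    ennreal (gauss_rms \<alpha> c r powr q)
      \<le> ennreal (C * r powr (q * (1 / p - 1 / 2)))
        * (\<integral>\<^sup>+s\<in>{r - 1..r + 1}. ennreal (gauss_mean \<alpha> p f s powr q) \<partial>lborel)"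
proof -
  define F where "F = (\<lambda>f s. gauss_mean \<alpha> p f s)"
  obtain C where C: "C > 0" and pt: "\<And>c f r. everywhere_sums c f \<Longrightarrow> r \<ge> 4 \<Longrightarrow>
    (\<exists>\<rho> d. 0 < d \<and> d \<le> 1 \<and> \<bar>\<rho> - r\<bar> \<le> 1 - d \<and>
      (\<forall>h. 0 < h \<longrightarrow> h < d / 2 \<longrightarrow>
        gauss_rms \<alpha> c r powr q
          \<le> C * r powr (q * (1 / p - 1 / 2)) * d * (F f (\<rho> + h) powr q + F f (\<rho> - h) powr q)))"
    using local_rms_bound_pointwise[OF assms] unfolding F_def by metis
  show ?thesis
  proof (intro exI[of _ "4 * C"] conjI allI impI)
    fix c f and r :: real
    assume f: "everywhere_sums c f" and r: "r \<ge> 4"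
    define K where "K = C * r powr (q * (1 / p - 1 / 2))"
    define X where "X = gauss_rms \<alpha> c r powr q"
    define \<phi> where "\<phi> s = ennreal (F f s powr q)" for s
    define I where "I = (\<integral>\<^sup>+s\<in>{r - 1..r + 1}. \<phi> s \<partial>lborel)"
    have K0: "K \<ge> 0" using C by (simp add: K_def)
    obtain \<rho> d where d: "0 < d" "d \<le> 1" and \<rho>: "\<bar>\<rho> - r\<bar> \<le> 1 - d"
      and le: "\<And>h. 0 < h \<Longrightarrow> h < d / 2 \<Longrightarrow> X \<le> K * d * (F f (\<rho> + h) powr q + F f (\<rho> - h) powr q)"
      using pt[OF f r] unfolding X_def K_def by blast
    have [measurable]: "integral_mean p f \<in> borel_measurable borel"
      by (rule borel_measurable_integral_mean[OF everywhere_sums_measurable[OF f]])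
    have [measurable]: "\<phi> \<in> borel_measurable borel"
      unfolding \<phi>_def F_def by measurable
    have "ennreal (d / 2) * ennreal X = (\<integral>\<^sup>+h\<in>{0<..<d / 2}. ennreal X \<partial>lborel)"
      using d by (simp add: nn_integral_cmult_indicator mult.commute)
    also have "\<dots> \<le> (\<integral>\<^sup>+h. ennreal (K * d) * (\<phi> (\<rho> + 1 * h) * indicator {0<..<d / 2} h + \<phi> (\<rho> + (-1) * h) * indicator {0<..<d / 2} h) \<partial>lborel)"
    proof (rule nn_integral_mono)
      fix h
      show "ennreal X * indicator {0<..<d / 2} h
        \<le> ennreal (K * d) * (\<phi> (\<rho> + 1 * h) * indicator {0<..<d / 2} h + \<phi> (\<rho> + (-1) * h) * indicator {0<..<d / 2} h)"
      proof (cases "0 < h \<and> h < d / 2")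
        case True
        have "ennreal X \<le> ennreal (K * d * (F f (\<rho> + h) powr q + F f (\<rho> - h) powr q))"
          using le[of h] True by (intro ennreal_leI) auto
        also have "\<dots> = ennreal (K * d) * (\<phi> (\<rho> + h) + \<phi> (\<rho> - h))"
          unfolding \<phi>_def using K0 d by (simp add: ennreal_mult)
        finally show ?thesis using True by simp
      qed auto
    qed
    also have "\<dots> = ennreal (K * d) * ((\<integral>\<^sup>+h\<in>{0<..<d / 2}. \<phi> (\<rho> + 1 * h) \<partial>lborel) + (\<integral>\<^sup>+h\<in>{0<..<d / 2}. \<phi> (\<rho> + (-1) * h) \<partial>lborel))"
      by (subst nn_integral_cmult, measurable) (subst nn_integral_add, measurable)
    also have "\<dots> \<le> ennreal (K * d) * (I + I)"
      unfolding I_def using \<rho> d by (intro mult_left_mono add_mono nn_integral_shift_reflect) auto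
    also have "\<dots> = ennreal (d / 2) * (ennreal (4 * K) * I)"
    proof -
      have "ennreal (d / 2) * (ennreal (4 * K) * I) = ennreal (d / 2 * (4 * K)) * I"
        using K0 d by (simp only: ennreal_mult mult.assoc)
      also have "d / 2 * (4 * K) = K * d + K * d" by simp
      also have "ennreal (K * d + K * d) * I = ennreal (K * d) * (I + I)"
        using K0 d by (subst ennreal_plus) (simp_all add: distrib_left distrib_right)
      finally show ?thesis by simp
    qed
    finally have "ennreal X \<le> ennreal (4 * K) * I"
      using d by (simp add: ennreal_mult_le_mult_iff)
    then show "ennreal (gauss_rms \<alpha> c r powr q)
      \<le> ennreal (4 * C * r powr (q * (1 / p - 1 / 2)))
        * (\<integral>\<^sup>+s\<in>{r - 1..r + 1}. ennreal (gauss_mean \<alpha> p f s powr q) \<partial>lborel)"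
      by (simp add: X_def K_def I_def \<phi>_def F_def mult.assoc)
  qed (use C in auto)
qed

section \<open>Embeddings into the mean-square Fock spaces\<close>

lemma fock_integral_weighted:
  "fock_integral \<alpha> p q f = (\<integral>\<^sup>+r\<in>{0..}. ennreal (gauss_mean \<alpha> p f r powr q * (\<alpha> * q * r)) \<partial>lborel)"
  unfolding fock_integral_def
proof (intro nn_integral_cong)
  fix r :: real
  have "gauss_mean \<alpha> p f r powr q = integral_mean p f r powr q * exp (- (\<alpha> * q / 2) * r\<^sup>2)"
    by (simp add: powr_mult exp_powr_real mult_ac)
  then show "ennreal (integral_mean p f r powr q * (\<alpha> * q * exp (- (\<alpha> * q / 2) * r\<^sup>2) * r)) * indicator {0..} r
    = ennreal (gauss_mean \<alpha> p f r powr q * (\<alpha> * q * r)) * indicator {0..} r"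
    by (simp add: mult_ac)
qed

text \<open>Separates the mean from a weight that does not depend on \<open>f\<close>, the form
  suited to Tonelli's theorem.\<close>

lemma fock_integral_split_weight:
  "fock_integral \<beta> p q f = (\<integral>\<^sup>+r. ennreal (integral_mean p f r powr q)
     * (ennreal (\<beta> * q * exp (- (\<beta> * q / 2) * r\<^sup>2) * r) * indicator {0..} r) \<partial>lborel)"
  unfolding fock_integral_def
  by (intro nn_integral_cong) (auto simp: indicator_def ennreal_mult')

lemma mem_fock_space_iff:
  "f \<in> fock_space \<alpha> p q \<longleftrightarrow> f holomorphic_on UNIV \<and> fock_integral \<alpha> p q f < \<infinity>"
  by (auto simp: fock_space_def fock_norm_def top.not_eq_extremum)

lemma fock_integral_mono_exponent:
  assumes f: "continuous_on UNIV f" and "0 < p" "p \<le> p'" "\<alpha> > 0" "q > 0"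
  shows "fock_integral \<alpha> p q f \<le> fock_integral \<alpha> p' q f"
  unfolding fock_integral_def
proof (intro nn_integral_mono)
  fix r :: real
  show "ennreal (integral_mean p f r powr q * (\<alpha> * q * exp (- (\<alpha> * q / 2) * r\<^sup>2) * r)) * indicator {0..} r
    \<le> ennreal (integral_mean p' f r powr q * (\<alpha> * q * exp (- (\<alpha> * q / 2) * r\<^sup>2) * r)) * indicator {0..} r"
    using assms
    by (cases "r \<ge> 0") (auto intro!: ennreal_leI mult_right_mono powr_mono2 integral_mean_mono)
qed

lemma radial_gaussian_finite:
  assumes "a > 0"
  shows "(\<integral>\<^sup>+r\<in>{0..}. ennreal (exp (- a * r\<^sup>2) * r) \<partial>lborel) < \<infinity>"
proof -
  have "(\<integral>\<^sup>+r. ennreal (exp (- a * r\<^sup>2) * r) * indicator {0..} r \<partial>lborel) = ennreal (0 - (- exp (- a * 0\<^sup>2) / (2 * a)))"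
  proof (rule nn_integral_FTC_atLeast)
    show "DERIV (\<lambda>r. - exp (- a * r\<^sup>2) / (2 * a)) x :> exp (- a * x\<^sup>2) * x" for x
      using assms by (auto intro!: derivative_eq_intros simp: field_simps)
    have "((\<lambda>r::real. exp (- a * r\<^sup>2)) \<longlongrightarrow> 0) at_top"
      using assms by real_asymp
    from tendsto_divide[OF tendsto_minus[OF this] tendsto_const[of "2 * a"]] assms
    show "((\<lambda>r. - exp (- a * r\<^sup>2) / (2 * a)) \<longlongrightarrow> 0) at_top" by simp
  qed auto
  then show ?thesis by simp
qed

lemma powr_le_exp_square:
  fixes m \<epsilon> :: real
  assumes "\<epsilon> > 0"
  shows "\<exists>K>0. \<forall>r\<ge>1. r powr m \<le> K * exp (\<epsilon> * r\<^sup>2)"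
proof -
  \<comment> \<open>Positive even when \<open>m\<close> is not, since
    \<open>ln y \<le> y - 1\<close> is going to be multiplied by \<open>k\<close>.\<close>
  define k where "k = max m 1"
  have k: "k > 0" by (simp add: k_def)
  have "r powr m \<le> (k / \<epsilon>) powr k * exp (\<epsilon> * r\<^sup>2)" if r: "r \<ge> 1" for r
  proof -
    have "r powr m \<le> r powr k" using r by (intro powr_mono) (auto simp: k_def)
    also have "\<dots> = (k / \<epsilon>) powr k * (\<epsilon> * r / k) powr k"
      using k assms r by (subst powr_mult[symmetric]) auto
    also have "(\<epsilon> * r / k) powr k = exp (k * ln (\<epsilon> * r / k))"
      using k assms r by (simp add: powr_def)
    also have "\<dots> \<le> exp (\<epsilon> * r\<^sup>2)"
    proof -
      have "k * ln (\<epsilon> * r / k) \<le> k * (\<epsilon> * r / k - 1)"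
        using k assms r by (intro mult_left_mono ln_le_minus_one) auto
      also have "\<dots> \<le> \<epsilon> * r" using k by (simp add: field_simps)
      also have "\<dots> \<le> \<epsilon> * r\<^sup>2" using assms r by (intro mult_left_mono) (auto simp: power2_eq_square)
      finally show ?thesis by simp
    qed
    finally show ?thesis by (simp add: mult_left_mono)
  qed
  moreover have "(k / \<epsilon>) powr k > 0" using k assms by simp
  ultimately show ?thesis by blast
qed

text \<open>The radial density \<open>s\<close> is at least \<open>r / 2\<close> on the window
  because \<open>r \<ge> 4\<close>. This gain of a factor \<open>r\<close> is the source of the
  \<open>- 1\<close> in the growth exponent of \<open>rms_growth\<close>.\<close>

lemma local_mean_integral_le:
  assumes f: "f \<in> borel_measurable borel" and \<alpha>: "\<alpha> > 0" and q: "q > 0" and r: "r \<ge> 4"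
  shows "ennreal (\<alpha> * q * r / 2) * (\<integral>\<^sup>+s\<in>{r - 1..r + 1}. ennreal (gauss_mean \<alpha> p f s powr q) \<partial>lborel)
    \<le> fock_integral \<alpha> p q f"
proof -
  have [measurable]: "integral_mean p f \<in> borel_measurable borel"
    by (rule borel_measurable_integral_mean[OF f])
  have "ennreal (\<alpha> * q * r / 2) * (\<integral>\<^sup>+s\<in>{r - 1..r + 1}. ennreal (gauss_mean \<alpha> p f s powr q) \<partial>lborel)
    = (\<integral>\<^sup>+s. ennreal (\<alpha> * q * r / 2) * (ennreal (gauss_mean \<alpha> p f s powr q) * indicator {r - 1..r + 1} s) \<partial>lborel)"
    by (rule nn_integral_cmult[symmetric]) measurable
  also have "\<dots> \<le> fock_integral \<alpha> p q f"
    unfolding fock_integral_weighted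
  proof (rule nn_integral_mono)
    fix s :: real
    show "ennreal (\<alpha> * q * r / 2) * (ennreal (gauss_mean \<alpha> p f s powr q) * indicator {r - 1..r + 1} s)
      \<le> ennreal (gauss_mean \<alpha> p f s powr q * (\<alpha> * q * s)) * indicator {0..} s"
    proof (cases "s \<in> {r - 1..r + 1}")
      case True
      have "ennreal (\<alpha> * q * r / 2) * ennreal (gauss_mean \<alpha> p f s powr q)
        = ennreal (\<alpha> * q * r / 2 * gauss_mean \<alpha> p f s powr q)"
        using \<alpha> q r by (subst ennreal_mult) auto
      also have "\<dots> \<le> ennreal (gauss_mean \<alpha> p f s powr q * (\<alpha> * q * s))"
      proof (rule ennreal_leI)
        have "\<alpha> * q * r / 2 \<le> \<alpha> * q * s" using True r \<alpha> q by (simp add: mult_le_cancel_left_pos)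
        then have "\<alpha> * q * r / 2 * gauss_mean \<alpha> p f s powr q
           \<le> \<alpha> * q * s * gauss_mean \<alpha> p f s powr q"
          by (rule mult_right_mono) simp
        then show "\<alpha> * q * r / 2 * gauss_mean \<alpha> p f s powr q
           \<le> (gauss_mean \<alpha> p f s) powr q * (\<alpha> * q * s)" by (simp add: mult_ac)
      qed
      finally show ?thesis using True r by simp
    qed auto
  qed
  finally show ?thesis .
qed

text \<open>The local comparison combined with the weight of a window. \<open>T\<close> stays
  explicit and \<open>C\<close> is chosen first, so that the bound is uniform over bounded families
  of functions.\<close>

lemma rms_growth:
  fixes \<alpha> p q :: real
  assumes \<alpha>: "\<alpha> > 0" and p: "0 < p" "p \<le> 2" and q: "q > 0"
  shows "\<exists>C>0. \<forall>c f r T. everywhere_sums c f \<longrightarrow> r \<ge> 4 \<longrightarrow> T \<ge> 0 \<longrightarrow> fock_integral \<alpha> p q f \<le> ennreal T \<longrightarrow>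
    gauss_rms \<alpha> c r powr q \<le> C * T * r powr (q * (1 / p - 1 / 2) - 1)"
proof -
  obtain C where C: "C > 0" and loc: "\<And>c f r. everywhere_sums c f \<Longrightarrow> r \<ge> 4 \<Longrightarrow>
    ennreal (gauss_rms \<alpha> c r powr q)
      \<le> ennreal (C * r powr (q * (1 / p - 1 / 2)))
        * (\<integral>\<^sup>+s\<in>{r - 1..r + 1}. ennreal (gauss_mean \<alpha> p f s powr q) \<partial>lborel)"
    using local_rms_bound[OF assms] by (elim exE conjE) (erule that, simp only:)
  show ?thesis
  proof (rule exI[of _ "2 * C / (\<alpha> * q)"], intro conjI allI impI)
    show "2 * C / (\<alpha> * q) > 0" using C \<alpha> q by simp
    fix c f and r T :: real
    assume f: "everywhere_sums c f" and r: "r \<ge> 4" and T: "T \<ge> 0" "fock_integral \<alpha> p q f \<le> ennreal T"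
    define X where "X = gauss_rms \<alpha> c r powr q"
    define Y where "Y = C * r powr (q * (1 / p - 1 / 2))"
    define I where "I = (\<integral>\<^sup>+s\<in>{r - 1..r + 1}. ennreal (gauss_mean \<alpha> p f s powr q) \<partial>lborel)"
    define w where "w = \<alpha> * q * r / 2"
    have w: "w > 0" using \<alpha> q r by (simp add: w_def)
    have X0: "X \<ge> 0" and Y0: "Y \<ge> 0" using C by (auto simp: X_def Y_def)
    have "ennreal (w * X) = ennreal w * ennreal X" using w X0 by (simp add: ennreal_mult)
    also have "\<dots> \<le> ennreal w * (ennreal Y * I)"
      using loc[OF f r] by (intro mult_left_mono) (auto simp: X_def Y_def I_def)
    also have "\<dots> = ennreal Y * (ennreal w * I)" by (simp add: mult_ac)
    also have "\<dots> \<le> ennreal Y * ennreal T"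
      using local_mean_integral_le[OF everywhere_sums_measurable[OF f] \<alpha> q r, of p] T(2)
      unfolding I_def w_def by (intro mult_left_mono) (auto intro: order_trans)
    also have "\<dots> = ennreal (Y * T)" using Y0 T by (simp add: ennreal_mult)
    finally have "w * X \<le> Y * T" using Y0 T by (subst (asm) ennreal_le_iff) auto
    then have "X \<le> Y * T / w" using w by (simp add: field_simps)
    also have "\<dots> = 2 * C / (\<alpha> * q) * T * r powr (q * (1 / p - 1 / 2) - 1)"
      using r by (simp add: Y_def w_def powr_diff)
    finally show "gauss_rms \<alpha> c r powr q \<le> 2 * C / (\<alpha> * q) * T * r powr (q * (1 / p - 1 / 2) - 1)"
      unfolding X_def .
  qed
qed

text \<open>On \<open>{0..4}\<close> the mean square is bounded by continuity; 4 is the radius from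
  which the local comparison is available.\<close>

lemma fock_integral_2_split:
  assumes f: "everywhere_sums c f" and \<beta>: "\<beta> > 0" and q: "q > 0"
    and tail: "(\<integral>\<^sup>+r\<in>{4..}. ennreal (gauss_rms \<beta> c r powr q * r) \<partial>lborel) < \<infinity>"
  shows "fock_integral \<beta> 2 q f < \<infinity>"
proof -
  define G where "G r = gauss_rms \<beta> c r" for r
  have meas: "f \<in> borel_measurable borel"
    by (rule everywhere_sums_measurable[OF f])
  have [measurable]: "integral_mean 2 f \<in> borel_measurable borel"
    by (rule borel_measurable_integral_mean[OF meas])
  have contG: "continuous_on {0..4} G"
    unfolding G_def by (intro continuous_intros continuous_on_subset[OF continuous_on_rms[OF f]]) auto
  then have "compact (G ` {0..4})" by (rule compact_continuous_image) auto
  then obtain B where B: "\<And>r. r \<in> {0..4} \<Longrightarrow> norm (G r) \<le> B"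
    by (metis bounded_iff compact_imp_bounded imageI)
  have G0: "G r \<ge> 0" if "r \<ge> 0" for r using rms_nonneg[OF f that] by (simp add: G_def)
  have eq: "gauss_mean \<beta> 2 f r = G r" if "r \<ge> 0" for r
    by (simp add: integral_mean_2[OF f that] G_def)
  define \<phi> where "\<phi> r = ennreal (gauss_mean \<beta> 2 f r powr q * (\<beta> * q * r))" for r
  have [measurable]: "\<phi> \<in> borel_measurable borel" unfolding \<phi>_def by measurable
  have "fock_integral \<beta> 2 q f = (\<integral>\<^sup>+r\<in>{0..}. \<phi> r \<partial>lborel)"
    unfolding fock_integral_weighted \<phi>_def ..
  also have "\<dots> \<le> (\<integral>\<^sup>+r. \<phi> r * indicator {0..4} r + \<phi> r * indicator {4..} r \<partial>lborel)"
    by (intro nn_integral_mono) (auto simp: indicator_def)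
  also have "\<dots> = (\<integral>\<^sup>+r\<in>{0..4}. \<phi> r \<partial>lborel) + (\<integral>\<^sup>+r\<in>{4..}. \<phi> r \<partial>lborel)"
    by (rule nn_integral_add) measurable
  also have "\<dots> < \<infinity>"
  proof -
    have "(\<integral>\<^sup>+r\<in>{0..4}. \<phi> r \<partial>lborel) \<le> (\<integral>\<^sup>+r\<in>{0..4::real}. ennreal (B powr q * (\<beta> * q * 4)) \<partial>lborel)"
    proof (rule nn_integral_mono)
      fix r :: real
      show "\<phi> r * indicator {0..4} r \<le> ennreal (B powr q * (\<beta> * q * 4)) * indicator {0..4} r"
      proof (cases "r \<in> {0..4}")
        case True
        then have "G r powr q * (\<beta> * q * r) \<le> B powr q * (\<beta> * q * 4)"
          using B[of r] G0[of r] \<beta> q by (intro mult_mono powr_mono2) auto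
        then show ?thesis using True eq[of r] by (auto simp: \<phi>_def intro!: ennreal_leI)
      qed auto
    qed
    also have "\<dots> < \<infinity>"
      by (simp add: nn_integral_cmult_indicator ennreal_mult_less_top)
    finally have 1: "(\<integral>\<^sup>+r\<in>{0..4}. \<phi> r \<partial>lborel) < \<infinity>" .
    have "(\<integral>\<^sup>+r\<in>{4..}. \<phi> r \<partial>lborel) = (\<integral>\<^sup>+r. ennreal (\<beta> * q) * (ennreal (gauss_mean \<beta> 2 f r powr q * r) * indicator {4..} r) \<partial>lborel)"
      using \<beta> q by (intro nn_integral_cong) (auto simp: \<phi>_def indicator_def ennreal_mult'[symmetric] mult_ac)
    also have "\<dots> = ennreal (\<beta> * q) * (\<integral>\<^sup>+r\<in>{4..}. ennreal (gauss_mean \<beta> 2 f r powr q * r) \<partial>lborel)"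
      by (rule nn_integral_cmult) measurable
    also have "(\<integral>\<^sup>+r\<in>{4..}. ennreal (gauss_mean \<beta> 2 f r powr q * r) \<partial>lborel)
      = (\<integral>\<^sup>+r\<in>{4..}. ennreal (gauss_rms \<beta> c r powr q * r) \<partial>lborel)"
      by (intro nn_integral_cong) (auto simp: indicator_def integral_mean_2[OF f])
    finally have 2: "(\<integral>\<^sup>+r\<in>{4..}. \<phi> r \<partial>lborel) < \<infinity>"
      using tail by (simp add: ennreal_mult_less_top)
    show ?thesis using 1 2 by simp
  qed
  finally show ?thesis .
qed

text \<open>The mean square grows at most polynomially against the weight \<alpha>, and the surplus
  Gaussian decay of the weight \<beta> swallows every power of \<open>r\<close>, whatever
  \<open>q\<close> and \<open>q'\<close> are.\<close>

lemma fock_embedding_larger_weight: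
  fixes \<alpha> \<beta> p q q' :: real
  assumes f: "everywhere_sums c f" and \<alpha>: "\<alpha> > 0" "\<alpha> < \<beta>" and p: "0 < p" "p \<le> 2" and q: "q > 0" "q' > 0"
    and fin: "fock_integral \<alpha> p q f < \<infinity>"
  shows "fock_integral \<beta> 2 q' f < \<infinity>"
proof (rule fock_integral_2_split[OF f])
  define T where "T = enn2real (fock_integral \<alpha> p q f)"
  have T: "T \<ge> 0" "fock_integral \<alpha> p q f \<le> ennreal T"
    using fin by (auto simp: T_def)
  define m where "m = q * (1 / p - 1 / 2) - 1"
  obtain C where C: "C > 0" and growth: "\<And>r. r \<ge> 4 \<Longrightarrow> (gauss_rms \<alpha> c r) powr q \<le> C * T * r powr m"
    using rms_growth[OF \<alpha>(1) p q(1)] by (elim exE conjE) (erule that, use f T in \<open>auto simp: m_def\<close>)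
  \<comment> \<open>The surplus decay is \<open>exp (- 2 * \<delta> * r\<^sup>2)\<close>: half of it
    absorbs the power of \<open>r\<close>, the other half remains integrable.\<close>
  define \<delta> where "\<delta> = (\<beta> - \<alpha>) * q' / 4"
  have \<delta>: "\<delta> > 0" using \<alpha> q by (simp add: \<delta>_def)
  obtain K where K: "K > 0" and Kle: "\<And>r. r \<ge> 1 \<Longrightarrow> r powr (m * (q' / q)) \<le> K * exp (\<delta> * r\<^sup>2)"
    using powr_le_exp_square[OF \<delta>] by metis
  define D where "D = (C * T) powr (q' / q) * K"
  have D: "D \<ge> 0" using K by (simp add: D_def)
  have bound: "gauss_rms \<beta> c r powr q' \<le> D * exp (- \<delta> * r\<^sup>2)" if r: "r \<ge> 4" for r
  proof -
    define G where "G = gauss_rms \<alpha> c r"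
    have G0: "G \<ge> 0" using rms_nonneg[OF f, of r] r by (simp add: G_def)
    have "G powr q' = (G powr q) powr (q' / q)" using q by (simp add: powr_powr)
    also have "\<dots> \<le> (C * T * r powr m) powr (q' / q)"
      using growth[OF r] q unfolding G_def by (intro powr_mono2) auto
    also have "\<dots> = (C * T) powr (q' / q) * r powr (m * (q' / q))"
      using C T r by (simp add: powr_mult powr_powr)
    also have "\<dots> \<le> (C * T) powr (q' / q) * (K * exp (\<delta> * r\<^sup>2))"
      using Kle[of r] r by (intro mult_left_mono) auto
    finally have Gq: "G powr q' \<le> D * exp (\<delta> * r\<^sup>2)" by (simp add: D_def mult_ac)
    have "gauss_rms \<beta> c r = G * exp (- ((\<beta> - \<alpha>) / 2) * r\<^sup>2)"
      by (simp add: G_def algebra_simps flip: exp_add) (simp add: field_simps)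
    then have "gauss_rms \<beta> c r powr q' = G powr q' * exp (- 2 * \<delta> * r\<^sup>2)"
      using G0 by (simp add: powr_mult exp_powr_real \<delta>_def)
    also have "\<dots> \<le> D * exp (\<delta> * r\<^sup>2) * exp (- 2 * \<delta> * r\<^sup>2)"
      using Gq by (intro mult_right_mono) auto
    also have "\<dots> = D * exp (- \<delta> * r\<^sup>2)"
      by (simp add: mult.assoc flip: exp_add)
    finally show ?thesis .
  qed
  have "(\<integral>\<^sup>+r\<in>{4..}. ennreal (gauss_rms \<beta> c r powr q' * r) \<partial>lborel)
    \<le> (\<integral>\<^sup>+r. ennreal D * (ennreal (exp (- \<delta> * r\<^sup>2) * r) * indicator {0..} r) \<partial>lborel)"
  proof (rule nn_integral_mono)
    fix r :: real
    show "ennreal (gauss_rms \<beta> c r powr q' * r) * indicator {4..} r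
      \<le> ennreal D * (ennreal (exp (- \<delta> * r\<^sup>2) * r) * indicator {0..} r)"
    proof (cases "r \<ge> 4")
      case True
      have "gauss_rms \<beta> c r powr q' * r \<le> D * exp (- \<delta> * r\<^sup>2) * r"
        using bound[OF True] True by (intro mult_right_mono) auto
      then show ?thesis using True D by (simp add: mult.assoc ennreal_mult'[symmetric] ennreal_leI)
    qed auto
  qed
  also have "\<dots> = ennreal D * (\<integral>\<^sup>+r\<in>{0..}. ennreal (exp (- \<delta> * r\<^sup>2) * r) \<partial>lborel)"
    by (rule nn_integral_cmult) measurable
  also have "\<dots> < \<infinity>"
    using radial_gaussian_finite[OF \<delta>] by (simp add: ennreal_mult_less_top)
  finally show "(\<integral>\<^sup>+r\<in>{4..}. ennreal (gauss_rms \<beta> c r powr q' * r) \<partial>lborel) < \<infinity>" .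
qed (use assms in auto)


text \<open>Tonelli: for fixed \<open>s\<close> the admissible \<open>r\<close> lie in an interval
  of length 2 and satisfy \<open>r \<le> 2 * s\<close>, hence the factor 4.\<close>

lemma nn_integral_window_le:
  fixes \<phi> :: "real \<Rightarrow> ennreal"
  assumes [measurable]: "\<phi> \<in> borel_measurable borel"
  shows "(\<integral>\<^sup>+r\<in>{4..}. (\<integral>\<^sup>+s\<in>{r - 1..r + 1}. \<phi> s \<partial>lborel) * ennreal r \<partial>lborel)
    \<le> 4 * (\<integral>\<^sup>+s\<in>{0..}. \<phi> s * ennreal s \<partial>lborel)"
proof -
  have "(\<integral>\<^sup>+r\<in>{4..}. (\<integral>\<^sup>+s\<in>{r - 1..r + 1}. \<phi> s \<partial>lborel) * ennreal r \<partial>lborel)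
    = (\<integral>\<^sup>+r. (\<integral>\<^sup>+s. \<phi> s * indicator {x. \<bar>fst x - snd x\<bar> \<le> 1} (r, s) * (ennreal r * indicator {4..} r) \<partial>lborel) \<partial>lborel)"
  proof (rule nn_integral_cong)
    fix r :: real
    have "(\<integral>\<^sup>+s\<in>{r - 1..r + 1}. \<phi> s \<partial>lborel) = (\<integral>\<^sup>+s. \<phi> s * indicator {x. \<bar>fst x - snd x\<bar> \<le> 1} (r, s) \<partial>lborel)"
      by (intro nn_integral_cong) (auto simp: indicator_def)
    then show "(\<integral>\<^sup>+s\<in>{r - 1..r + 1}. \<phi> s \<partial>lborel) * ennreal r * indicator {4..} r
      = (\<integral>\<^sup>+s. \<phi> s * indicator {x. \<bar>fst x - snd x\<bar> \<le> 1} (r, s) * (ennreal r * indicator {4..} r) \<partial>lborel)"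
      by (simp only:) (subst nn_integral_multc, measurable, simp add: mult.assoc)
  qed
  also have "\<dots> = (\<integral>\<^sup>+s. (\<integral>\<^sup>+r. \<phi> s * indicator {x. \<bar>fst x - snd x\<bar> \<le> 1} (r, s) * (ennreal r * indicator {4..} r) \<partial>lborel) \<partial>lborel)"
    by (rule lborel_pair.Fubini') measurable
  also have "\<dots> \<le> (\<integral>\<^sup>+s. (\<integral>\<^sup>+r. \<phi> s * ennreal (2 * s) * indicator {0..} s * indicator {s - 1..s + 1} r \<partial>lborel) \<partial>lborel)"
  proof (intro nn_integral_mono)
    fix r s :: real
    show "\<phi> s * indicator {x. \<bar>fst x - snd x\<bar> \<le> 1} (r, s) * (ennreal r * indicator {4..} r)
      \<le> \<phi> s * ennreal (2 * s) * indicator {0..} s * indicator {s - 1..s + 1} r"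
    proof (cases "\<bar>r - s\<bar> \<le> 1 \<and> r \<ge> 4")
      case True
      then have "s \<ge> 0" "r \<le> 2 * s" "r \<in> {s - 1..s + 1}" by auto
      then show ?thesis using True by (auto intro!: mult_left_mono ennreal_leI)
    qed (auto simp: indicator_def)
  qed
  also have "\<dots> = (\<integral>\<^sup>+s. 4 * (\<phi> s * ennreal s * indicator {0..} s) \<partial>lborel)"
  proof (rule nn_integral_cong)
    fix s :: real
    have "(\<integral>\<^sup>+r. \<phi> s * ennreal (2 * s) * indicator {0..} s * indicator {s - 1..s + 1} r \<partial>lborel)
      = \<phi> s * ennreal (2 * s) * indicator {0..} s * 2"
      by (subst nn_integral_cmult_indicator) auto
    also have "\<dots> = 4 * (\<phi> s * ennreal s * indicator {0..} s)"
    proof (cases "s \<ge> 0")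
      case True
      then have "ennreal (2 * s) = 2 * ennreal s" by (simp add: ennreal_mult')
      moreover have "(2::ennreal) * 2 = 4" by simp
      ultimately show ?thesis using True by (metis (no_types, lifting) mult.assoc mult.commute)
    qed auto
    finally show "(\<integral>\<^sup>+r. \<phi> s * ennreal (2 * s) * indicator {0..} s * indicator {s - 1..s + 1} r \<partial>lborel)
      = 4 * (\<phi> s * ennreal s * indicator {0..} s)" .
  qed
  also have "\<dots> = 4 * (\<integral>\<^sup>+s\<in>{0..}. \<phi> s * ennreal s \<partial>lborel)"
    by (rule nn_integral_cmult) measurable
  finally show ?thesis .
qed

text \<open>Of the \<open>q'\<close> powers of the mean square, \<open>q\<close> are averaged over a
  window and the other \<open>q' - q\<close> are estimated by the growth bound; \<open>crit\<close>
  says that the resulting total power of \<open>r\<close> is nonpositive.\<close>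

lemma fock_embedding_same_weight:
  fixes \<alpha> p q q' :: real
  assumes f: "everywhere_sums c f" and \<alpha>: "\<alpha> > 0" and p: "0 < p" "p \<le> 2" and q: "q > 0" "q \<le> q'"
    and crit: "1 / p - 1 / 2 \<le> 1 / q - 1 / q'"
    and fin: "fock_integral \<alpha> p q f < \<infinity>"
  shows "fock_integral \<alpha> 2 q' f < \<infinity>"
proof (rule fock_integral_2_split[OF f])
  have q': "q' > 0" using q by simp
  define lam where "lam = 1 / p - 1 / 2"
  define T where "T = enn2real (fock_integral \<alpha> p q f)"
  have T: "T \<ge> 0" "fock_integral \<alpha> p q f \<le> ennreal T"
    using fin by (auto simp: T_def)
  define m where "m = q * lam - 1"
  obtain C where C: "C > 0" and growth: "\<And>r. r \<ge> 4 \<Longrightarrow> (gauss_rms \<alpha> c r) powr q \<le> C * T * r powr m"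
    using rms_growth[OF \<alpha>(1) p q(1)] by (elim exE conjE) (erule that, use f T in \<open>auto simp: m_def lam_def\<close>)
  obtain C' where C': "C' > 0" and loc: "\<And>c f r. everywhere_sums c f \<Longrightarrow> r \<ge> 4 \<Longrightarrow>
    ennreal (gauss_rms \<alpha> c r powr q)
      \<le> ennreal (C' * r powr (q * (1 / p - 1 / 2)))
        * (\<integral>\<^sup>+s\<in>{r - 1..r + 1}. ennreal (gauss_mean \<alpha> p f s powr q) \<partial>lborel)"
    using local_rms_bound[OF \<alpha> p q(1)] by (elim exE conjE) (erule that, simp only:)
  define \<phi> where "\<phi> s = ennreal (gauss_mean \<alpha> p f s powr q)" for s
  have meas: "f \<in> borel_measurable borel"
    by (rule everywhere_sums_measurable[OF f])
  have [measurable]: "integral_mean p f \<in> borel_measurable borel"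
    by (rule borel_measurable_integral_mean[OF meas])
  have [measurable]: "\<phi> \<in> borel_measurable borel"
    unfolding \<phi>_def by measurable
  define e where "e = (q' - q) / q"
  have e: "e \<ge> 0" using q by (simp add: e_def)
  define D where "D = C' * (C * T) powr e"
  have D: "D \<ge> 0" using C' by (simp add: D_def)
  have expo: "q * lam + m * e \<le> 0"
  proof -
    have "lam * q' \<le> (1 / q - 1 / q') * q'"
      using crit q' by (intro mult_right_mono) (auto simp: lam_def)
    moreover have "q * lam + m * e = lam * q' - (1 / q - 1 / q') * q'"
      using q q' by (simp add: m_def e_def field_simps)
    ultimately show ?thesis by simp
  qed
  have bound: "ennreal (gauss_rms \<alpha> c r powr q') \<le> ennreal D * (\<integral>\<^sup>+s\<in>{r - 1..r + 1}. \<phi> s \<partial>lborel)"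
    if r: "r \<ge> 4" for r
  proof -
    define G where "G = gauss_rms \<alpha> c r"
    define I where "I = (\<integral>\<^sup>+s\<in>{r - 1..r + 1}. \<phi> s \<partial>lborel)"
    have G0: "G \<ge> 0" using rms_nonneg[OF f, of r] r by (simp add: G_def)
    have "G powr q' = (G powr q) powr e * G powr q"
      using q by (simp add: powr_powr e_def flip: powr_add)
    then have "ennreal (G powr q') = ennreal ((G powr q) powr e) * ennreal (G powr q)"
      by (simp add: ennreal_mult)
    also have "\<dots> \<le> ennreal ((C * T * r powr m) powr e) * (ennreal (C' * r powr (q * lam)) * I)"
      using growth[OF r] loc[OF f r] e unfolding G_def \<phi>_def I_def lam_def
      by (intro mult_mono ennreal_leI powr_mono2) auto
    also have "\<dots> = ennreal ((C * T * r powr m) powr e * (C' * r powr (q * lam))) * I"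
      using C' by (simp add: ennreal_mult mult_ac)
    also have "\<dots> \<le> ennreal D * I"
    proof (intro mult_right_mono ennreal_leI)
      have "(C * T * r powr m) powr e * (C' * r powr (q * lam)) = D * r powr (q * lam + m * e)"
        using C T r by (simp add: D_def powr_mult powr_powr powr_add mult_ac)
      also have "\<dots> \<le> D * r powr 0"
        using expo D r by (intro mult_left_mono powr_mono) auto
      finally show "(C * T * r powr m) powr e * (C' * r powr (q * lam)) \<le> D" using r by simp
    qed simp
    finally show ?thesis by (simp add: G_def I_def)
  qed
  have "(\<integral>\<^sup>+r\<in>{4..}. ennreal (gauss_rms \<alpha> c r powr q' * r) \<partial>lborel)
    \<le> (\<integral>\<^sup>+r. ennreal D * ((\<integral>\<^sup>+s\<in>{r - 1..r + 1}. \<phi> s \<partial>lborel) * ennreal r * indicator {4..} r) \<partial>lborel)"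
  proof (rule nn_integral_mono)
    fix r :: real
    show "ennreal (gauss_rms \<alpha> c r powr q' * r) * indicator {4..} r
      \<le> ennreal D * ((\<integral>\<^sup>+s\<in>{r - 1..r + 1}. \<phi> s \<partial>lborel) * ennreal r * indicator {4..} r)"
    proof (cases "r \<ge> 4")
      case True
      have "ennreal (gauss_rms \<alpha> c r powr q' * r)
        = ennreal (gauss_rms \<alpha> c r powr q') * ennreal r"
        using True by (simp add: ennreal_mult)
      also have "\<dots> \<le> ennreal D * (\<integral>\<^sup>+s\<in>{r - 1..r + 1}. \<phi> s \<partial>lborel) * ennreal r"
        using bound[OF True] by (rule mult_right_mono) simp
      finally show ?thesis using True by (simp add: mult.assoc)
    qed auto
  qed
  also have "\<dots> = ennreal D * (\<integral>\<^sup>+r\<in>{4..}. (\<integral>\<^sup>+s\<in>{r - 1..r + 1}. \<phi> s \<partial>lborel) * ennreal r \<partial>lborel)"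
  proof (rule nn_integral_cmult)
    \<comment> \<open>The window moving with \<open>r\<close> is recast as a fixed strip in the
      plane, which makes the inner integral measurable in \<open>r\<close>.\<close>
    have "(\<lambda>r. (\<integral>\<^sup>+s. \<phi> s * indicator {x. \<bar>fst x - snd x\<bar> \<le> 1} (r, s) \<partial>lborel) * ennreal r * indicator {4..} r) \<in> borel_measurable lborel"
      by measurable
    also have "(\<lambda>r. (\<integral>\<^sup>+s. \<phi> s * indicator {x. \<bar>fst x - snd x\<bar> \<le> 1} (r, s) \<partial>lborel) * ennreal r * indicator {4..} r)
      = (\<lambda>r. (\<integral>\<^sup>+s\<in>{r - 1..r + 1}. \<phi> s \<partial>lborel) * ennreal r * indicator {4..} r)"
    proof
      fix r :: real
      have "(\<integral>\<^sup>+s. \<phi> s * indicator {x. \<bar>fst x - snd x\<bar> \<le> 1} (r, s) \<partial>lborel) = (\<integral>\<^sup>+s\<in>{r - 1..r + 1}. \<phi> s \<partial>lborel)"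
        by (intro nn_integral_cong) (auto simp: indicator_def)
      then show "(\<integral>\<^sup>+s. \<phi> s * indicator {x. \<bar>fst x - snd x\<bar> \<le> 1} (r, s) \<partial>lborel) * ennreal r * indicator {4..} r
        = (\<integral>\<^sup>+s\<in>{r - 1..r + 1}. \<phi> s \<partial>lborel) * ennreal r * indicator {4..} r" by simp
    qed
    finally show "(\<lambda>r. (\<integral>\<^sup>+s\<in>{r - 1..r + 1}. \<phi> s \<partial>lborel) * ennreal r * indicator {4..} r) \<in> borel_measurable lborel" .
  qed
  also have "\<dots> \<le> ennreal D * (4 * (\<integral>\<^sup>+s\<in>{0..}. \<phi> s * ennreal s \<partial>lborel))"
    by (intro mult_left_mono nn_integral_window_le) auto
  also have "\<dots> < \<infinity>"
  proof -
    have "ennreal (\<alpha> * q) * (\<integral>\<^sup>+s\<in>{0..}. \<phi> s * ennreal s \<partial>lborel)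
      = (\<integral>\<^sup>+s. ennreal (\<alpha> * q) * (\<phi> s * ennreal s * indicator {0..} s) \<partial>lborel)"
      by (rule nn_integral_cmult[symmetric]) measurable
    also have "\<dots> = fock_integral \<alpha> p q f"
      unfolding fock_integral_weighted using \<alpha> q
      by (intro nn_integral_cong) (auto simp: \<phi>_def indicator_def ennreal_mult'[symmetric] mult_ac)
    finally have "ennreal (\<alpha> * q) * (\<integral>\<^sup>+s\<in>{0..}. \<phi> s * ennreal s \<partial>lborel) < \<infinity>"
      using fin by simp
    then have "(\<integral>\<^sup>+s\<in>{0..}. \<phi> s * ennreal s \<partial>lborel) < \<infinity>"
      using \<alpha> q by (auto simp: ennreal_mult_less_top)
    then show ?thesis by (auto simp: ennreal_mult_less_top)
  qed
  finally show "(\<integral>\<^sup>+r\<in>{4..}. ennreal (gauss_rms \<alpha> c r powr q' * r) \<partial>lborel) < \<infinity>" .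
qed (use assms in auto)

text \<open>Replacing \<open>p\<close> by \<open>min p 2\<close> enlarges the space without spoiling
  the condition: at exponent 2 it reads \<open>q \<le> q'\<close>.\<close>

lemma fock_embedding:
  fixes \<alpha> \<beta> p q q' :: real
  assumes pos: "\<alpha> > 0" "\<beta> > 0" "p > 0" "q > 0" "q' > 0"
    and cond: "\<alpha> < \<beta> \<or> (\<alpha> = \<beta> \<and> q \<le> q' \<and> 1 / p + 1 / q' - 1 / q \<le> 1 / 2)"
    and f: "f \<in> fock_space \<alpha> p q"
  shows "f \<in> fock_space \<beta> 2 q'"
proof -
  have hol: "f holomorphic_on UNIV" and fin: "fock_integral \<alpha> p q f < \<infinity>"
    using f by (auto simp: mem_fock_space_iff)
  have sums: "everywhere_sums (taylor_coeff f) f" by (rule everywhere_sums_taylor[OF hol])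
  have "fock_integral \<alpha> (min p 2) q f \<le> fock_integral \<alpha> p q f"
    using pos by (intro fock_integral_mono_exponent holomorphic_on_imp_continuous_on[OF hol]) auto
  then have fin': "fock_integral \<alpha> (min p 2) q f < \<infinity>" using fin by (rule order_le_less_trans)
  have "fock_integral \<beta> 2 q' f < \<infinity>"
  proof (cases "\<alpha> < \<beta>")
    case True
    show ?thesis
      by (rule fock_embedding_larger_weight[OF sums pos(1) True _ _ pos(4,5) fin']) (use pos in auto)
  next
    case False
    then have c: "\<alpha> = \<beta>" "q \<le> q'" "1 / p + 1 / q' - 1 / q \<le> 1 / 2" using cond by auto
    have "1 / min p 2 - 1 / 2 \<le> 1 / q - 1 / q'"
    proof (cases "p \<le> 2")
      case True
      then show ?thesis using c by simp
    next
      case False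
      have "1 / q' \<le> 1 / q" using c pos by (simp add: frac_le)
      then show ?thesis using False by simp
    qed
    then show ?thesis
      unfolding c(1)[symmetric] using pos c fin'
      by (intro fock_embedding_same_weight[OF sums, where p = "min p 2" and q = q]) auto
  qed
  then show ?thesis using hol by (simp add: mem_fock_space_iff)
qed

section \<open>Randomized power series\<close>

lemma mgf_bounded_law:
  fixes \<mu> :: "complex measure" and z :: complex
  assumes \<mu>: "prob_space \<mu>" "sets \<mu> = sets borel" and bd: "AE x in \<mu>. norm x = 1"
    and mean: "(\<integral>x. x \<partial>\<mu>) = 0"
  shows "(\<integral>\<^sup>+x. ennreal (exp (Re (z * x))) \<partial>\<mu>) \<le> ennreal (exp ((norm z)\<^sup>2 / 2))"
proof -
  interpret prob_space \<mu> by fact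
  note [measurable_cong] = \<mu>(2)
  interpret interval_bounded_random_variable \<mu> "\<lambda>x. Re (z * x)" "- norm z" "norm z"
  proof
    show "AE x in \<mu>. Re (z * x) \<in> {- norm z..norm z}"
      using bd
    proof eventually_elim
      case (elim x)
      then show ?case using abs_Re_le_cmod[of "z * x"] by (auto simp: norm_mult abs_le_iff)
    qed
  qed measurable
  have "integrable \<mu> (\<lambda>x. x)"
    using bd by (intro integrable_const_bound[where B = 1]) auto
  then have "expectation (\<lambda>x. Re (z * x)) = 0"
    using mean by simp
  \<comment> \<open>\<open>Re (z * x)\<close> ranges over an interval of length
    \<open>2 * norm z\<close>; Hoeffding's exponent, the squared length over 8, is
    \<open>(norm z)\<^sup>2 / 2\<close>.\<close>
  from Hoeffdings_lemma_nn_integral_0[of 1, OF _ this]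
  show ?thesis by (simp add: power_mult_distrib)
qed

lemma second_moment_bounded_law:
  fixes \<mu> :: "complex measure"
  assumes "prob_space \<mu>" "AE x in \<mu>. norm x = 1"
  shows "(\<integral>\<^sup>+x. ennreal ((norm x)\<^sup>2) \<partial>\<mu>) = 1"
proof -
  interpret prob_space \<mu> by fact
  have "(\<integral>\<^sup>+x. ennreal ((norm x)\<^sup>2) \<partial>\<mu>) = (\<integral>\<^sup>+x. 1 \<partial>\<mu>)"
    by (rule nn_integral_cong_AE) (use assms(2) in eventually_elim, simp)
  then show ?thesis by (simp add: emeasure_space_1)
qed

lemma bernoulli_law_facts:
  shows "prob_space bernoulli_law" "sets bernoulli_law = sets borel"
    "AE x in bernoulli_law. norm x = 1" "(\<integral>x. x \<partial>bernoulli_law) = 0"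
proof -
  show "prob_space bernoulli_law"
    unfolding bernoulli_law_def by (intro prob_space.prob_space_distr prob_space_measure_pmf) simp
  show "AE x in bernoulli_law. norm x = 1"
    unfolding bernoulli_law_def by (subst AE_distr_iff) (auto simp: AE_measure_pmf_iff)
  show "(\<integral>x. x \<partial>bernoulli_law) = 0"
  proof -
    have "(\<integral>x. x \<partial>measure_pmf (pmf_of_set {1, - 1 :: complex}))
        = (\<Sum>x\<in>{1, - 1}. pmf (pmf_of_set {1, - 1}) x *\<^sub>R x)"
      by (rule integral_measure_pmf) auto
    then show ?thesis
      unfolding bernoulli_law_def by (subst integral_distr) auto
  qed
qed (simp add: bernoulli_law_def)

lemma steinhaus_law_facts:
  shows "prob_space steinhaus_law" "sets steinhaus_law = sets borel"
    "AE x in steinhaus_law. norm x = 1" "(\<integral>x. x \<partial>steinhaus_law) = 0"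
proof -
  have [measurable]: "cis \<in> borel_measurable borel"
    by (intro borel_measurable_continuous_onI continuous_intros)
  have eq: "steinhaus_law = distr circ borel cis"
    by (simp add: steinhaus_law_def circ_def)
  show "prob_space steinhaus_law"
    unfolding eq by (intro circ.prob_space_distr) measurable
  show "AE x in steinhaus_law. norm x = 1"
    unfolding eq by (subst AE_distr_iff) auto
  show "(\<integral>x. x \<partial>steinhaus_law) = 0"
    unfolding eq using circ_integral_cis[of 1] by (subst integral_distr) auto
qed (simp add: steinhaus_law_def)

lemma gaussian_law_facts:
  shows "sets gaussian_law = sets borel"
    and "(\<integral>\<^sup>+x. ennreal (exp (Re (z * x))) \<partial>gaussian_law) \<le> ennreal (exp ((norm z)\<^sup>2 / 2))"
    and "(\<integral>\<^sup>+x. ennreal ((norm x)\<^sup>2) \<partial>gaussian_law) = 1"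
proof -
  show "sets gaussian_law = sets borel" by (simp add: gaussian_law_def)
  define a where "a = Re z"
  have "(\<integral>\<^sup>+x. ennreal (exp (Re (z * x))) \<partial>gaussian_law)
      = (\<integral>\<^sup>+x. ennreal (std_normal_density x) * ennreal (exp (a * x)) \<partial>lborel)"
    unfolding gaussian_law_def a_def by (simp add: nn_integral_distr nn_integral_density)
  \<comment> \<open>Completing the square moves the mean of the normal density from 0 to
    \<open>a\<close>.\<close>
  also have "\<dots> = (\<integral>\<^sup>+x. ennreal (exp (a\<^sup>2 / 2)) * ennreal (normal_density a 1 x) \<partial>lborel)"
  proof (rule nn_integral_cong)
    fix x :: real
    have "std_normal_density x * exp (a * x) = exp (a\<^sup>2 / 2) * normal_density a 1 x"
      by (simp add: normal_density_def power2_diff field_simps flip: exp_add)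
    then show "ennreal (std_normal_density x) * ennreal (exp (a * x)) = ennreal (exp (a\<^sup>2 / 2)) * ennreal (normal_density a 1 x)"
      by (simp add: normal_density_nonneg flip: ennreal_mult)
  qed
  also have "\<dots> = ennreal (exp (a\<^sup>2 / 2))"
    by (simp add: nn_integral_cmult nn_integral_eq_integral normal_density_nonneg)
  also have "\<dots> \<le> ennreal (exp ((norm z)\<^sup>2 / 2))"
    using power_mono[OF abs_Re_le_cmod[of z], of 2] by (intro ennreal_leI) (simp add: a_def)
  finally show "(\<integral>\<^sup>+x. ennreal (exp (Re (z * x))) \<partial>gaussian_law) \<le> ennreal (exp ((norm z)\<^sup>2 / 2))" .
  have "(\<integral>\<^sup>+x. ennreal ((norm x)\<^sup>2) \<partial>gaussian_law) = (\<integral>\<^sup>+x. ennreal (std_normal_density x * x\<^sup>2) \<partial>lborel)"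
    unfolding gaussian_law_def by (simp add: nn_integral_distr nn_integral_density ennreal_mult normal_density_nonneg)
  also have "\<dots> = ennreal 1"
    using std_normal_moment_even[of 1]
    by (subst nn_integral_eq_integral) (auto simp: has_bochner_integral_iff normal_density_nonneg fact_numeral)
  finally show "(\<integral>\<^sup>+x. ennreal ((norm x)\<^sup>2) \<partial>gaussian_law) = 1" by simp
qed

text \<open>From here on the laws enter only through independence, the exponential bound
  \<open>X_mgf\<close> and the second moment, so the three cases are treated together.\<close>

locale standard_sequence = prob_space M for M :: "'w measure" +
  fixes X :: "nat \<Rightarrow> 'w \<Rightarrow> complex"
  assumes standard: "standard_random_sequence M X"
begin

lemma indep: "indep_vars (\<lambda>_. borel) X UNIV"
  using standard by (auto simp: standard_random_sequence_def iid_sequence_def)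

lemma X_measurable [measurable]: "X n \<in> borel_measurable M"
  using indep by (auto simp: indep_vars_def)

lemma law_cases: "distr M borel (X n) \<in> {bernoulli_law, steinhaus_law, gaussian_law}"
  using standard by (auto simp: standard_random_sequence_def iid_sequence_def)

lemma X_mgf: "(\<integral>\<^sup>+\<omega>. ennreal (exp (Re (z * X n \<omega>))) \<partial>M) \<le> ennreal (exp ((norm z)\<^sup>2 / 2))"
proof -
  have "(\<integral>\<^sup>+\<omega>. ennreal (exp (Re (z * X n \<omega>))) \<partial>M) = (\<integral>\<^sup>+x. ennreal (exp (Re (z * x))) \<partial>distr M borel (X n))"
    by (subst nn_integral_distr) auto
  then show ?thesis
    using law_cases[of n] mgf_bounded_law[OF bernoulli_law_facts] mgf_bounded_law[OF steinhaus_law_facts]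
      gaussian_law_facts(2) by auto
qed

lemma X_second_moment: "(\<integral>\<^sup>+\<omega>. ennreal ((norm (X n \<omega>))\<^sup>2) \<partial>M) = 1"
proof -
  have "(\<integral>\<^sup>+\<omega>. ennreal ((norm (X n \<omega>))\<^sup>2) \<partial>M) = (\<integral>\<^sup>+x. ennreal ((norm x)\<^sup>2) \<partial>distr M borel (X n))"
    by (subst nn_integral_distr) auto
  then show ?thesis
    using law_cases[of n] second_moment_bounded_law[OF bernoulli_law_facts(1,3)]
      second_moment_bounded_law[OF steinhaus_law_facts(1,3)] gaussian_law_facts(3) by auto
qed

text \<open>By independence the expectation factorizes and the Gaussian exponents add up to the sum
  of the squared coefficients.\<close>

lemma partial_sum_mgf:
  "(\<integral>\<^sup>+\<omega>. ennreal (exp (Re (z * (\<Sum>n<N. c n * X n \<omega>)))) \<partial>M)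
    \<le> ennreal (exp ((norm z)\<^sup>2 / 2 * (\<Sum>n<N. (norm (c n))\<^sup>2)))"
proof -
  have "(\<integral>\<^sup>+\<omega>. ennreal (exp (Re (z * (\<Sum>n<N. c n * X n \<omega>)))) \<partial>M)
      = (\<integral>\<^sup>+\<omega>. (\<Prod>n<N. ennreal (exp (Re (z * c n * X n \<omega>)))) \<partial>M)"
    by (simp add: sum_distrib_left Re_sum exp_sum prod_ennreal mult.assoc)
  also have "\<dots> = (\<Prod>n<N. \<integral>\<^sup>+\<omega>. ennreal (exp (Re (z * c n * X n \<omega>))) \<partial>M)"
  proof (rule indep_vars_nn_integral)
    show "indep_vars (\<lambda>_. borel) (\<lambda>n \<omega>. ennreal (exp (Re (z * c n * X n \<omega>)))) {..<N}"
      by (rule indep_vars_compose2[where M' = "\<lambda>_. borel" and Y = "\<lambda>n x. ennreal (exp (Re (z * c n * x)))"])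
         (auto intro: indep_vars_subset[OF indep])
  qed auto
  also have "\<dots> \<le> (\<Prod>n<N. ennreal (exp ((norm (z * c n))\<^sup>2 / 2)))"
    by (intro prod_mono_ennreal X_mgf)
  also have "\<dots> = ennreal (exp ((norm z)\<^sup>2 / 2 * (\<Sum>n<N. (norm (c n))\<^sup>2)))"
    by (simp add: prod_ennreal norm_mult power_mult_distrib sum_distrib_left flip: exp_sum)
  finally show ?thesis .
qed

text \<open>A power is dominated by an exponential, and the modulus by the four directions of the
  coordinate axes. At scale \<open>2 / \<sigma>\<close> each exponential moment is at most
  \<open>exp 2\<close>, whence \<open>4 * exp 2\<close>; \<open>s powr s\<close> comes from
  \<open>y powr s \<le> s powr s * exp y\<close>.\<close>

lemma partial_sum_moment:
  assumes s: "s > 0" and \<sigma>: "\<sigma> > 0" "(\<Sum>n<N. (norm (c n))\<^sup>2) \<le> \<sigma>\<^sup>2"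
  shows "(\<integral>\<^sup>+\<omega>. ennreal (norm (\<Sum>n<N. c n * X n \<omega>) powr s) \<partial>M) \<le> ennreal (4 * s powr s * exp 2 * \<sigma> powr s)"
proof -
  define S where "S \<omega> = (\<Sum>n<N. c n * X n \<omega>)" for \<omega>
  have [measurable]: "S \<in> borel_measurable M" unfolding S_def by measurable
  define Z where "Z = [2 / of_real \<sigma>, - 2 / of_real \<sigma>, 2 * \<i> / of_real \<sigma>, - 2 * \<i> / complex_of_real \<sigma>]"
  have "norm w powr s \<le> \<sigma> powr s * s powr s * (\<Sum>z\<leftarrow>Z. exp (Re (z * w)))" for w :: complex
  proof (cases "w = 0")
    case True
    then show ?thesis by (auto intro!: mult_nonneg_nonneg sum_list_nonneg)
  next
    case False
    define y where "y = norm w / \<sigma>"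
    define a b where "a = Re w / \<sigma>" and "b = Im w / \<sigma>"
    have y: "y > 0" using False \<sigma> by (simp add: y_def)
    have "y powr s = s powr s * (y / s) powr s"
      using y s by (subst powr_mult[symmetric]) auto
    also have "(y / s) powr s \<le> exp y"
    proof -
      have "s * ln (y / s) \<le> s * (y / s - 1)"
        using y s by (intro mult_left_mono ln_le_minus_one) auto
      also have "\<dots> \<le> y" using s by (simp add: field_simps)
      finally show ?thesis using y s by (simp add: powr_def)
    qed
    also have "exp y \<le> exp (\<bar>a\<bar> + \<bar>b\<bar>)"
      using cmod_le[of w] \<sigma> by (simp add: y_def a_def b_def field_simps)
    also have "\<dots> \<le> exp (2 * a) + exp (- 2 * a) + exp (2 * b) + exp (- 2 * b)"
    proof -
      have m: "\<bar>a\<bar> + \<bar>b\<bar> \<le> 2 * a \<or> \<bar>a\<bar> + \<bar>b\<bar> \<le> - 2 * a \<or> \<bar>a\<bar> + \<bar>b\<bar> \<le> 2 * b \<or> \<bar>a\<bar> + \<bar>b\<bar> \<le> - 2 * b"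
        by linarith
      have "exp (\<bar>a\<bar> + \<bar>b\<bar>) \<le> exp (2 * a) \<or> exp (\<bar>a\<bar> + \<bar>b\<bar>) \<le> exp (- 2 * a)
        \<or> exp (\<bar>a\<bar> + \<bar>b\<bar>) \<le> exp (2 * b) \<or> exp (\<bar>a\<bar> + \<bar>b\<bar>) \<le> exp (- 2 * b)"
        using m by simp
      then show ?thesis
        using exp_gt_zero[of "2 * a"] exp_gt_zero[of "- 2 * a"] exp_gt_zero[of "2 * b"] exp_gt_zero[of "- 2 * b"]
        by linarith
    qed
    also have "\<dots> = (\<Sum>z\<leftarrow>Z. exp (Re (z * w)))"
      using \<sigma> by (simp add: Z_def a_def b_def Re_divide Im_divide power2_eq_square field_simps)
    finally have "y powr s \<le> s powr s * (\<Sum>z\<leftarrow>Z. exp (Re (z * w)))" by (simp add: mult_left_mono)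
    moreover have "norm w powr s = \<sigma> powr s * y powr s"
      using \<sigma> y by (simp add: y_def flip: powr_mult)
    ultimately show ?thesis by (simp add: mult.assoc mult_left_mono)
  qed
  then have "(\<integral>\<^sup>+\<omega>. ennreal (norm (S \<omega>) powr s) \<partial>M)
    \<le> (\<integral>\<^sup>+\<omega>. ennreal (\<sigma> powr s * s powr s) * (\<Sum>z\<leftarrow>Z. ennreal (exp (Re (z * S \<omega>)))) \<partial>M)"
    by (intro nn_integral_mono) (auto simp: Z_def ennreal_mult'[symmetric] simp flip: ennreal_plus intro!: ennreal_leI)
  also have "\<dots> = ennreal (\<sigma> powr s * s powr s) * (\<Sum>z\<leftarrow>Z. \<integral>\<^sup>+\<omega>. ennreal (exp (Re (z * S \<omega>))) \<partial>M)"
    by (subst nn_integral_cmult) (simp_all add: Z_def nn_integral_add)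
  also have "\<dots> \<le> ennreal (\<sigma> powr s * s powr s) * (\<Sum>z\<leftarrow>Z. ennreal (exp 2))"
  proof (intro mult_left_mono sum_list_mono)
    fix z assume z: "z \<in> set Z"
    have "norm z = 2 / \<sigma>" using z \<sigma> by (auto simp: Z_def norm_divide norm_mult)
    then have "(norm z)\<^sup>2 / 2 * (\<Sum>n<N. (norm (c n))\<^sup>2) \<le> (2 / \<sigma>)\<^sup>2 / 2 * \<sigma>\<^sup>2"
      using \<sigma> by (intro mult_mono) (auto simp: sum_nonneg)
    also have "\<dots> = 2" using \<sigma> by (simp add: power_divide)
    finally have "ennreal (exp ((norm z)\<^sup>2 / 2 * (\<Sum>n<N. (norm (c n))\<^sup>2))) \<le> ennreal (exp 2)"
      by (intro ennreal_leI) simp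
    with partial_sum_mgf[of z c N] show "(\<integral>\<^sup>+\<omega>. ennreal (exp (Re (z * S \<omega>))) \<partial>M) \<le> ennreal (exp 2)"
      unfolding S_def by (rule order_trans)
  qed simp
  also have "\<dots> = ennreal (4 * s powr s * exp 2 * \<sigma> powr s)"
  proof -
    have "(\<Sum>z\<leftarrow>Z. ennreal (exp 2)) = ennreal (4 * exp 2)"
      by (simp add: Z_def flip: ennreal_plus)
    then show ?thesis by (simp add: mult_ac flip: ennreal_mult')
  qed
  finally show ?thesis unfolding S_def .
qed


lemma X_first_moment: "(\<integral>\<^sup>+\<omega>. ennreal (norm (X n \<omega>)) \<partial>M) \<le> 2"
proof -
  have "x \<le> 1 + x\<^sup>2" for x :: real
    using sum_power2_ge_zero[of "x - 1 / 2" 0] by (simp add: power2_eq_square algebra_simps)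
  then have "(\<integral>\<^sup>+\<omega>. ennreal (norm (X n \<omega>)) \<partial>M) \<le> (\<integral>\<^sup>+\<omega>. 1 + ennreal ((norm (X n \<omega>))\<^sup>2) \<partial>M)"
    by (intro nn_integral_mono) (auto simp flip: ennreal_1 ennreal_plus intro!: ennreal_leI)
  also have "\<dots> = 2"
    by (subst nn_integral_add) (auto simp: X_second_moment emeasure_space_1)
  finally show ?thesis .
qed

text \<open>Bounded first moments make the series of norms finite in expectation on every circle of
  integer radius; countably many radii yield one null set for all \<open>z\<close>.\<close>

lemma AE_random_series_converges:
  assumes f: "everywhere_sums a f"
  shows "AE \<omega> in M. \<forall>z. summable (\<lambda>n. a n * X n \<omega> * z ^ n)"
proof -
  have "AE \<omega> in M. summable (\<lambda>n. norm (a n * X n \<omega>) * real R ^ n)" for R :: nat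
  proof -
    have "(\<integral>\<^sup>+\<omega>. (\<Sum>n. ennreal (norm (a n * X n \<omega>) * real R ^ n)) \<partial>M)
        = (\<Sum>n. \<integral>\<^sup>+\<omega>. ennreal (norm (a n) * real R ^ n) * ennreal (norm (X n \<omega>)) \<partial>M)"
      by (subst nn_integral_suminf) (auto simp: norm_mult mult_ac simp flip: ennreal_mult')
    also have "\<dots> \<le> (\<Sum>n. ennreal (norm (a n) * real R ^ n * 2))"
    proof (intro suminf_le)
      fix n
      have "(\<integral>\<^sup>+\<omega>. ennreal (norm (a n) * real R ^ n) * ennreal (norm (X n \<omega>)) \<partial>M)
        = ennreal (norm (a n) * real R ^ n) * (\<integral>\<^sup>+\<omega>. ennreal (norm (X n \<omega>)) \<partial>M)"
        by (rule nn_integral_cmult) measurable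
      also have "\<dots> \<le> ennreal (norm (a n) * real R ^ n) * 2"
        by (intro mult_left_mono X_first_moment) auto
      finally show "(\<integral>\<^sup>+\<omega>. ennreal (norm (a n) * real R ^ n) * ennreal (norm (X n \<omega>)) \<partial>M)
        \<le> ennreal (norm (a n) * real R ^ n * 2)"
        by (simp add: ennreal_mult)
    qed auto
    also have "\<dots> < \<infinity>"
      by (subst suminf_ennreal2[OF _ summable_mult2[OF everywhere_sums_norm_summable[OF f]]]) auto
    finally have "AE \<omega> in M. (\<Sum>n. ennreal (norm (a n * X n \<omega>) * real R ^ n)) \<noteq> \<infinity>"
      by (intro nn_integral_noteq_infinite) auto
    then show ?thesis
    proof eventually_elim
      case (elim \<omega>)
      then show ?case by (intro summable_suminf_not_top) auto
    qed
  qed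
  then have "AE \<omega> in M. \<forall>R::nat. summable (\<lambda>n. norm (a n * X n \<omega>) * real R ^ n)"
    by (simp add: AE_all_countable)
  then show ?thesis
  proof eventually_elim
    case (elim \<omega>)
    show ?case
    proof
      fix z :: complex
      obtain R :: nat where R: "norm z \<le> real R" using real_arch_simple by blast
      show "summable (\<lambda>n. a n * X n \<omega> * z ^ n)"
      proof (rule summable_comparison_test'[where N = 0])
        show "summable (\<lambda>n. norm (a n * X n \<omega>) * real R ^ n)" using elim by blast
        show "norm (a n * X n \<omega> * z ^ n) \<le> norm (a n * X n \<omega>) * real R ^ n" for n
          using R by (simp add: norm_mult norm_power mult_left_mono power_mono)
      qed
    qed
  qed
qed

lemma AE_randomization_sums:
  assumes f: "everywhere_sums (taylor_coeff f) f"
  shows "AE \<omega> in M. everywhere_sums (\<lambda>n. taylor_coeff f n * X n \<omega>) (randomization X f \<omega>)"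
  using AE_random_series_converges[OF f]
  by eventually_elim (auto simp: everywhere_sums_def randomization_def[abs_def] intro!: summable_sums)

text \<open>Joint measurability in the sample and the point underlies every exchange of integrals
  below.\<close>

lemma randomization_measurable [measurable]:
  assumes [measurable]: "g \<in> measurable N M" "h \<in> borel_measurable N"
  shows "(\<lambda>x. randomization X f (g x) (h x)) \<in> borel_measurable N"
  unfolding randomization_def by measurable

text \<open>The degenerate case of a vanishing mean square is split off because the exponential
  estimates divide by it.\<close>

lemma randomization_zero:
  assumes f: "everywhere_sums (taylor_coeff f) f" and "rms (taylor_coeff f) (norm z) = 0"
  shows "randomization X f \<omega> z = 0"
proof -
  have "(\<Sum>n. (norm (taylor_coeff f n) * norm z ^ n)\<^sup>2) = 0"
    using assms(2) rms_square[OF f, of "norm z"] by simp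
  then have "\<forall>n. (norm (taylor_coeff f n) * norm z ^ n)\<^sup>2 = 0"
    using suminf_eq_zero_iff[OF everywhere_sums_square_summable[OF f, of "norm z"]] by auto
  then have "taylor_coeff f n * X n \<omega> * z ^ n = 0" for n by auto
  then show ?thesis unfolding randomization_def by (simp only: suminf_zero)
qed

text \<open>Fatou's lemma carries the uniform moment bound from the partial sums to their almost
  sure limit.\<close>

lemma randomization_moment:
  assumes f: "everywhere_sums (taylor_coeff f) f" and s: "s > 0"
  shows "(\<integral>\<^sup>+\<omega>. ennreal (norm (randomization X f \<omega> z) powr s) \<partial>M)
    \<le> ennreal (4 * s powr s * exp 2 * rms (taylor_coeff f) (norm z) powr s)"
proof (cases "rms (taylor_coeff f) (norm z) = 0")
  case True
  then show ?thesis by (simp add: randomization_zero[OF f])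
next
  case False
  define \<sigma> where "\<sigma> = rms (taylor_coeff f) (norm z)"
  have \<sigma>: "\<sigma> > 0" using False rms_nonneg[OF f, of "norm z"] by (simp add: \<sigma>_def)
  define c where "c n = taylor_coeff f n * z ^ n" for n
  define S where "S N \<omega> = (\<Sum>n<N. c n * X n \<omega>)" for N \<omega>
  have [measurable]: "S N \<in> borel_measurable M" for N unfolding S_def by measurable
  have c: "norm (c n) = norm (taylor_coeff f n) * norm z ^ n" for n
    by (simp add: c_def norm_mult norm_power)
  have le: "(\<Sum>n<N. (norm (c n))\<^sup>2) \<le> \<sigma>\<^sup>2" for N
    unfolding \<sigma>_def rms_square[OF f norm_ge_zero] c
    by (intro sum_le_suminf everywhere_sums_square_summable[OF f]) auto
  have "AE \<omega> in M. (\<lambda>N. ennreal (norm (S N \<omega>) powr s)) \<longlonglongrightarrow> ennreal (norm (randomization X f \<omega> z) powr s)"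
    using AE_randomization_sums[OF f]
  proof eventually_elim
    case (elim \<omega>)
    then have "(\<lambda>N. S N \<omega>) \<longlonglongrightarrow> randomization X f \<omega> z"
      unfolding everywhere_sums_def sums_def S_def c_def by (simp add: mult_ac)
    then show ?case using s by (intro tendsto_ennrealI tendsto_powr' tendsto_norm tendsto_const) auto
  qed
  then have "AE \<omega> in M. ennreal (norm (randomization X f \<omega> z) powr s) = liminf (\<lambda>N. ennreal (norm (S N \<omega>) powr s))"
    by eventually_elim (rule lim_imp_Liminf[symmetric], auto)
  then have "(\<integral>\<^sup>+\<omega>. ennreal (norm (randomization X f \<omega> z) powr s) \<partial>M)
    = (\<integral>\<^sup>+\<omega>. liminf (\<lambda>N. ennreal (norm (S N \<omega>) powr s)) \<partial>M)"
    by (rule nn_integral_cong_AE)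
  also have "\<dots> \<le> liminf (\<lambda>N. \<integral>\<^sup>+\<omega>. ennreal (norm (S N \<omega>) powr s) \<partial>M)"
    by (rule nn_integral_liminf) measurable
  also have "\<dots> \<le> ennreal (4 * s powr s * exp 2 * \<sigma> powr s)"
  proof (rule Liminf_le)
    show "\<forall>\<^sub>F N in sequentially. (\<integral>\<^sup>+\<omega>. ennreal (norm (S N \<omega>) powr s) \<partial>M) \<le> ennreal (4 * s powr s * exp 2 * \<sigma> powr s)"
      unfolding S_def by (intro always_eventually allI partial_sum_moment[OF s \<sigma> le])
  qed simp
  finally show ?thesis unfolding \<sigma>_def .
qed

lemma cis_measurable [measurable]: "cis \<in> borel_measurable borel"
  by (intro borel_measurable_continuous_onI continuous_intros)

lemma integral_mean_randomization_measurable [measurable]: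
  assumes [measurable]: "g \<in> measurable N M" "h \<in> borel_measurable N"
  shows "(\<lambda>x. integral_mean p (randomization X f (g x)) (h x)) \<in> borel_measurable N"
  unfolding integral_mean_def set_lebesgue_integral_def by measurable

text \<open>When the power equals the exponent of the mean, the outer root disappears and
  expectation and circle integral can be exchanged.\<close>

lemma integral_mean_randomization_moment:
  assumes f: "everywhere_sums (taylor_coeff f) f" and s: "s > 0" and r: "r \<ge> 0"
  shows "(\<integral>\<^sup>+\<omega>. ennreal (integral_mean s (randomization X f \<omega>) r powr s) \<partial>M)
    \<le> ennreal (4 * s powr s * exp 2 * rms (taylor_coeff f) r powr s)"
proof -
  interpret P: pair_sigma_finite M circ ..
  have "AE \<omega> in M. ennreal (integral_mean s (randomization X f \<omega>) r powr s)
      = (\<integral>\<^sup>+t. ennreal (norm (randomization X f \<omega> (of_real r * cis t)) powr s) \<partial>circ)"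
    using AE_randomization_sums[OF f]
  proof eventually_elim
    case (elim \<omega>)
    have cont: "continuous_on UNIV (randomization X f \<omega>)" by (rule everywhere_sums_continuous[OF elim])
    show ?case
      unfolding integral_mean_powr[OF borel_measurable_continuous_onI[OF cont] s]
      by (rule nn_integral_eq_integral[symmetric]) (auto intro: integrable_circle_powr[OF cont s])
  qed
  then have "(\<integral>\<^sup>+\<omega>. ennreal (integral_mean s (randomization X f \<omega>) r powr s) \<partial>M)
    = (\<integral>\<^sup>+\<omega>. \<integral>\<^sup>+t. ennreal (norm (randomization X f \<omega> (of_real r * cis t)) powr s) \<partial>circ \<partial>M)"
    by (rule nn_integral_cong_AE)
  also have "\<dots> = (\<integral>\<^sup>+t. \<integral>\<^sup>+\<omega>. ennreal (norm (randomization X f \<omega> (of_real r * cis t)) powr s) \<partial>M \<partial>circ)"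
    by (rule P.Fubini'[symmetric]) measurable
  also have "\<dots> \<le> (\<integral>\<^sup>+t. ennreal (4 * s powr s * exp 2 * rms (taylor_coeff f) r powr s) \<partial>circ)"
    using r randomization_moment[OF f s, of "of_real r * cis t" for t]
    by (intro nn_integral_mono) (simp add: norm_mult)
  also have "\<dots> = ennreal (4 * s powr s * exp 2 * rms (taylor_coeff f) r powr s)"
    using circ.emeasure_space_1 by simp
  finally show ?thesis .
qed


text \<open>With \<open>s = max p q\<close> different exponents are reduced to equal ones:
  \<open>p \<le> s\<close> allows monotonicity of the means, and \<open>q \<le> s\<close> gives
  \<open>y powr q \<le> 1 + y powr s\<close> for the mean \<open>y\<close> relative to
  \<sigma>.\<close>

lemma integral_mean_randomization_moment_le:
  assumes f: "everywhere_sums (taylor_coeff f) f" and pq: "p > 0" "q > 0" and r: "r \<ge> 0"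
  defines "s \<equiv> max p q"
  shows "(\<integral>\<^sup>+\<omega>. ennreal (integral_mean p (randomization X f \<omega>) r powr q) \<partial>M)
    \<le> ennreal ((1 + 4 * s powr s * exp 2) * rms (taylor_coeff f) r powr q)"
proof (cases "rms (taylor_coeff f) r = 0")
  case True
  then have "randomization X f \<omega> (of_real r * cis t) = 0" for \<omega> t
    using randomization_zero[OF f, of "of_real r * cis t"] r by (simp add: norm_mult)
  then have "integral_mean p (randomization X f \<omega>) r = 0" for \<omega>
    using pq by (simp add: integral_mean_def)
  then show ?thesis by simp
next
  case False
  define \<sigma> where "\<sigma> = rms (taylor_coeff f) r"
  have \<sigma>: "\<sigma> > 0" using False rms_nonneg[OF f r] by (simp add: \<sigma>_def)
  have s: "s > 0" "p \<le> s" "q \<le> s" using pq by (auto simp: s_def)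
  define K where "K = 4 * s powr s * exp 2"
  have K: "K \<ge> 0" by (simp add: K_def)
  have "AE \<omega> in M. ennreal (integral_mean p (randomization X f \<omega>) r powr q)
     \<le> ennreal (\<sigma> powr q) + ennreal (\<sigma> powr (q - s)) * ennreal (integral_mean s (randomization X f \<omega>) r powr s)"
    using AE_randomization_sums[OF f]
  proof eventually_elim
    case (elim \<omega>)
    define y where "y = integral_mean s (randomization X f \<omega>) r / \<sigma>"
    have y: "y \<ge> 0" using \<sigma> by (simp add: y_def)
    have "integral_mean p (randomization X f \<omega>) r \<le> \<sigma> * y"
      using integral_mean_mono[OF everywhere_sums_continuous[OF elim] pq(1) s(2), of r] \<sigma> by (simp add: y_def)
    then have "integral_mean p (randomization X f \<omega>) r powr q \<le> (\<sigma> * y) powr q"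
      using pq by (intro powr_mono2) auto
    also have "\<dots> = \<sigma> powr q * y powr q" using \<sigma> y by (simp add: powr_mult)
    also have "y powr q \<le> 1 + y powr s"
    proof (cases "y \<le> 1")
      case True
      then have "y powr q \<le> 1" using y pq by (intro powr_le1) auto
      then show ?thesis by (simp add: add_increasing2)
    next
      case False
      then have "y powr q \<le> y powr s" using s by (intro powr_mono) auto
      then show ?thesis by simp
    qed
    also have "\<sigma> powr q * (1 + y powr s) = \<sigma> powr q + \<sigma> powr (q - s) * integral_mean s (randomization X f \<omega>) r powr s"
      using \<sigma> by (simp add: y_def powr_divide powr_diff field_simps)
    finally show ?case using \<sigma> by (simp add: mult_left_mono flip: ennreal_mult ennreal_plus)
  qed
  then have "(\<integral>\<^sup>+\<omega>. ennreal (integral_mean p (randomization X f \<omega>) r powr q) \<partial>M)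
    \<le> (\<integral>\<^sup>+\<omega>. ennreal (\<sigma> powr q) + ennreal (\<sigma> powr (q - s)) * ennreal (integral_mean s (randomization X f \<omega>) r powr s) \<partial>M)"
    by (rule nn_integral_mono_AE)
  also have "\<dots> = ennreal (\<sigma> powr q) + ennreal (\<sigma> powr (q - s)) * (\<integral>\<^sup>+\<omega>. ennreal (integral_mean s (randomization X f \<omega>) r powr s) \<partial>M)"
    by (simp add: nn_integral_add nn_integral_cmult emeasure_space_1)
  also have "\<dots> \<le> ennreal (\<sigma> powr q) + ennreal (\<sigma> powr (q - s)) * ennreal (K * \<sigma> powr s)"
    unfolding K_def \<sigma>_def using integral_mean_randomization_moment[OF f s(1) r]
    by (intro add_left_mono mult_left_mono) auto
  also have "\<dots> = ennreal ((1 + K) * \<sigma> powr q)"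
    using \<sigma> K by (simp add: powr_diff field_simps flip: ennreal_mult ennreal_plus)
  finally show ?thesis by (simp add: K_def \<sigma>_def)
qed

lemma fock_integral_randomization_measurable [measurable]:
  "(\<lambda>\<omega>. fock_integral \<beta> p q (randomization X f \<omega>)) \<in> borel_measurable M"
  unfolding fock_integral_split_weight by measurable

text \<open>By Tonelli the expected Fock integral of the randomization is at most a constant times
  the Fock integral of \<open>f\<close> at exponent 2, hence it is almost surely finite.\<close>

theorem randomization_in_fock_space:
  assumes f: "f \<in> fock_space \<beta> 2 q" and pos: "\<beta> > 0" "p > 0" "q > 0"
  shows "AE \<omega> in M. randomization X f \<omega> \<in> fock_space \<beta> p q"
proof -
  have hol: "f holomorphic_on UNIV" and fin: "fock_integral \<beta> 2 q f < \<infinity>"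
    using f by (auto simp: mem_fock_space_iff)
  have sums: "everywhere_sums (taylor_coeff f) f" by (rule everywhere_sums_taylor[OF hol])
  interpret P: pair_sigma_finite M "lborel :: real measure" ..
  define C where "C = 1 + 4 * (max p q) powr (max p q) * exp 2"
  have C: "C \<ge> 0" by (simp add: C_def)
  define w where "w r = ennreal (\<beta> * q * exp (- (\<beta> * q / 2) * r\<^sup>2) * r) * indicator {0..} r" for r
  have [measurable]: "w \<in> borel_measurable borel" unfolding w_def by measurable
  have [measurable]: "integral_mean 2 f \<in> borel_measurable borel"
    by (rule borel_measurable_integral_mean[OF everywhere_sums_measurable[OF sums]])
  have "(\<integral>\<^sup>+\<omega>. fock_integral \<beta> p q (randomization X f \<omega>) \<partial>M)
    = (\<integral>\<^sup>+r. \<integral>\<^sup>+\<omega>. ennreal (integral_mean p (randomization X f \<omega>) r powr q) * w r \<partial>M \<partial>lborel)"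
    unfolding fock_integral_split_weight w_def[symmetric] by (rule P.Fubini'[symmetric]) measurable
  also have "\<dots> \<le> (\<integral>\<^sup>+r. ennreal C * (ennreal (integral_mean 2 f r powr q) * w r) \<partial>lborel)"
  proof (rule nn_integral_mono)
    fix r :: real
    show "(\<integral>\<^sup>+\<omega>. ennreal (integral_mean p (randomization X f \<omega>) r powr q) * w r \<partial>M)
      \<le> ennreal C * (ennreal (integral_mean 2 f r powr q) * w r)"
    proof (cases "r \<ge> 0")
      case True
      have "(\<integral>\<^sup>+\<omega>. ennreal (integral_mean p (randomization X f \<omega>) r powr q) * w r \<partial>M)
        = (\<integral>\<^sup>+\<omega>. ennreal (integral_mean p (randomization X f \<omega>) r powr q) \<partial>M) * w r"
        by (rule nn_integral_multc) measurable
      also have "\<dots> \<le> ennreal (C * rms (taylor_coeff f) r powr q) * w r"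
        unfolding C_def using True pos by (intro mult_right_mono integral_mean_randomization_moment_le[OF sums]) auto
      also have "\<dots> = ennreal C * (ennreal (integral_mean 2 f r powr q) * w r)"
        using C by (simp add: ennreal_mult integral_mean_2[OF sums True] mult_ac)
      finally show ?thesis .
    qed (simp add: w_def)
  qed
  also have "\<dots> = ennreal C * (\<integral>\<^sup>+r. ennreal (integral_mean 2 f r powr q) * w r \<partial>lborel)"
    by (rule nn_integral_cmult) measurable
  also have "(\<integral>\<^sup>+r. ennreal (integral_mean 2 f r powr q) * w r \<partial>lborel) = fock_integral \<beta> 2 q f"
    unfolding fock_integral_split_weight w_def ..
  also have "ennreal C * fock_integral \<beta> 2 q f < \<infinity>"
    using fin by (simp add: ennreal_mult_less_top)
  finally have "AE \<omega> in M. fock_integral \<beta> p q (randomization X f \<omega>) \<noteq> \<infinity>"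
    by (intro nn_integral_noteq_infinite) auto
  with AE_randomization_sums[OF sums] show ?thesis
    by eventually_elim (auto simp: mem_fock_space_iff everywhere_sums_holomorphic top.not_eq_extremum)
qed


section \<open>From the randomization back to the function\<close>

lemma rms_randomization_second_moment:
  assumes f: "everywhere_sums (taylor_coeff f) f" and r: "r \<ge> 0"
  shows "(\<integral>\<^sup>+\<omega>. ennreal ((integral_mean 2 (randomization X f \<omega>) r)\<^sup>2) \<partial>M) = ennreal ((rms (taylor_coeff f) r)\<^sup>2)"
proof -
  define d where "d n = (norm (taylor_coeff f n) * r ^ n)\<^sup>2" for n
  have "AE \<omega> in M. ennreal ((integral_mean 2 (randomization X f \<omega>) r)\<^sup>2) = (\<Sum>n. ennreal (d n) * ennreal ((norm (X n \<omega>))\<^sup>2))"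
    using AE_randomization_sums[OF f]
  proof eventually_elim
    case (elim \<omega>)
    have "(integral_mean 2 (randomization X f \<omega>) r)\<^sup>2 = (\<Sum>n. (norm (taylor_coeff f n * X n \<omega>) * r ^ n)\<^sup>2)"
      by (simp only: integral_mean_2[OF elim r] rms_square[OF elim r])
    also have "ennreal \<dots> = (\<Sum>n. ennreal ((norm (taylor_coeff f n * X n \<omega>) * r ^ n)\<^sup>2))"
      by (rule suminf_ennreal2[symmetric]) (auto intro: everywhere_sums_square_summable[OF elim r])
    also have "\<dots> = (\<Sum>n. ennreal (d n) * ennreal ((norm (X n \<omega>))\<^sup>2))"
      by (simp add: d_def norm_mult power_mult_distrib mult_ac flip: ennreal_mult')
    finally show ?case .
  qed
  then have "(\<integral>\<^sup>+\<omega>. ennreal ((integral_mean 2 (randomization X f \<omega>) r)\<^sup>2) \<partial>M)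
      = (\<integral>\<^sup>+\<omega>. (\<Sum>n. ennreal (d n) * ennreal ((norm (X n \<omega>))\<^sup>2)) \<partial>M)"
    by (rule nn_integral_cong_AE)
  also have "\<dots> = (\<Sum>n. ennreal (d n))"
    by (simp add: nn_integral_suminf nn_integral_cmult X_second_moment)
  also have "\<dots> = ennreal ((rms (taylor_coeff f) r)\<^sup>2)"
    unfolding rms_square[OF f r] d_def
    by (rule suminf_ennreal2) (auto intro: everywhere_sums_square_summable[OF f r])
  finally show ?thesis .
qed

text \<open>A Paley--Zygmund argument: the second and fourth moments of the randomized circle means are
  comparable to powers of \<open>\<sigma>\<close>, which forces the \<open>p\<close>-mean to be of size \<open>\<sigma>\<close> with fixed probability.\<close>

lemma integral_mean_randomization_lower_tail:
  assumes p: "0 < p" "p \<le> 2"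
  shows "\<exists>\<epsilon>>0. \<exists>\<delta>>0. \<forall>f r. everywhere_sums (taylor_coeff f) f \<longrightarrow> r \<ge> 0 \<longrightarrow>
    \<delta> \<le> prob {\<omega> \<in> space M. \<epsilon> * rms (taylor_coeff f) r \<le> integral_mean p (randomization X f \<omega>) r}"
proof -
  \<comment> \<open>\<open>K\<close> is the fourth-moment constant. The choice
    \<open>\<kappa> = 4 * K\<close> makes the fourth-moment term contribute
    \<open>\<sigma>\<^sup>2 / 4\<close>, and \<eta> makes the small-mean term contribute the same;
    half of the second moment is left for the event \<open>A\<close>.\<close>
  define K :: real where "K = 4 * 4 powr 4 * exp 2"
  define \<kappa> where "\<kappa> = 4 * K"
  have K: "K > 0" and \<kappa>: "\<kappa> > 0" by (auto simp: K_def \<kappa>_def)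
  define \<eta> where "\<eta> = 1 / (4 * \<kappa> powr (1 - p / 2))"
  have \<eta>: "\<eta> > 0" using \<kappa> by (simp add: \<eta>_def)
  define \<epsilon> where "\<epsilon> = \<eta> powr (1 / p)"
  have \<epsilon>: "\<epsilon> > 0" using \<eta> by (simp add: \<epsilon>_def)
  have \<epsilon>p: "\<epsilon> powr p = \<eta>" using \<eta> p by (simp add: \<epsilon>_def powr_powr)
  \<comment> \<open>The minimum with 1 serves the case of a vanishing mean square, where the event
    is the whole space.\<close>
  define \<delta> where "\<delta> = min 1 (1 / (2 * \<kappa>))"
  have \<delta>: "\<delta> > 0" using \<kappa> by (simp add: \<delta>_def)
  have "\<delta> \<le> prob {\<omega> \<in> space M. \<epsilon> * rms (taylor_coeff f) r \<le> integral_mean p (randomization X f \<omega>) r}"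
    if f: "everywhere_sums (taylor_coeff f) f" and r: "r \<ge> 0" for f r
  proof (cases "rms (taylor_coeff f) r = 0")
    case True
    then show ?thesis by (simp add: \<delta>_def prob_space)
  next
    case False
    define \<sigma> where "\<sigma> = rms (taylor_coeff f) r"
    have \<sigma>: "\<sigma> > 0" using False rms_nonneg[OF f r] by (simp add: \<sigma>_def)
    define A where "A = {\<omega> \<in> space M. \<epsilon> * \<sigma> \<le> integral_mean p (randomization X f \<omega>) r}"
    have [measurable]: "A \<in> sets M" unfolding A_def by measurable
    define W where "W \<omega> = (integral_mean 2 (randomization X f \<omega>) r)\<^sup>2" for \<omega>
    define V where "V \<omega> = integral_mean 4 (randomization X f \<omega>) r powr 4" for \<omega>
    define Z where "Z \<omega> = integral_mean p (randomization X f \<omega>) r powr p" for \<omega>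
    have [measurable]: "V \<in> borel_measurable M" unfolding V_def by measurable
    have V0: "V \<omega> \<ge> 0" for \<omega> by (simp add: V_def)
    have split: "ennreal (b + c * v) = ennreal b + ennreal c * ennreal v" if "b \<ge> 0" "c \<ge> 0" "v \<ge> 0" for b c v :: real
      using that by (simp add: ennreal_mult)
    have "AE \<omega> in M. ennreal (W \<omega>) \<le> ennreal (\<kappa> * \<sigma>\<^sup>2) * indicator A \<omega> + (ennreal (\<sigma>\<^sup>2 / 4) + ennreal (1 / (\<kappa> * \<sigma>\<^sup>2)) * ennreal (V \<omega>))"
      using AE_randomization_sums[OF f] AE_space
    proof eventually_elim
      case (elim \<omega>)
      define R where "R = randomization X f \<omega>"
      have cont: "continuous_on UNIV R" unfolding R_def by (rule everywhere_sums_continuous[OF elim(1)])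
      have meas: "R \<in> borel_measurable borel" by (rule borel_measurable_continuous_onI[OF cont])
      define g where "g t = norm (R (of_real r * cis t))" for t
      have int: "integrable circ (\<lambda>t. g t powr u)" if "u > 0" for u
        unfolding g_def using integrable_circle_powr[OF cont that] .
      have W: "W \<omega> = (\<integral>t. g t powr 2 \<partial>circ)"
        using integral_mean_powr[OF meas, of 2 r] by (simp add: W_def R_def g_def)
      have V: "V \<omega> = (\<integral>t. g t powr 4 \<partial>circ)"
        using integral_mean_powr[OF meas, of 4 r] by (simp add: V_def R_def g_def)
      have Z: "Z \<omega> = (\<integral>t. g t powr p \<partial>circ)"
        using integral_mean_powr[OF meas p(1), of r] by (simp add: Z_def R_def g_def)
      show ?case
      proof (cases "\<omega> \<in> A")
        case True
        \<comment> \<open>On the event a crude bound suffices: \<open>W\<close> is at most the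
          threshold plus \<open>W\<^sup>2\<close> over the threshold, and
          \<open>W\<^sup>2 \<le> V\<close>.\<close>
        have "integral_mean 2 R r \<le> integral_mean 4 R r"
          by (rule integral_mean_mono[OF cont]) auto
        then have "integral_mean 2 R r powr 4 \<le> integral_mean 4 R r powr 4"
          by (intro powr_mono2) auto
        then have WV: "(W \<omega>)\<^sup>2 \<le> V \<omega>"
          by (simp add: W_def V_def R_def power_mult[symmetric] powr_numeral)
        have "0 \<le> (W \<omega> - \<kappa> * \<sigma>\<^sup>2)\<^sup>2" by simp
        also have "\<dots> = (W \<omega>)\<^sup>2 + (\<kappa> * \<sigma>\<^sup>2) * (\<kappa> * \<sigma>\<^sup>2) - 2 * (W \<omega> * (\<kappa> * \<sigma>\<^sup>2))"
          unfolding power2_diff by (simp add: power2_eq_square)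
        finally have "2 * (W \<omega> * (\<kappa> * \<sigma>\<^sup>2)) \<le> (W \<omega>)\<^sup>2 + (\<kappa> * \<sigma>\<^sup>2) * (\<kappa> * \<sigma>\<^sup>2)" by linarith
        moreover have "0 \<le> W \<omega> * (\<kappa> * \<sigma>\<^sup>2)" using \<kappa> by (simp add: W_def)
        ultimately have "W \<omega> * (\<kappa> * \<sigma>\<^sup>2) \<le> (\<kappa> * \<sigma>\<^sup>2) * (\<kappa> * \<sigma>\<^sup>2) + V \<omega>"
          using WV by linarith
        then have "W \<omega> \<le> \<kappa> * \<sigma>\<^sup>2 + (1 / (\<kappa> * \<sigma>\<^sup>2)) * V \<omega>"
          using \<kappa> \<sigma> by (simp add: field_simps)
        then have "W \<omega> \<le> \<kappa> * \<sigma>\<^sup>2 + (\<sigma>\<^sup>2 / 4 + (1 / (\<kappa> * \<sigma>\<^sup>2)) * V \<omega>)"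
          using zero_le_power2[of \<sigma>] by linarith
        then have "ennreal (W \<omega>) \<le> ennreal (\<kappa> * \<sigma>\<^sup>2 + (\<sigma>\<^sup>2 / 4 + (1 / (\<kappa> * \<sigma>\<^sup>2)) * V \<omega>))"
          by (rule ennreal_leI)
        also have "\<dots> = ennreal (\<kappa> * \<sigma>\<^sup>2) + (ennreal (\<sigma>\<^sup>2 / 4) + ennreal (1 / (\<kappa> * \<sigma>\<^sup>2)) * ennreal (V \<omega>))"
          using \<kappa> \<sigma> V0[of \<omega>] by (subst ennreal_plus, simp, simp, subst split) auto
        finally show ?thesis using True by simp
      next
        case False
        \<comment> \<open>Off the event truncate at height \<open>T\<close>: values below
          \<open>T\<close> are interpolated with the small \<open>p\<close>-mean, values above it
          are paid for by the fourth moment.\<close>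
        define T where "T = sqrt \<kappa> * \<sigma>"
        have T: "T > 0" "T\<^sup>2 = \<kappa> * \<sigma>\<^sup>2" using \<kappa> \<sigma> by (auto simp: T_def power_mult_distrib)
        have pt: "g t powr 2 \<le> T powr (2 - p) * g t powr p + (1 / T\<^sup>2) * g t powr 4" for t
        proof (cases "g t \<le> T")
          case True
          have "g t powr 2 = g t powr (2 - p) * g t powr p" by (simp flip: powr_add)
          also have "\<dots> \<le> T powr (2 - p) * g t powr p"
            using True p by (intro mult_right_mono powr_mono2) (auto simp: g_def)
          finally show ?thesis by (simp add: add_increasing2)
        next
          case False
          have "T\<^sup>2 * (g t)\<^sup>2 \<le> (g t)\<^sup>2 * (g t)\<^sup>2"
            using False T by (intro mult_right_mono power_mono) auto
          also have "\<dots> = (g t) ^ 4" by (simp flip: power_add)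
          finally have "(g t)\<^sup>2 \<le> (1 / T\<^sup>2) * (g t) ^ 4"
            using T(1) by (simp add: field_simps)
          then show ?thesis by (simp add: g_def powr_numeral add_increasing)
        qed
        have "W \<omega> \<le> (\<integral>t. T powr (2 - p) * g t powr p + (1 / T\<^sup>2) * g t powr 4 \<partial>circ)"
          unfolding W by (rule integral_mono) (use int p pt in auto)
        also have "\<dots> = T powr (2 - p) * Z \<omega> + (1 / T\<^sup>2) * V \<omega>"
          unfolding V Z using int p by simp
        also have "T powr (2 - p) * Z \<omega> \<le> T powr (2 - p) * (\<epsilon> * \<sigma>) powr p"
          using False elim(2) p by (intro mult_left_mono) (auto simp: Z_def A_def intro!: powr_mono2)
        also have "\<dots> = \<sigma>\<^sup>2 / 4"
        proof -
          have "T powr (2 - p) = \<kappa> powr (1 - p / 2) * \<sigma> powr (2 - p)"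
            using \<kappa> \<sigma> by (simp add: T_def powr_mult powr_powr field_simps flip: powr_half_sqrt)
          moreover have "(\<epsilon> * \<sigma>) powr p = \<eta> * \<sigma> powr p" using \<epsilon> \<sigma> \<epsilon>p by (simp add: powr_mult)
          ultimately have "T powr (2 - p) * (\<epsilon> * \<sigma>) powr p = (\<kappa> powr (1 - p / 2) * \<eta>) * (\<sigma> powr (2 - p) * \<sigma> powr p)"
            by simp
          also have "\<sigma> powr (2 - p) * \<sigma> powr p = \<sigma>\<^sup>2" using \<sigma> by (simp flip: powr_add)
          also have "\<kappa> powr (1 - p / 2) * \<eta> = 1 / 4" using \<kappa> by (simp add: \<eta>_def)
          finally show ?thesis by simp
        qed
        finally have "W \<omega> \<le> \<sigma>\<^sup>2 / 4 + (1 / (\<kappa> * \<sigma>\<^sup>2)) * V \<omega>" by (simp add: T(2))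
        then have "ennreal (W \<omega>) \<le> ennreal (\<sigma>\<^sup>2 / 4 + (1 / (\<kappa> * \<sigma>\<^sup>2)) * V \<omega>)"
          by (rule ennreal_leI)
        also have "\<dots> = ennreal (\<sigma>\<^sup>2 / 4) + ennreal (1 / (\<kappa> * \<sigma>\<^sup>2)) * ennreal (V \<omega>)"
          using \<kappa> \<sigma> V0[of \<omega>] by (intro split) auto
        finally show ?thesis using False by simp
      qed
    qed
    then have "(\<integral>\<^sup>+\<omega>. ennreal (W \<omega>) \<partial>M)
      \<le> (\<integral>\<^sup>+\<omega>. ennreal (\<kappa> * \<sigma>\<^sup>2) * indicator A \<omega> + (ennreal (\<sigma>\<^sup>2 / 4) + ennreal (1 / (\<kappa> * \<sigma>\<^sup>2)) * ennreal (V \<omega>)) \<partial>M)"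
      by (rule nn_integral_mono_AE)
    also have "\<dots> = ennreal (\<kappa> * \<sigma>\<^sup>2) * emeasure M A + (ennreal (\<sigma>\<^sup>2 / 4) + ennreal (1 / (\<kappa> * \<sigma>\<^sup>2)) * (\<integral>\<^sup>+\<omega>. ennreal (V \<omega>) \<partial>M))"
      by (simp add: nn_integral_add nn_integral_cmult emeasure_space_1)
    also have "\<dots> \<le> ennreal (\<kappa> * \<sigma>\<^sup>2) * ennreal (prob A) + (ennreal (\<sigma>\<^sup>2 / 4) + ennreal (1 / (\<kappa> * \<sigma>\<^sup>2)) * ennreal (K * \<sigma> powr 4))"
      using integral_mean_randomization_moment[OF f _ r, of 4]
      by (intro add_mono mult_left_mono) (auto simp: V_def K_def \<sigma>_def emeasure_eq_measure)
    also have "\<dots> = ennreal (\<kappa> * \<sigma>\<^sup>2 * prob A + (\<sigma>\<^sup>2 / 4 + 1 / (\<kappa> * \<sigma>\<^sup>2) * (K * \<sigma> powr 4)))"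
      using \<kappa> \<sigma> K by (subst ennreal_plus, simp, simp, subst split) (auto simp: ennreal_mult[of "\<kappa> * \<sigma>\<^sup>2" "prob A"])
    finally have "ennreal (\<sigma>\<^sup>2) \<le> ennreal (\<kappa> * \<sigma>\<^sup>2 * prob A + (\<sigma>\<^sup>2 / 4 + 1 / (\<kappa> * \<sigma>\<^sup>2) * (K * \<sigma> powr 4)))"
      unfolding W_def rms_randomization_second_moment[OF f r] \<sigma>_def[symmetric] .
    then have "\<sigma>\<^sup>2 \<le> \<kappa> * \<sigma>\<^sup>2 * prob A + (\<sigma>\<^sup>2 / 4 + 1 / (\<kappa> * \<sigma>\<^sup>2) * (K * \<sigma> powr 4))"
      using \<kappa> \<sigma> K by (subst (asm) ennreal_le_iff) auto
    also have "1 / (\<kappa> * \<sigma>\<^sup>2) * (K * \<sigma> powr 4) = \<sigma>\<^sup>2 / 4"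
      using K \<sigma> by (simp add: \<kappa>_def powr_numeral field_simps flip: power_add)
    finally have "\<sigma>\<^sup>2 * (1 / 2) \<le> \<sigma>\<^sup>2 * (\<kappa> * prob A)" by (simp add: mult_ac)
    then have "1 / 2 \<le> \<kappa> * prob A" using \<sigma> by simp
    then have "1 / (2 * \<kappa>) \<le> prob A" using \<kappa> by (simp add: field_simps)
    then show ?thesis by (simp add: \<delta>_def A_def \<sigma>_def)
  qed
  then show ?thesis using \<epsilon> \<delta> by blast
qed

text \<open>Some event \<open>B L\<close>, on which the Fock integral of the randomization is at
  most \<open>L\<close>, has probability above \<open>1 - \<delta> / 2\<close>. At each radius the
  lower-tail event therefore meets \<open>B L\<close> with probability at least
  \<open>\<delta> / 2\<close>, and integrating over \<open>B L\<close> and all radii bounds the Fock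
  integral of \<open>f\<close> by a multiple of \<open>L\<close>.\<close>

theorem fock_integral_of_randomization:
  assumes hol: "f holomorphic_on UNIV" and pos: "\<beta> > 0" "p > 0" "q > 0"
    and R: "AE \<omega> in M. randomization X f \<omega> \<in> fock_space \<beta> p q"
  shows "f \<in> fock_space \<beta> 2 q"
proof -
  have sums: "everywhere_sums (taylor_coeff f) f" by (rule everywhere_sums_taylor[OF hol])
  interpret P: pair_sigma_finite M "lborel :: real measure" ..
  define p' where "p' = min p 2"
  have p': "0 < p'" "p' \<le> 2" using pos by (auto simp: p'_def)
  define \<Phi> where "\<Phi> \<omega> = fock_integral \<beta> p' q (randomization X f \<omega>)" for \<omega>
  have [measurable]: "\<Phi> \<in> borel_measurable M" unfolding \<Phi>_def by measurable
  have "AE \<omega> in M. \<Phi> \<omega> < \<infinity>"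
    using R
  proof eventually_elim
    case (elim \<omega>)
    then have "continuous_on UNIV (randomization X f \<omega>)" "fock_integral \<beta> p q (randomization X f \<omega>) < \<infinity>"
      by (auto simp: mem_fock_space_iff holomorphic_on_imp_continuous_on)
    then show ?case
      using fock_integral_mono_exponent[of "randomization X f \<omega>" p' p \<beta> q] pos p'
      by (auto simp: \<Phi>_def p'_def intro: order_le_less_trans)
  qed
  obtain \<epsilon> \<delta> where \<epsilon>: "\<epsilon> > 0" and \<delta>: "\<delta> > 0"
    and tail: "\<And>r. r \<ge> 0 \<Longrightarrow> \<delta> \<le> prob {\<omega> \<in> space M. \<epsilon> * rms (taylor_coeff f) r \<le> integral_mean p' (randomization X f \<omega>) r}"
    using integral_mean_randomization_lower_tail[OF p'] sums by blast
  define B where "B n = {\<omega> \<in> space M. \<Phi> \<omega> \<le> of_nat n}" for n :: nat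
  have [measurable]: "B n \<in> sets M" for n unfolding B_def by measurable
  have "(\<lambda>n. prob (B n)) \<longlonglongrightarrow> prob (\<Union>n. B n)"
  proof (rule finite_Lim_measure_incseq)
    show "incseq B"
    proof (rule incseq_SucI)
      fix n
      have "(of_nat n :: ennreal) \<le> of_nat (Suc n)" by (rule of_nat_mono) simp
      then show "B n \<subseteq> B (Suc n)" unfolding B_def by (auto simp del: of_nat_Suc intro: order_trans)
    qed
  qed auto
  moreover have "prob (\<Union>n. B n) = 1"
  proof (rule prob_eq_1[THEN iffD2])
    show "AE \<omega> in M. \<omega> \<in> (\<Union>n. B n)"
      using \<open>AE \<omega> in M. \<Phi> \<omega> < \<infinity>\<close> AE_space
    proof eventually_elim
      case (elim \<omega>)
      then obtain n :: nat where "\<Phi> \<omega> < of_nat n"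
        using ennreal_Ex_less_of_nat[of "\<Phi> \<omega>"] by (auto simp: top.not_eq_extremum)
      then show ?case using elim by (auto simp: B_def intro!: less_imp_le)
    qed
  qed auto
  ultimately have "(\<lambda>n. prob (B n)) \<longlonglongrightarrow> 1" by simp
  then have "eventually (\<lambda>n. prob (B n) > 1 - \<delta> / 2) sequentially"
    using \<delta> by (intro order_tendstoD(1)) auto
  then obtain L where L: "prob (B L) > 1 - \<delta> / 2"
    by (auto simp: eventually_sequentially)
  define w where "w r = ennreal (\<beta> * q * exp (- (\<beta> * q / 2) * r\<^sup>2) * r) * indicator {0..} r" for r
  have [measurable]: "w \<in> borel_measurable borel" unfolding w_def by measurable
  have lower: "ennreal (\<delta> / 2 * \<epsilon> powr q) * ennreal (rms (taylor_coeff f) r powr q)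
    \<le> (\<integral>\<^sup>+\<omega>. ennreal (integral_mean p' (randomization X f \<omega>) r powr q) * indicator (B L) \<omega> \<partial>M)" if r: "r \<ge> 0" for r
  proof -
    define A where "A = {\<omega> \<in> space M. \<epsilon> * rms (taylor_coeff f) r \<le> integral_mean p' (randomization X f \<omega>) r}"
    have [measurable]: "A \<in> sets M" unfolding A_def by measurable
    define \<sigma> where "\<sigma> = rms (taylor_coeff f) r"
    have \<sigma>: "\<sigma> \<ge> 0" unfolding \<sigma>_def by (rule rms_nonneg[OF sums r])
    have "prob A + prob (B L) - prob (A \<inter> B L) = prob (A \<union> B L)"
      by (subst finite_measure_Union') (auto simp: finite_measure_Diff' Int_commute)
    also have "\<dots> \<le> 1" by (rule prob_le_1)
    finally have AB: "\<delta> / 2 \<le> prob (A \<inter> B L)" using tail[OF r] L by (simp add: A_def)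
    have "ennreal (\<delta> / 2 * \<epsilon> powr q) * ennreal (\<sigma> powr q) = ennreal ((\<epsilon> * \<sigma>) powr q) * ennreal (\<delta> / 2)"
      using \<epsilon> \<delta> \<sigma> by (simp add: powr_mult mult_ac flip: ennreal_mult)
    also have "\<dots> \<le> ennreal ((\<epsilon> * \<sigma>) powr q) * emeasure M (A \<inter> B L)"
      using AB by (intro mult_left_mono) (auto simp: emeasure_eq_measure intro!: ennreal_leI)
    also have "\<dots> = (\<integral>\<^sup>+\<omega>. ennreal ((\<epsilon> * \<sigma>) powr q) * indicator (A \<inter> B L) \<omega> \<partial>M)"
      by (rule nn_integral_cmult_indicator[symmetric]) measurable
    also have "\<dots> \<le> (\<integral>\<^sup>+\<omega>. ennreal (integral_mean p' (randomization X f \<omega>) r powr q) * indicator (B L) \<omega> \<partial>M)"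
      using \<epsilon> \<sigma> pos by (intro nn_integral_mono) (auto simp: A_def \<sigma>_def indicator_def intro!: ennreal_leI powr_mono2)
    finally show ?thesis by (simp add: \<sigma>_def)
  qed
  have "ennreal (\<delta> / 2 * \<epsilon> powr q) * fock_integral \<beta> 2 q f
    = (\<integral>\<^sup>+r. ennreal (\<delta> / 2 * \<epsilon> powr q) * (ennreal (integral_mean 2 f r powr q) * w r) \<partial>lborel)"
  proof -
    have [measurable]: "integral_mean 2 f \<in> borel_measurable borel"
      by (rule borel_measurable_integral_mean[OF everywhere_sums_measurable[OF sums]])
    have "fock_integral \<beta> 2 q f = (\<integral>\<^sup>+r. ennreal (integral_mean 2 f r powr q) * w r \<partial>lborel)"
      unfolding fock_integral_split_weight w_def ..
    then show ?thesis by (simp add: nn_integral_cmult)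
  qed
  also have "\<dots> \<le> (\<integral>\<^sup>+r. \<integral>\<^sup>+\<omega>. ennreal (integral_mean p' (randomization X f \<omega>) r powr q) * w r * indicator (B L) \<omega> \<partial>M \<partial>lborel)"
  proof (rule nn_integral_mono)
    fix r :: real
    show "ennreal (\<delta> / 2 * \<epsilon> powr q) * (ennreal (integral_mean 2 f r powr q) * w r)
      \<le> (\<integral>\<^sup>+\<omega>. ennreal (integral_mean p' (randomization X f \<omega>) r powr q) * w r * indicator (B L) \<omega> \<partial>M)"
    proof (cases "r \<ge> 0")
      case True
      have "ennreal (\<delta> / 2 * \<epsilon> powr q) * (ennreal (integral_mean 2 f r powr q) * w r)
        = ennreal (\<delta> / 2 * \<epsilon> powr q) * ennreal (rms (taylor_coeff f) r powr q) * w r"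
        by (simp add: integral_mean_2[OF sums True] mult.assoc)
      also have "\<dots> \<le> (\<integral>\<^sup>+\<omega>. ennreal (integral_mean p' (randomization X f \<omega>) r powr q) * indicator (B L) \<omega> \<partial>M) * w r"
        by (intro mult_right_mono lower[OF True]) simp
      also have "\<dots> = (\<integral>\<^sup>+\<omega>. ennreal (integral_mean p' (randomization X f \<omega>) r powr q) * indicator (B L) \<omega> * w r \<partial>M)"
        by (rule nn_integral_multc[symmetric]) measurable
      finally show ?thesis by (simp add: mult_ac)
    qed (simp add: w_def)
  qed
  also have "\<dots> = (\<integral>\<^sup>+\<omega>. \<integral>\<^sup>+r. ennreal (integral_mean p' (randomization X f \<omega>) r powr q) * w r * indicator (B L) \<omega> \<partial>lborel \<partial>M)"
    by (rule P.Fubini') measurable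
  also have "\<dots> = (\<integral>\<^sup>+\<omega>. \<Phi> \<omega> * indicator (B L) \<omega> \<partial>M)"
    unfolding \<Phi>_def fock_integral_split_weight w_def[symmetric]
    by (intro nn_integral_cong nn_integral_multc) measurable
  also have "\<dots> \<le> (\<integral>\<^sup>+\<omega>. of_nat L \<partial>M)"
    by (intro nn_integral_mono) (auto simp: indicator_def B_def)
  also have "\<dots> < \<infinity>" by (simp add: emeasure_space_1 of_nat_less_top)
  finally have "fock_integral \<beta> 2 q f < \<infinity>"
    using \<epsilon> \<delta> by (auto simp: ennreal_mult_less_top)
  then show ?thesis using hol by (simp add: mem_fock_space_iff)
qed

end

section \<open>Gliding humps\<close>

text \<open>Makes superpositions of humps converge everywhere. The sum of the absolute values of the
  terms increases with the radius, so it can be estimated at a radius \<open>s\<close> where the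
  growth bound holds.\<close>

lemma fock_pointwise_bound:
  fixes \<alpha> p q r :: real
  assumes \<alpha>: "\<alpha> > 0" and p: "p > 0" and q: "q > 0"
  shows "\<exists>B. \<forall>c f z. everywhere_sums c f \<longrightarrow> fock_integral \<alpha> p q f \<le> 1 \<longrightarrow> norm z \<le> r \<longrightarrow> norm (f z) \<le> B"
proof -
  define p' where "p' = min p 2"
  have p': "0 < p'" "p' \<le> 2" "p' \<le> p" using p by (auto simp: p'_def)
  \<comment> \<open>At least 5, so that \<open>s - 1\<close> is still at least 4.\<close>
  define s where "s = max r 5"
  have s: "r \<le> s" "s \<ge> 5" by (auto simp: s_def)
  define m where "m = q * (1 / p' - 1 / 2) - 1"
  obtain C where C: "C > 0" and growth0: "\<forall>c f r T. everywhere_sums c f \<longrightarrow> r \<ge> 4 \<longrightarrow> T \<ge> 0 \<longrightarrow> fock_integral \<alpha> p' q f \<le> ennreal T \<longrightarrow>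
    gauss_rms \<alpha> c r powr q \<le> C * T * r powr m"
    using rms_growth[OF \<alpha> p'(1,2) q] by (elim exE conjE) (rule that, simp_all only: m_def)
  have growth: "gauss_rms \<alpha> c r powr q \<le> C * r powr m"
    if "everywhere_sums c f" "r \<ge> 4" "fock_integral \<alpha> p' q f \<le> 1" for c f r
    using growth0[rule_format, of c f r 1] that by simp
  define U where "U t = (C * t powr m) powr (1 / q)" for t
  have G: "gauss_rms \<alpha> c t \<le> U t"
    if f: "everywhere_sums c f" and fi: "fock_integral \<alpha> p q f \<le> 1" and t: "t \<ge> 4" for c f t
  proof -
    define g where "g = gauss_rms \<alpha> c t"
    have g: "g \<ge> 0" using rms_nonneg[OF f, of t] t by (simp add: g_def)
    have "fock_integral \<alpha> p' q f \<le> 1"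
      using fi fock_integral_mono_exponent[OF everywhere_sums_continuous[OF f] p'(1,3) \<alpha> q] by (rule order_trans[rotated])
    then have "g powr q \<le> C * t powr m" using growth[OF f t] by (simp add: g_def)
    then have "(g powr q) powr (1 / q) \<le> U t" unfolding U_def using q by (intro powr_mono2) auto
    then show ?thesis using q g by (simp add: powr_powr g_def)
  qed
  define K where "K = sqrt (24 * exp (6 * \<alpha>) * (s / 1) * ((U (s + 1))\<^sup>2 + (U (s - 1))\<^sup>2))"
  have "norm (f z) \<le> K * exp ((\<alpha> / 2) * s\<^sup>2)"
    if f: "everywhere_sums c f" and fi: "fock_integral \<alpha> p q f \<le> 1" and z: "norm z \<le> r" for c f z
  proof -
    define H where "H = (\<Sum>n. norm (c n) * s ^ n)"
    have "norm (f z) \<le> (\<Sum>n. norm (c n) * norm z ^ n)" by (rule norm_eval_le[OF f])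
    also have "\<dots> \<le> H"
      unfolding H_def using z s
      by (intro suminf_le mult_left_mono power_mono everywhere_sums_norm_summable[OF f]) auto
    finally have fH: "norm (f z) \<le> H" .
    have "(H * gauss \<alpha> s)\<^sup>2
      \<le> 24 * exp (6 * \<alpha>) * (s / 1) * ((gauss_rms \<alpha> c (s + 1))\<^sup>2 + (gauss_rms \<alpha> c (s - 1))\<^sup>2)"
      unfolding H_def using s by (intro weighted_rms_shift(2)[OF f \<alpha>]) auto
    also have "\<dots> \<le> 24 * exp (6 * \<alpha>) * (s / 1) * ((U (s + 1))\<^sup>2 + (U (s - 1))\<^sup>2)"
      using s rms_nonneg[OF f] by (intro mult_left_mono add_mono power_mono G[OF f fi]) auto
    finally have "H * gauss \<alpha> s \<le> K"
      unfolding K_def by (rule real_le_rsqrt)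
    then have "H * gauss \<alpha> s * exp ((\<alpha> / 2) * s\<^sup>2) \<le> K * exp ((\<alpha> / 2) * s\<^sup>2)"
      by (rule mult_right_mono) simp
    then have "H \<le> K * exp ((\<alpha> / 2) * s\<^sup>2)"
      by (simp add: mult.assoc flip: exp_add)
    then show ?thesis using fH by linarith
  qed
  then show ?thesis by blast
qed

text \<open>A substitute for Minkowski's inequality that treats all \<open>t > 0\<close> alike: one
  factor \<open>\<rho> ^ k\<close> sums the geometric series, the other stays with the term, whose
  power \<open>t\<close> is at most the whole sum \<open>S\<close>.\<close>

lemma powr_geometric_series_le:
  fixes x :: "nat \<Rightarrow> real" and \<rho> t :: real
  assumes \<rho>: "0 < \<rho>" "\<rho> < 1" and t: "t > 0" and x: "\<And>k. x k \<ge> 0"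
    and summ: "summable (\<lambda>k. \<rho> ^ (2 * k) * x k)"
  shows "ennreal ((\<Sum>k. \<rho> ^ (2 * k) * x k) powr t) \<le> ennreal ((1 / (1 - \<rho>)) powr t) * (\<Sum>k. ennreal ((\<rho> ^ k * x k) powr t))"
proof (cases "(\<Sum>k. ennreal ((\<rho> ^ k * x k) powr t)) = \<infinity>")
  case True
  then show ?thesis using \<rho> t by (simp add: ennreal_mult_top)
next
  case False
  define S where "S = (\<Sum>k. (\<rho> ^ k * x k) powr t)"
  have sm: "summable (\<lambda>k. (\<rho> ^ k * x k) powr t)"
    using False by (intro summable_suminf_not_top) auto
  have S: "(\<Sum>k. ennreal ((\<rho> ^ k * x k) powr t)) = ennreal S" "S \<ge> 0"
    unfolding S_def using sm by (auto intro!: suminf_ennreal2 suminf_nonneg)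
  have le: "\<rho> ^ k * x k \<le> S powr (1 / t)" for k
  proof -
    have "(\<rho> ^ k * x k) powr t \<le> S"
      unfolding S_def using sum_le_suminf[OF sm, of "{k}"] by simp
    then have "((\<rho> ^ k * x k) powr t) powr (1 / t) \<le> S powr (1 / t)"
      using t by (intro powr_mono2) auto
    then show ?thesis using t x \<rho> by (simp add: powr_powr)
  qed
  have geo: "(\<lambda>k. \<rho> ^ k * S powr (1 / t)) sums (1 / (1 - \<rho>) * S powr (1 / t))"
    using \<rho> by (intro sums_mult2 geometric_sums) auto
  have "(\<Sum>k. \<rho> ^ (2 * k) * x k) \<le> (\<Sum>k. \<rho> ^ k * S powr (1 / t))"
  proof (rule suminf_le[OF _ summ sums_summable[OF geo]])
    fix k
    have "\<rho> ^ (2 * k) * x k = \<rho> ^ k * (\<rho> ^ k * x k)" by (simp add: mult_2 power_add)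
    also have "\<dots> \<le> \<rho> ^ k * S powr (1 / t)" using \<rho> le by (intro mult_left_mono) auto
    finally show "\<rho> ^ (2 * k) * x k \<le> \<rho> ^ k * S powr (1 / t)" .
  qed
  also have "\<dots> = 1 / (1 - \<rho>) * S powr (1 / t)" using geo by (simp add: sums_iff)
  finally have "(\<Sum>k. \<rho> ^ (2 * k) * x k) powr t \<le> (1 / (1 - \<rho>) * S powr (1 / t)) powr t"
    using t x \<rho> by (intro powr_mono2 suminf_nonneg summ) auto
  also have "\<dots> = (1 / (1 - \<rho>)) powr t * S"
    using \<rho> t S by (subst powr_mult) (auto simp: powr_powr)
  finally show ?thesis
    unfolding S(1) using S(2) by (simp add: ennreal_leI flip: ennreal_mult)
qed

text \<open>For nonnegative coefficients the value at a nonnegative real point is the sum of the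
  absolute values of the terms on that circle. Boundedness there makes the double series absolutely
  summable, so both orders of summation agree.\<close>

lemma positive_series_superposition:
  fixes a :: "nat \<Rightarrow> nat \<Rightarrow> real"
  assumes a: "\<And>k n. a k n \<ge> 0" and g: "\<And>k. everywhere_sums (\<lambda>n. of_real (a k n)) (g k)"
    and B: "\<And>r. \<exists>B. \<forall>k. norm (g k (of_real r)) \<le> B"
  shows "\<exists>c f. everywhere_sums (\<lambda>n. of_real (c n)) f \<and> (\<forall>k n. (1 / 4) ^ k * a k n \<le> c n)
    \<and> (\<forall>z. (\<lambda>k. (1 / 4) ^ k * g k z) sums f z)"
proof -
  have total: "(\<lambda>(k, n). (1 / 4) ^ k * complex_of_real (a k n) * z ^ n) summable_on (UNIV \<times> UNIV)" for z
  proof -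
    define r where "r = norm z"
    obtain B where B: "norm (g k (of_real r)) \<le> B" for k using B by blast
    have gs: "(\<lambda>n. a k n * r ^ n) sums Re (g k (of_real r))" for k
      using sums_Re[OF spec[OF g[of k, unfolded everywhere_sums_def], of "of_real r"]]
      by (simp flip: of_real_power of_real_mult)
    have gB: "norm (Re (g k (of_real r))) \<le> B" for k
      using B[of k] abs_Re_le_cmod[of "g k (of_real r)"] by simp
    have "(\<lambda>(k, n). (1 / 4) ^ k * a k n * r ^ n) summable_on (UNIV \<times> UNIV)"
    proof (rule summable_on_SigmaI)
      show "((\<lambda>n. case (k, n) of (k, n) \<Rightarrow> (1 / 4) ^ k * a k n * r ^ n) has_sum ((1 / 4) ^ k * Re (g k (of_real r)))) UNIV" for k
        using sums_mult[OF gs[of k], of "(1 / 4) ^ k"] a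
        by (intro sums_nonneg_imp_has_sum) (auto simp: r_def mult.assoc)
      have "summable (\<lambda>k. (1 / 4) ^ k * Re (g k (of_real r)))"
      proof (rule summable_comparison_test'[where N = 0])
        show "summable (\<lambda>k. (1 / 4 :: real) ^ k * B)"
          by (intro summable_mult2 summable_geometric) auto
        show "norm ((1 / 4) ^ k * Re (g k (of_real r))) \<le> (1 / 4) ^ k * B" for k
          using gB[of k] by (simp add: abs_mult mult_left_mono)
      qed
      moreover have "Re (g k (of_real r)) \<ge> 0" for k
        by (rule sums_le[OF _ sums_zero gs[of k]]) (use a in \<open>auto simp: r_def\<close>)
      ultimately show "(\<lambda>k. (1 / 4) ^ k * Re (g k (of_real r))) summable_on UNIV"
        by (intro summable_nonneg_imp_summable_on) auto
    qed (use a in \<open>auto simp: r_def\<close>)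
    then have "(\<lambda>x. norm (case x of (k, n) \<Rightarrow> (1 / 4) ^ k * complex_of_real (a k n) * z ^ n)) summable_on (UNIV \<times> UNIV)"
      using a by (simp add: case_prod_unfold norm_mult norm_power norm_divide r_def)
    then show ?thesis
      by (rule abs_summable_summable)
  qed
  define f where "f z = (\<Sum>\<^sub>\<infinity>(k, n)\<in>UNIV \<times> UNIV. (1 / 4) ^ k * complex_of_real (a k n) * z ^ n)" for z
  have f: "((\<lambda>(k, n). (1 / 4) ^ k * complex_of_real (a k n) * z ^ n) has_sum f z) (UNIV \<times> UNIV)" for z
    unfolding f_def by (rule has_sum_infsum[OF total])
  have gsum: "((\<lambda>n. (1 / 4) ^ k * complex_of_real (a k n) * z ^ n) has_sum ((1 / 4) ^ k * g k z)) UNIV" for k z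
  proof (rule norm_summable_imp_has_sum)
    show "(\<lambda>n. (1 / 4) ^ k * complex_of_real (a k n) * z ^ n) sums ((1 / 4) ^ k * g k z)"
      using sums_mult[OF spec[OF g[of k, unfolded everywhere_sums_def], of z], of "(1 / 4) ^ k"] by (simp add: mult.assoc)
    show "summable (\<lambda>n. norm ((1 / 4) ^ k * complex_of_real (a k n) * z ^ n))"
      using summable_mult[OF everywhere_sums_norm_summable[OF g[of k], of "norm z"], of "(1 / 4) ^ k"]
      by (simp add: norm_mult norm_power norm_divide mult.assoc)
  qed
  have fsum: "(\<lambda>k. (1 / 4) ^ k * g k z) sums f z" for z
    by (rule has_sum_imp_sums[OF has_sum_SigmaD[OF f]]) (use gsum in simp)
  define c where "c n = (\<Sum>k. (1 / 4) ^ k * a k n)" for n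
  have asum: "summable (\<lambda>k. (1 / 4) ^ k * a k n)" for n
  proof -
    obtain B where B: "norm (g k 1) \<le> B" for k using B[of 1] by auto
    have "a k n \<le> B" for k
    proof -
      have s: "(\<lambda>n. a k n) sums Re (g k 1)"
        using sums_Re[OF spec[OF g[of k, unfolded everywhere_sums_def], of 1]] by simp
      have "a k n \<le> Re (g k 1)"
        using sum_le_suminf[OF sums_summable[OF s], of "{n}"] s a by (auto simp: sums_iff)
      then show ?thesis using B[of k] abs_Re_le_cmod[of "g k 1"] by linarith
    qed
    then have "norm ((1 / 4) ^ k * a k n) \<le> (1 / 4) ^ k * B" for k
      using a by (simp add: mult_left_mono)
    then show ?thesis
      by (rule summable_comparison_test'[rotated, where N = 0]) (intro summable_mult2 summable_geometric, simp)
  qed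
  have csum: "((\<lambda>k. (1 / 4) ^ k * complex_of_real (a k n) * z ^ n) has_sum (of_real (c n) * z ^ n)) UNIV" for n z
  proof (rule norm_summable_imp_has_sum)
    show "(\<lambda>k. (1 / 4) ^ k * complex_of_real (a k n) * z ^ n) sums (of_real (c n) * z ^ n)"
      using sums_mult2[OF sums_of_real[OF summable_sums[OF asum[of n]]], of "z ^ n"]
      by (simp add: c_def)
    show "summable (\<lambda>k. norm ((1 / 4) ^ k * complex_of_real (a k n) * z ^ n))"
      using summable_mult2[OF asum[of n], of "norm z ^ n"] a by (simp add: norm_mult norm_power norm_divide)
  qed
  have "everywhere_sums (\<lambda>n. of_real (c n)) f"
    unfolding everywhere_sums_def
  proof
    fix z
    have "((\<lambda>(n, k). (1 / 4) ^ k * complex_of_real (a k n) * z ^ n) has_sum f z) (UNIV \<times> UNIV)"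
      using f[of z] by (subst has_sum_swap) simp
    then show "(\<lambda>n. of_real (c n) * z ^ n) sums f z"
      by (rule has_sum_imp_sums[OF has_sum_SigmaD]) (use csum in simp)
  qed
  moreover have "(1 / 4) ^ k * a k n \<le> c n" for k n
    unfolding c_def using sum_le_suminf[OF asum[of n], of "{k}"] a by simp
  ultimately show ?thesis using fsum by blast
qed

lemma rms_mono:
  assumes "everywhere_sums c f" "everywhere_sums d g" "\<And>n. norm (c n) \<le> norm (d n)" "r \<ge> 0"
  shows "rms c r \<le> rms d r"
  unfolding rms_def using assms
  by (intro real_sqrt_le_mono suminf_le power_mono mult_right_mono everywhere_sums_square_summable) auto

text \<open>A gliding hump: nonnegative Taylor coefficients rule out cancellation between the humps.\<close>

lemma gliding_hump:
  fixes \<alpha> p q q' :: real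
  assumes pos: "\<alpha> > 0" "p > 0" "q > 0" "q' > 0"
    and hump: "\<And>L. \<exists>a g. (\<forall>n. a n \<ge> (0::real)) \<and> everywhere_sums (\<lambda>n. of_real (a n)) g
      \<and> fock_integral \<alpha> p q g \<le> 1 \<and> ennreal L \<le> fock_integral \<alpha> 2 q' g"
  shows "\<exists>f \<in> fock_space \<alpha> p q. f \<notin> fock_space \<alpha> 2 q'"
proof -
  \<comment> \<open>The weight \<open>(1 / 4) ^ k\<close> of the hump costs a factor
    \<open>4 ^ k\<close> in the mean square, to the power \<open>q'\<close>; the prescribed size
    compensates this and leaves \<open>k\<close>.\<close>
  have "\<forall>k. \<exists>a g. (\<forall>n. a n \<ge> (0::real)) \<and> everywhere_sums (\<lambda>n. of_real (a n)) g
      \<and> fock_integral \<alpha> p q g \<le> 1 \<and> ennreal (real k * (4 ^ k) powr q') \<le> fock_integral \<alpha> 2 q' g"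
    using hump by blast
  then obtain a g where a: "\<And>k n. a k n \<ge> (0::real)" and g: "\<And>k. everywhere_sums (\<lambda>n. of_real (a k n)) (g k)"
    and gi: "\<And>k. fock_integral \<alpha> p q (g k) \<le> 1"
    and big: "\<And>k. ennreal (real k * (4 ^ k) powr q') \<le> fock_integral \<alpha> 2 q' (g k)"
    by (subst (asm) choice_iff, elim exE, subst (asm) choice_iff) blast
  have bdd: "\<exists>B. \<forall>k z. norm z \<le> r \<longrightarrow> norm (g k z) \<le> B" for r
    using fock_pointwise_bound[OF pos(1-3), of r] g gi by blast
  have bdd': "\<exists>B. \<forall>k. norm (g k (of_real r)) \<le> B" for r
    using bdd[of "\<bar>r\<bar>"] by (metis norm_of_real order_refl)
  obtain c f where f: "everywhere_sums (\<lambda>n. of_real (c n)) f" and c: "\<And>k n. (1 / 4) ^ k * a k n \<le> c n"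
    and fs: "\<And>z. (\<lambda>k. (1 / 4) ^ k * g k z) sums f z"
    using positive_series_superposition[OF a g bdd'] by blast
  have c0: "c n \<ge> 0" for n using c[of 0 n] a[of 0 n] by simp
  have hol: "f holomorphic_on UNIV" by (rule everywhere_sums_holomorphic[OF f])
  have contg: "continuous_on UNIV (g k)" for k by (rule everywhere_sums_continuous[OF g])
  have measg: "g k \<in> borel_measurable borel" for k by (rule borel_measurable_continuous_onI[OF contg])
  have contf: "continuous_on UNIV f" by (rule everywhere_sums_continuous[OF f])
  have measf: "f \<in> borel_measurable borel" by (rule borel_measurable_continuous_onI[OF contf])
  define y where "y r k = integral_mean p (g k) r powr p" for r k
  \<comment> \<open>Then \<open>\<rho> ^ (2 * k)\<close> is the \<open>p\<close>-th power of
    \<open>(1 / 2) ^ k\<close>. Of the weight \<open>(1 / 4) ^ k\<close>, one factor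
    \<open>(1 / 2) ^ k\<close> is spent on the circle mean; the other becomes
    \<open>\<rho> ^ (2 * k)\<close> and is halved again for the radial integral.\<close>
  define \<rho> where "\<rho> = (1 / 2 :: real) powr (p / 2)"
  have \<rho>: "0 < \<rho>" "\<rho> < 1"
    using pos powr_less_mono2[of "p / 2" "1 / 2" 1] by (auto simp: \<rho>_def)
  have \<rho>2: "\<rho> ^ (2 * k) = ((1 / 2) ^ k) powr p" for k
    by (simp add: \<rho>_def powr_powr powr_realpow[symmetric] mult_ac)
  define D where "D = 2 powr p"
  have D: "D > 0" by (simp add: D_def)
  have ysum: "summable (\<lambda>k. \<rho> ^ (2 * k) * y r k)" and Mp: "integral_mean p f r powr p \<le> D * (\<Sum>k. \<rho> ^ (2 * k) * y r k)"
    for r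
  proof -
    obtain B where B: "\<And>k z. norm z \<le> \<bar>r\<bar> \<Longrightarrow> norm (g k z) \<le> B" using bdd[of "\<bar>r\<bar>"] by blast
    have nB: "norm (g k (of_real r * cis t)) \<le> B" for k t using B by (simp add: norm_mult)
    have B0: "B \<ge> 0" using nB[of 0 0] norm_ge_zero order_trans by blast
    have yle: "y r k \<le> B powr p" for k
    proof -
      have "y r k = (\<integral>t. norm (g k (of_real r * cis t)) powr p \<partial>circ)"
        unfolding y_def by (rule integral_mean_powr[OF measg pos(2)])
      also have "\<dots> \<le> (\<integral>t. B powr p \<partial>circ)"
        using nB pos by (intro integral_mono integrable_circle_powr[OF contg]) (auto intro!: powr_mono2)
      also have "\<dots> = B powr p" using circ.prob_space by simp
      finally show ?thesis .
    qed
    show ysum: "summable (\<lambda>k. \<rho> ^ (2 * k) * y r k)"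
    proof (rule summable_comparison_test'[where N = 0])
      show "summable (\<lambda>k. (\<rho>\<^sup>2) ^ k * B powr p)"
        using \<rho> by (intro summable_mult2 summable_geometric) (simp add: power_less_one_iff abs_square_less_1)
      show "norm (\<rho> ^ (2 * k) * y r k) \<le> (\<rho>\<^sup>2) ^ k * B powr p" for k
        using yle[of k] \<rho> by (simp add: y_def power_mult mult_left_mono)
    qed
    have "ennreal (integral_mean p f r powr p) = (\<integral>\<^sup>+t. ennreal (norm (f (of_real r * cis t)) powr p) \<partial>circ)"
      unfolding integral_mean_powr[OF measf pos(2)]
      by (rule nn_integral_eq_integral[symmetric]) (auto intro: integrable_circle_powr[OF contf pos(2)])
    also have "\<dots> \<le> (\<integral>\<^sup>+t. ennreal D * (\<Sum>k. ennreal (\<rho> ^ (2 * k)) * ennreal (norm (g k (of_real r * cis t)) powr p)) \<partial>circ)"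
    proof (rule nn_integral_mono)
      fix t
      define x where "x k = norm (g k (of_real r * cis t))" for k
      have xs: "summable (\<lambda>k. (1 / 2) ^ (2 * k) * x k)"
      proof (rule summable_comparison_test'[where N = 0])
        show "summable (\<lambda>k. (1 / 4 :: real) ^ k * B)" by (intro summable_mult2 summable_geometric) auto
        show "norm ((1 / 2) ^ (2 * k) * x k) \<le> (1 / 4) ^ k * B" for k
          using nB[of k t] by (simp add: x_def power_mult power2_eq_square mult_left_mono)
      qed
      have "norm (f (of_real r * cis t)) \<le> (\<Sum>k. norm ((1 / 4) ^ k * g k (of_real r * cis t)))"
      proof -
        have "summable (\<lambda>k. norm ((1 / 4) ^ k * g k (of_real r * cis t)))"
          using xs by (simp add: x_def norm_mult norm_power norm_divide power_mult power2_eq_square)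
        from summable_norm[OF this] show ?thesis using fs[of "of_real r * cis t"] by (simp add: sums_iff)
      qed
      also have "\<dots> = (\<Sum>k. (1 / 2) ^ (2 * k) * x k)"
        by (simp add: x_def norm_mult norm_power norm_divide power_mult power2_eq_square)
      finally have "ennreal (norm (f (of_real r * cis t)) powr p) \<le> ennreal ((\<Sum>k. (1 / 2) ^ (2 * k) * x k) powr p)"
        using pos by (intro ennreal_leI powr_mono2) auto
      also have "\<dots> \<le> ennreal ((1 / (1 - 1 / 2)) powr p) * (\<Sum>k. ennreal (((1 / 2) ^ k * x k) powr p))"
        using pos xs by (intro powr_geometric_series_le) (auto simp: x_def)
      also have "(\<Sum>k. ennreal (((1 / 2) ^ k * x k) powr p)) = (\<Sum>k. ennreal (\<rho> ^ (2 * k)) * ennreal (x k powr p))"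
        unfolding \<rho>2 by (intro suminf_cong) (simp add: x_def powr_mult ennreal_mult)
      finally show "ennreal (norm (f (of_real r * cis t)) powr p)
        \<le> ennreal D * (\<Sum>k. ennreal (\<rho> ^ (2 * k)) * ennreal (norm (g k (of_real r * cis t)) powr p))"
        by (simp add: D_def x_def)
    qed
    also have "\<dots> = ennreal D * (\<Sum>k. ennreal (\<rho> ^ (2 * k)) * (\<integral>\<^sup>+t. ennreal (norm (g k (of_real r * cis t)) powr p) \<partial>circ))"
    proof -
      have [measurable]: "(\<lambda>t. norm (g k (complex_of_real r * cis t)) powr p) \<in> borel_measurable borel" for k
        by (rule borel_measurable_circle[OF measg])
      show ?thesis by (simp add: nn_integral_cmult nn_integral_suminf)
    qed
    also have "(\<lambda>k. ennreal (\<rho> ^ (2 * k)) * (\<integral>\<^sup>+t. ennreal (norm (g k (of_real r * cis t)) powr p) \<partial>circ))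
      = (\<lambda>k. ennreal (\<rho> ^ (2 * k) * y r k))"
    proof
      fix k
      have "(\<integral>\<^sup>+t. ennreal (norm (g k (of_real r * cis t)) powr p) \<partial>circ) = ennreal (y r k)"
        unfolding y_def integral_mean_powr[OF measg pos(2)]
        by (rule nn_integral_eq_integral) (auto intro: integrable_circle_powr[OF contg pos(2)])
      then show "ennreal (\<rho> ^ (2 * k)) * (\<integral>\<^sup>+t. ennreal (norm (g k (of_real r * cis t)) powr p) \<partial>circ)
        = ennreal (\<rho> ^ (2 * k) * y r k)"
        using \<rho> by (simp add: y_def ennreal_mult)
    qed
    also have "(\<Sum>k. ennreal (\<rho> ^ (2 * k) * y r k)) = ennreal (\<Sum>k. \<rho> ^ (2 * k) * y r k)"
      using \<rho> by (intro suminf_ennreal2 ysum) (auto simp: y_def)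
    finally have le: "ennreal (integral_mean p f r powr p) \<le> ennreal D * ennreal (\<Sum>k. \<rho> ^ (2 * k) * y r k)" .
    have S0: "(\<Sum>k. \<rho> ^ (2 * k) * y r k) \<ge> 0"
      using \<rho> by (intro suminf_nonneg ysum) (simp add: y_def)
    have "ennreal (integral_mean p f r powr p) \<le> ennreal (D * (\<Sum>k. \<rho> ^ (2 * k) * y r k))"
      using le D S0 by (simp add: ennreal_mult)
    then show "integral_mean p f r powr p \<le> D * (\<Sum>k. \<rho> ^ (2 * k) * y r k)"
      using D S0 by (subst (asm) ennreal_le_iff) auto
  qed
  define E where "E = D powr (q / p) * (1 / (1 - \<rho>)) powr (q / p)"
  define \<theta> where "\<theta> = \<rho> powr (q / p)"
  have \<theta>: "0 < \<theta>" "\<theta> < 1" using \<rho> pos powr_less_mono2[of "q / p" \<rho> 1] by (auto simp: \<theta>_def)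
  have Mq: "ennreal (integral_mean p f r powr q) \<le> ennreal E * (\<Sum>k. ennreal (\<theta> ^ k) * ennreal (integral_mean p (g k) r powr q))" for r
  proof -
    have y0: "y r k \<ge> 0" for k by (simp add: y_def)
    have "integral_mean p f r powr q = (integral_mean p f r powr p) powr (q / p)"
      using pos by (simp add: powr_powr)
    also have "\<dots> \<le> (D * (\<Sum>k. \<rho> ^ (2 * k) * y r k)) powr (q / p)"
      using pos Mp[of r] by (intro powr_mono2) auto
    also have "\<dots> = D powr (q / p) * (\<Sum>k. \<rho> ^ (2 * k) * y r k) powr (q / p)"
      using D \<rho> y0 by (intro powr_mult)
    finally have "ennreal (integral_mean p f r powr q) \<le> ennreal (D powr (q / p)) * ennreal ((\<Sum>k. \<rho> ^ (2 * k) * y r k) powr (q / p))"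
      by (simp add: ennreal_leI flip: ennreal_mult)
    \<comment> \<open>Second use of the series inequality, with \<open>t = q / p\<close> and ratio
      \<rho>.\<close>
    also have "\<dots> \<le> ennreal (D powr (q / p)) * (ennreal ((1 / (1 - \<rho>)) powr (q / p)) * (\<Sum>k. ennreal ((\<rho> ^ k * y r k) powr (q / p))))"
      using pos y0 by (intro mult_left_mono powr_geometric_series_le \<rho> ysum) auto
    also have "(\<lambda>k. ennreal ((\<rho> ^ k * y r k) powr (q / p))) = (\<lambda>k. ennreal (\<theta> ^ k) * ennreal (integral_mean p (g k) r powr q))"
    proof
      fix k
      have "(\<rho> ^ k) powr (q / p) = \<theta> ^ k"
        using \<rho> by (simp add: \<theta>_def powr_powr powr_realpow[symmetric] mult_ac)
      then show "ennreal ((\<rho> ^ k * y r k) powr (q / p)) = ennreal (\<theta> ^ k) * ennreal (integral_mean p (g k) r powr q)"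
        using \<rho> \<theta> pos by (simp add: y_def powr_mult powr_powr ennreal_mult)
    qed
    finally show ?thesis by (simp add: E_def ennreal_mult mult.assoc)
  qed
  define w where "w r = ennreal (\<alpha> * q * exp (- (\<alpha> * q / 2) * r\<^sup>2) * r) * indicator {0..} r" for r
  have fw: "fock_integral \<alpha> p q h = (\<integral>\<^sup>+r. ennreal (integral_mean p h r powr q) * w r \<partial>lborel)" for h
    unfolding fock_integral_split_weight w_def ..
  have [measurable]: "w \<in> borel_measurable borel" unfolding w_def by measurable
  have [measurable]: "integral_mean p (g k) \<in> borel_measurable borel" for k
    by (rule borel_measurable_integral_mean[OF measg])
  have "fock_integral \<alpha> p q f \<le> (\<integral>\<^sup>+r. ennreal E * (\<Sum>k. ennreal (\<theta> ^ k) * (ennreal (integral_mean p (g k) r powr q) * w r)) \<partial>lborel)"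
    unfolding fw
  proof (rule nn_integral_mono)
    fix r
    have "ennreal (integral_mean p f r powr q) * w r \<le> ennreal E * (\<Sum>k. ennreal (\<theta> ^ k) * ennreal (integral_mean p (g k) r powr q)) * w r"
      by (intro mult_right_mono Mq) simp
    then show "ennreal (integral_mean p f r powr q) * w r \<le> ennreal E * (\<Sum>k. ennreal (\<theta> ^ k) * (ennreal (integral_mean p (g k) r powr q) * w r))"
      by (simp add: mult.assoc flip: ennreal_suminf_multc)
  qed
  also have "\<dots> = ennreal E * (\<Sum>k. ennreal (\<theta> ^ k) * fock_integral \<alpha> p q (g k))"
    unfolding fw by (simp add: nn_integral_cmult nn_integral_suminf)
  also have "\<dots> \<le> ennreal E * (\<Sum>k. ennreal (\<theta> ^ k) * 1)"
    by (intro mult_left_mono suminf_le gi) auto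
  also have "\<dots> = ennreal E * ennreal (\<Sum>k. \<theta> ^ k)"
    using \<theta> by (simp add: suminf_ennreal2 summable_geometric)
  also have "\<dots> < \<infinity>" by (simp add: ennreal_mult_less_top)
  finally have "f \<in> fock_space \<alpha> p q" using hol by (simp add: mem_fock_space_iff)
  moreover have "f \<notin> fock_space \<alpha> 2 q'"
  proof
    assume "f \<in> fock_space \<alpha> 2 q'"
    then have fin: "fock_integral \<alpha> 2 q' f < \<infinity>" by (simp add: mem_fock_space_iff)
    \<comment> \<open>The coefficients of \<open>f\<close> dominate those of the \<open>k\<close>-th
      hump up to the factor \<open>4 ^ k\<close>, so \<open>f\<close> inherits the lower bound
      \<open>k\<close> for every \<open>k\<close>.\<close>
    have "ennreal (real k) \<le> fock_integral \<alpha> 2 q' f" for k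
    proof -
      define \<mu> where "\<mu> = ((4::real) ^ k) powr q'"
      have \<mu>: "\<mu> > 0" by (simp add: \<mu>_def)
      have "fock_integral \<alpha> 2 q' (g k) \<le> (\<integral>\<^sup>+r. ennreal \<mu> * (ennreal (integral_mean 2 f r powr q' * (\<alpha> * q' * exp (- (\<alpha> * q' / 2) * r\<^sup>2) * r)) * indicator {0..} r) \<partial>lborel)"
        unfolding fock_integral_def
      proof (rule nn_integral_mono)
        fix r :: real
        show "ennreal (integral_mean 2 (g k) r powr q' * (\<alpha> * q' * exp (- (\<alpha> * q' / 2) * r\<^sup>2) * r)) * indicator {0..} r
          \<le> ennreal \<mu> * (ennreal (integral_mean 2 f r powr q' * (\<alpha> * q' * exp (- (\<alpha> * q' / 2) * r\<^sup>2) * r)) * indicator {0..} r)"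
        proof (cases "r \<ge> 0")
          case True
          have "rms (\<lambda>n. of_real (a k n)) r \<le> rms (\<lambda>n. 4 ^ k * of_real (c n)) r"
          proof (rule rms_mono[OF g _ _ True])
            show "everywhere_sums (\<lambda>n. 4 ^ k * of_real (c n)) (\<lambda>z. 4 ^ k * f z)"
              using f unfolding everywhere_sums_def by (auto simp: mult.assoc intro: sums_mult)
            show "norm (complex_of_real (a k n)) \<le> norm (4 ^ k * complex_of_real (c n))" for n
              using c[of k n] a[of k n] c0[of n] by (simp add: norm_mult norm_power power_divide field_simps)
          qed
          also have "rms (\<lambda>n. 4 ^ k * of_real (c n)) r = 4 ^ k * rms (\<lambda>n. of_real (c n)) r"
          proof -
            have "(\<Sum>n. (norm (4 ^ k * complex_of_real (c n)) * r ^ n)\<^sup>2) = (\<Sum>n. (4 ^ k)\<^sup>2 * (norm (complex_of_real (c n)) * r ^ n)\<^sup>2)"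
              by (simp add: norm_mult norm_power power_mult_distrib mult.assoc)
            also have "\<dots> = (4 ^ k)\<^sup>2 * (\<Sum>n. (norm (complex_of_real (c n)) * r ^ n)\<^sup>2)"
              by (rule suminf_mult[OF everywhere_sums_square_summable[OF f True]])
            finally show ?thesis by (simp add: rms_def real_sqrt_mult)
          qed
          finally have "integral_mean 2 (g k) r \<le> 4 ^ k * integral_mean 2 f r"
            by (simp add: integral_mean_2[OF g True] integral_mean_2[OF f True])
          then have "integral_mean 2 (g k) r powr q' \<le> (4 ^ k * integral_mean 2 f r) powr q'"
            using pos by (intro powr_mono2) auto
          also have "\<dots> = \<mu> * integral_mean 2 f r powr q'"
            by (simp add: \<mu>_def powr_mult)
          finally have "integral_mean 2 (g k) r powr q' * (\<alpha> * q' * exp (- (\<alpha> * q' / 2) * r\<^sup>2) * r)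
            \<le> \<mu> * integral_mean 2 f r powr q' * (\<alpha> * q' * exp (- (\<alpha> * q' / 2) * r\<^sup>2) * r)"
            using True pos by (intro mult_right_mono) auto
          then show ?thesis using True \<mu> by (simp add: mult.assoc ennreal_mult'[symmetric] ennreal_leI)
        qed auto
      qed
      also have "\<dots> = ennreal \<mu> * fock_integral \<alpha> 2 q' f"
        unfolding fock_integral_def using borel_measurable_integral_mean[OF measf, of 2]
        by (intro nn_integral_cmult) auto
      finally have "ennreal (real k * \<mu>) \<le> ennreal \<mu> * fock_integral \<alpha> 2 q' f"
        using big[of k] unfolding \<mu>_def by (rule order_trans[rotated])
      then have "ennreal \<mu> * ennreal (real k) \<le> ennreal \<mu> * fock_integral \<alpha> 2 q' f"
        using \<mu> by (simp add: ennreal_mult mult.commute)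
      then show ?thesis using \<mu> by (simp add: ennreal_mult_le_mult_iff)
    qed
    moreover obtain k :: nat where "fock_integral \<alpha> 2 q' f < of_nat k"
      using fin ennreal_Ex_less_of_nat[of "fock_integral \<alpha> 2 q' f"] by (auto simp: top.not_eq_extremum)
    ultimately show False by (metis ennreal_of_nat_eq_real_of_nat not_less)
  qed
  ultimately show ?thesis by blast
qed

section \<open>Test functions\<close>

lemma nn_integral_gaussian:
  fixes b :: real
  assumes b: "b > 0"
  shows "(\<integral>\<^sup>+x. ennreal (exp (- b * (x - m)\<^sup>2)) \<partial>lborel) = ennreal (sqrt (pi / b))"
proof -
  define \<sigma> where "\<sigma> = sqrt (1 / (2 * b))"
  have \<sigma>: "\<sigma> > 0" "\<sigma>\<^sup>2 = 1 / (2 * b)" using b by (auto simp: \<sigma>_def)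
  have eq: "exp (- b * (x - m)\<^sup>2) = sqrt (pi / b) * normal_density m \<sigma> x" for x
    unfolding normal_density_def \<sigma>(2) using b by (simp add: real_sqrt_divide real_sqrt_mult field_simps)
  have "(\<integral>\<^sup>+x. ennreal (exp (- b * (x - m)\<^sup>2)) \<partial>lborel) = (\<integral>\<^sup>+x. ennreal (sqrt (pi / b)) * ennreal (normal_density m \<sigma> x) \<partial>lborel)"
    unfolding eq using b by (simp add: ennreal_mult normal_density_nonneg)
  also have "\<dots> = ennreal (sqrt (pi / b))"
    using \<sigma> by (simp add: nn_integral_cmult nn_integral_eq_integral normal_density_nonneg)
  finally show ?thesis .
qed

text \<open>The profile sits within bounded distance of \<open>R\<close>, and the radial density
  contributes one factor \<open>R\<close>, hence \<open>w + 1\<close>. \<open>C\<close> is chosen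
  before \<open>g\<close>, \<open>R\<close> and \<open>w\<close>. The polynomial factor is there for
  the kernels, whose angular concentration weakens at small radii.\<close>

lemma fock_integral_peak_upper:
  fixes \<alpha> p q D m :: real
  assumes pos: "\<alpha> > 0" "q > 0" "D > 0" "m \<ge> 0"
  shows "\<exists>C>0. \<forall>g R w. R \<ge> 1 \<longrightarrow>
     (\<forall>r>0. gauss_mean \<alpha> p g r powr q
       \<le> D * R powr w * (1 + \<bar>r - R\<bar>) powr m * exp (- (\<alpha> * q / 2) * (r - R)\<^sup>2)) \<longrightarrow>
     fock_integral \<alpha> p q g \<le> ennreal (C * R powr (w + 1))"
proof -
  define b where "b = \<alpha> * q / 2"
  have b: "b > 0" using pos by (simp add: b_def)
  \<comment> \<open>The exponent is \<open>m + 1\<close> because \<open>r \<le> R * y\<close>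
    produces one more factor \<open>y\<close>. With \<open>b / 4\<close> and
    \<open>y\<^sup>2 \<le> 2 + 2 * (r - R)\<^sup>2\<close>, half of the Gaussian is left.\<close>
  obtain K where K: "K > 0" and Kle: "\<And>y. y \<ge> 1 \<Longrightarrow> y powr (m + 1) \<le> K * exp (b / 4 * y\<^sup>2)"
    using powr_le_exp_square[of "b / 4" "m + 1"] b by auto
  define C0 where "C0 = D * (\<alpha> * q) * K * exp (b / 2)"
  have C0: "C0 > 0" using pos K by (simp add: C0_def)
  have "fock_integral \<alpha> p q g \<le> ennreal (C0 * sqrt (pi / (b / 2)) * R powr (w + 1))"
    if R: "R \<ge> 1" and up: "\<And>r. r > 0 \<Longrightarrow> (gauss_mean \<alpha> p g r) powr q
       \<le> D * R powr w * (1 + \<bar>r - R\<bar>) powr m * exp (- (\<alpha> * q / 2) * (r - R)\<^sup>2)" for g R w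
  proof -
    have "fock_integral \<alpha> p q g \<le> (\<integral>\<^sup>+r. ennreal (C0 * R powr (w + 1)) * ennreal (exp (- (b / 2) * (r - R)\<^sup>2)) \<partial>lborel)"
      unfolding fock_integral_weighted
    proof (rule nn_integral_mono)
      fix r :: real
      show "ennreal (gauss_mean \<alpha> p g r powr q * (\<alpha> * q * r)) * indicator {0..} r
        \<le> ennreal (C0 * R powr (w + 1)) * ennreal (exp (- (b / 2) * (r - R)\<^sup>2))"
      proof (cases "r > 0")
        case True
        define y where "y = 1 + \<bar>r - R\<bar>"
        have y: "y \<ge> 1" by (simp add: y_def)
        have "r \<le> R + \<bar>r - R\<bar>" by simp
        also have "\<dots> \<le> R * y" using R mult_right_mono[of 1 R "\<bar>r - R\<bar>"] by (simp add: y_def algebra_simps)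
        finally have rR: "r \<le> R * y" .
        have y2: "y\<^sup>2 \<le> 2 + 2 * (r - R)\<^sup>2"
          using sum_squares_ge_zero[of "1 - \<bar>r - R\<bar>" 0] unfolding y_def by (simp add: power2_eq_square algebra_simps)
        have "gauss_mean \<alpha> p g r powr q * (\<alpha> * q * r)
          \<le> (D * R powr w * y powr m * exp (- b * (r - R)\<^sup>2)) * (\<alpha> * q * (R * y))"
          using up[OF True] rR pos True R y unfolding y_def b_def by (intro mult_mono) auto
        also have "\<dots> = D * (\<alpha> * q) * R powr (w + 1) * (y powr (m + 1) * exp (- b * (r - R)\<^sup>2))"
          using R y by (simp add: powr_add mult_ac)
        also have "\<dots> \<le> D * (\<alpha> * q) * R powr (w + 1) * (K * exp (b / 2) * exp (- (b / 2) * (r - R)\<^sup>2))"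
        proof (intro mult_left_mono)
          have "y powr (m + 1) * exp (- b * (r - R)\<^sup>2) \<le> K * exp (b / 4 * y\<^sup>2) * exp (- b * (r - R)\<^sup>2)"
            using Kle[OF y] by (intro mult_right_mono) auto
          also have "\<dots> \<le> K * exp (b / 4 * (2 + 2 * (r - R)\<^sup>2)) * exp (- b * (r - R)\<^sup>2)"
            using y2 K b by (intro mult_right_mono mult_left_mono) auto
          also have "\<dots> = K * exp (b / 2) * exp (- (b / 2) * (r - R)\<^sup>2)"
            by (simp add: algebra_simps flip: exp_add)
          finally show "y powr (m + 1) * exp (- b * (r - R)\<^sup>2) \<le> K * exp (b / 2) * exp (- (b / 2) * (r - R)\<^sup>2)" .
        qed (use pos in auto)
        finally have "gauss_mean \<alpha> p g r powr q * (\<alpha> * q * r) \<le> C0 * R powr (w + 1) * exp (- (b / 2) * (r - R)\<^sup>2)"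
          by (simp add: C0_def mult_ac)
        then show ?thesis using True C0 by (simp add: ennreal_leI flip: ennreal_mult)
      qed (auto simp: indicator_def)
    qed
    also have "\<dots> = ennreal (C0 * R powr (w + 1)) * ennreal (sqrt (pi / (b / 2)))"
      using b by (subst nn_integral_cmult, measurable, subst nn_integral_gaussian) auto
    also have "\<dots> = ennreal (C0 * sqrt (pi / (b / 2)) * R powr (w + 1))"
      using C0 b by (simp add: mult_ac flip: ennreal_mult)
    finally show ?thesis .
  qed
  moreover have "C0 * sqrt (pi / (b / 2)) > 0" using C0 b by simp
  ultimately show ?thesis by blast
qed

lemma fock_integral_peak_lower:
  fixes \<alpha> p q D R w :: real
  assumes pos: "\<alpha> > 0" "q > 0" "D \<ge> 0" and R: "R > 0"
    and low: "\<And>r. R \<le> r \<Longrightarrow> r \<le> R + 1 \<Longrightarrow> D * R powr w \<le> (gauss_mean \<alpha> p g r) powr q"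
  shows "ennreal (D * (\<alpha> * q) * R powr (w + 1)) \<le> fock_integral \<alpha> p q g"
proof -
  have "ennreal (D * (\<alpha> * q) * R powr (w + 1)) = (\<integral>\<^sup>+r\<in>{R..R + 1}. ennreal (D * (\<alpha> * q) * R powr (w + 1)) \<partial>lborel)"
    by (simp add: nn_integral_cmult_indicator)
  also have "\<dots> \<le> fock_integral \<alpha> p q g"
    unfolding fock_integral_weighted
  proof (rule nn_integral_mono)
    fix r :: real
    show "ennreal (D * (\<alpha> * q) * R powr (w + 1)) * indicator {R..R + 1} r
      \<le> ennreal (gauss_mean \<alpha> p g r powr q * (\<alpha> * q * r)) * indicator {0..} r"
    proof (cases "r \<in> {R..R + 1}")
      case True
      have "D * (\<alpha> * q) * R powr (w + 1) = D * R powr w * (\<alpha> * q * R)"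
        using R by (simp add: powr_add mult_ac)
      also have "\<dots> \<le> (gauss_mean \<alpha> p g r) powr q * (\<alpha> * q * r)"
        using low[of r] True pos R by (intro mult_mono) auto
      finally show ?thesis using True R by (simp add: ennreal_leI)
    qed auto
  qed
  finally show ?thesis .
qed

lemma integral_mean_scale:
  assumes "p > 0" "s \<ge> 0"
  shows "integral_mean p (\<lambda>z. complex_of_real s * g z) r = s * integral_mean p g r"
proof -
  define I where "I = (LBINT t:{0..2 * pi}. norm (g (of_real r * cis t)) powr p)"
  have I: "I \<ge> 0" unfolding I_def set_lebesgue_integral_def by (rule Bochner_Integration.integral_nonneg) auto
  have "(LBINT t:{0..2 * pi}. norm (of_real s * g (of_real r * cis t)) powr p) = s powr p * I"
    unfolding I_def set_integral_mult_right[symmetric] using assms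
    by (intro set_lebesgue_integral_cong) (auto simp: norm_mult powr_mult)
  then have "integral_mean p (\<lambda>z. complex_of_real s * g z) r = (s powr p * (1 / (2 * pi) * I)) powr (1 / p)"
    by (simp add: integral_mean_def mult_ac)
  also have "\<dots> = s * (1 / (2 * pi) * I) powr (1 / p)"
    using assms I by (subst powr_mult) (auto simp: powr_powr)
  finally show ?thesis by (simp add: integral_mean_def I_def)
qed

lemma fock_integral_scale:
  assumes "p > 0" "q > 0" "s \<ge> 0" "g \<in> borel_measurable borel"
  shows "fock_integral \<alpha> p q (\<lambda>z. complex_of_real s * g z) = ennreal (s powr q) * fock_integral \<alpha> p q g"
proof -
  have [measurable]: "integral_mean p g \<in> borel_measurable borel" by (rule borel_measurable_integral_mean[OF assms(4)])
  have "fock_integral \<alpha> p q (\<lambda>z. complex_of_real s * g z)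
    = (\<integral>\<^sup>+r. ennreal (s powr q) * (ennreal (integral_mean p g r powr q * (\<alpha> * q * exp (- (\<alpha> * q / 2) * r\<^sup>2) * r)) * indicator {0..} r) \<partial>lborel)"
    unfolding fock_integral_def using assms
    by (intro nn_integral_cong)
       (auto simp: integral_mean_scale powr_mult ennreal_mult'[symmetric] mult.assoc indicator_def)
  also have "\<dots> = ennreal (s powr q) * fock_integral \<alpha> p q g"
    unfolding fock_integral_def by (rule nn_integral_cmult) measurable
  finally show ?thesis .
qed

text \<open>Normalizing the source integral to at most 1 leaves a target integral of order
  \<open>R powr (v - u * q' / q)\<close>, which \<open>gap\<close> makes unbounded; the humps are
  the test functions at large \<open>R\<close>.\<close>

lemma fock_space_noninclusion:
  fixes \<alpha> p q q' u v C D :: real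
  assumes pos: "\<alpha> > 0" "p > 0" "q > 0" "q' > 0" "C > 0" "D > 0"
    and gap: "u / q < v / q'"
    and test: "\<And>R0. \<exists>R\<ge>R0. \<exists>a g. R \<ge> 1 \<and> (\<forall>n. a n \<ge> (0::real)) \<and> everywhere_sums (\<lambda>n. of_real (a n)) g
      \<and> fock_integral \<alpha> p q g \<le> ennreal (C * R powr u) \<and> ennreal (D * R powr v) \<le> fock_integral \<alpha> 2 q' g"
  shows "\<exists>f \<in> fock_space \<alpha> p q. f \<notin> fock_space \<alpha> 2 q'"
proof (rule gliding_hump[OF pos(1-4)])
  fix L :: real
  define e where "e = v - u * q' / q"
  have e: "e > 0" using gap pos by (simp add: e_def field_simps)
  define E where "E = C powr (- q' / q) * D"
  have E: "E > 0" using pos by (simp add: E_def)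
  \<comment> \<open>The radius at which \<open>E * R powr e\<close> reaches \<open>max L 1\<close>;
    the maximum keeps the base positive for every \<open>L\<close>.\<close>
  define R0 where "R0 = (max L 1 / E) powr (1 / e)"
  obtain R a g where R: "R \<ge> R0" "R \<ge> 1" and a: "\<And>n. a n \<ge> (0::real)" and g: "everywhere_sums (\<lambda>n. of_real (a n)) g"
    and up: "fock_integral \<alpha> p q g \<le> ennreal (C * R powr u)" and low: "ennreal (D * R powr v) \<le> fock_integral \<alpha> 2 q' g"
    using test[of R0] by blast
  have measg: "g \<in> borel_measurable borel"
    by (rule everywhere_sums_measurable[OF g])
  define s where "s = (C * R powr u) powr (- 1 / q)"
  have s: "s > 0" using pos R by (simp add: s_def)
  have sq: "s powr q = 1 / (C * R powr u)"
  proof -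
    have "s powr q = (C * R powr u) powr (- 1)"
      unfolding s_def powr_powr using pos by simp
    then show ?thesis using pos R by (simp add: powr_minus_divide)
  qed
  have sq': "s powr q' * (D * R powr v) = E * R powr e"
  proof -
    have "s powr q' = (C * R powr u) powr (- q' / q)"
      unfolding s_def powr_powr by simp
    also have "\<dots> = C powr (- q' / q) * R powr (u * (- q' / q))"
      using pos R by (subst powr_mult) (simp_all add: powr_powr)
    finally have "s powr q' * (D * R powr v) = E * (R powr (u * (- q' / q)) * R powr v)"
      by (simp add: E_def)
    also have "R powr (u * (- q' / q)) * R powr v = R powr e"
      unfolding powr_add[symmetric] by (simp add: e_def)
    finally show ?thesis .
  qed
  show "\<exists>a g. (\<forall>n. a n \<ge> (0::real)) \<and> everywhere_sums (\<lambda>n. of_real (a n)) g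
      \<and> fock_integral \<alpha> p q g \<le> 1 \<and> ennreal L \<le> fock_integral \<alpha> 2 q' g"
  proof (intro exI conjI allI)
    show "s * a n \<ge> 0" for n using s a by simp
    show "everywhere_sums (\<lambda>n. of_real (s * a n)) (\<lambda>z. of_real s * g z)"
      using g unfolding everywhere_sums_def by (auto simp: mult.assoc intro: sums_mult)
    have "fock_integral \<alpha> p q (\<lambda>z. of_real s * g z) \<le> ennreal (s powr q) * ennreal (C * R powr u)"
      using s pos up by (subst fock_integral_scale[OF _ _ _ measg]) (auto intro: mult_left_mono)
    also have "\<dots> = 1" unfolding sq using pos R by (simp flip: ennreal_mult)
    finally show "fock_integral \<alpha> p q (\<lambda>z. of_real s * g z) \<le> 1" .
    have "max L 1 \<le> E * R powr e"
    proof -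
      have "max L 1 / E = R0 powr e" using e E by (simp add: R0_def powr_powr)
      also have "\<dots> \<le> R powr e" using R e by (intro powr_mono2) (auto simp: R0_def)
      finally show ?thesis using E by (simp add: field_simps)
    qed
    then have "ennreal L \<le> ennreal (s powr q' * (D * R powr v))" unfolding sq' by (intro ennreal_leI) simp
    also have "\<dots> = ennreal (s powr q') * ennreal (D * R powr v)" using pos by (simp add: ennreal_mult)
    also have "\<dots> \<le> fock_integral \<alpha> 2 q' (\<lambda>z. of_real s * g z)"
      using s pos low by (subst fock_integral_scale[OF _ _ _ measg]) (auto intro: mult_left_mono)
    finally show "ennreal L \<le> fock_integral \<alpha> 2 q' (\<lambda>z. of_real s * g z)" .
  qed
qed


text \<open>A monomial has constant modulus on circles, so all its means agree, and its weighted
  profile has bounded width around \<open>R\<close>. The integral is of order \<open>R\<close> for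
  both \<open>q\<close> and \<open>q'\<close>, and its root of order \<open>q'\<close> outgrows that
  of order \<open>q\<close>.\<close>

lemma monomial_noninclusion:
  fixes \<alpha> p q q' :: real
  assumes pos: "\<alpha> > 0" "p > 0" "q > 0" "q' > 0" and less: "q' < q"
  shows "\<exists>f \<in> fock_space \<alpha> p q. f \<notin> fock_space \<alpha> 2 q'"
proof -
  obtain C where C: "C > 0" and upper: "\<And>g R w. R \<ge> 1 \<Longrightarrow>
     (\<And>r. r > 0 \<Longrightarrow> (gauss_mean \<alpha> p g r) powr q
       \<le> 1 * R powr w * (1 + \<bar>r - R\<bar>) powr 0 * exp (- (\<alpha> * q / 2) * (r - R)\<^sup>2)) \<Longrightarrow>
     fock_integral \<alpha> p q g \<le> ennreal (C * R powr (w + 1))"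
    using fock_integral_peak_upper[of \<alpha> q 1 0 p] pos by auto
  define D where "D = exp (- (3 / 2) * \<alpha>) powr q' * (\<alpha> * q')"
  have D: "D > 0" using pos by (simp add: D_def)
  show ?thesis
  proof (rule fock_space_noninclusion[OF pos C D])
    show "1 / q < 1 / q'" using pos less by (simp add: frac_less2)
    fix R0 :: real
    obtain n :: nat where n: "\<alpha> * (max R0 1)\<^sup>2 \<le> real n" using real_arch_simple by blast
    define R where "R = sqrt (real n / \<alpha>)"
    have nR: "real n = \<alpha> * R\<^sup>2" using pos by (simp add: R_def)
    have "max R0 1 \<le> R"
      unfolding R_def using n pos by (intro real_le_rsqrt) (simp add: field_simps)
    then have R: "R \<ge> R0" "R \<ge> 1" by auto
    \<comment> \<open>Gives the weighted profile the value 1 at its peak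
      \<open>r = R\<close>.\<close>
    define A where "A = exp (real n / 2) / R ^ n"
    have A: "A > 0" using R by (simp add: A_def)
    define g where "g = (\<lambda>z::complex. of_real A * z ^ n)"
    have sums: "everywhere_sums (\<lambda>k. of_real (if k = n then A else 0)) g"
      unfolding everywhere_sums_def g_def
    proof
      fix z :: complex
      have "(\<lambda>k. if k = n then of_real A * z ^ k else 0) sums (of_real A * z ^ n)" by (rule sums_single)
      then show "(\<lambda>k. of_real (if k = n then A else 0) * z ^ k) sums (of_real A * z ^ n)"
        by (rule sums_cong[THEN iffD1, rotated]) auto
    qed
    have meas: "g \<in> borel_measurable borel"
      by (rule everywhere_sums_measurable[OF sums])
    have mean: "integral_mean s g r = A * r ^ n" if "s > 0" "r \<ge> 0" for s r
      unfolding integral_mean_circ[OF meas] using that A circ.prob_space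
      by (simp add: g_def norm_mult norm_power powr_powr)
    have weighted: "A * r ^ n * gauss \<alpha> r = exp (real n / 2 + real n * ln (r / R) - (\<alpha> / 2) * r\<^sup>2)" if "r > 0" for r
    proof -
      have "A * r ^ n = exp (real n / 2) * (r / R) ^ n" by (simp add: A_def power_divide)
      also have "(r / R) ^ n = exp (real n * ln (r / R))" using that R by (simp add: exp_of_nat_mult)
      finally show ?thesis by (simp flip: exp_add)
    qed
    have up: "fock_integral \<alpha> p q g \<le> ennreal (C * R powr (0 + 1))"
    proof (rule upper[OF R(2)])
      fix r :: real assume r: "r > 0"
      \<comment> \<open>The tangent bound on the logarithm yields a Gaussian profile centred at
        \<open>R\<close>.\<close>
      have "real n * ln (r / R) \<le> \<alpha> * R\<^sup>2 * (r / R - 1)"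
        unfolding nR using pos r R by (intro mult_left_mono ln_le_minus_one) auto
      also have "\<dots> = \<alpha> * R * r - \<alpha> * R\<^sup>2" using R by (simp add: power2_eq_square field_simps)
      finally have "real n / 2 + real n * ln (r / R) - (\<alpha> / 2) * r\<^sup>2 \<le> - (\<alpha> / 2) * (r - R)\<^sup>2"
        unfolding power2_diff by (simp add: nR algebra_simps)
      then have "gauss_mean \<alpha> p g r \<le> gauss \<alpha> (r - R)"
        using mean[OF pos(2), of r] weighted[OF r] r by simp
      then have "gauss_mean \<alpha> p g r powr q \<le> gauss \<alpha> (r - R) powr q"
        using pos by (intro powr_mono2) auto
      also have "\<dots> = exp (- (\<alpha> * q / 2) * (r - R)\<^sup>2)" by (simp add: exp_powr_real mult_ac)
      finally show "gauss_mean \<alpha> p g r powr q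
        \<le> 1 * R powr 0 * (1 + \<bar>r - R\<bar>) powr 0 * exp (- (\<alpha> * q / 2) * (r - R)\<^sup>2)" using R by simp
    qed
    have low: "ennreal (exp (- (3 / 2) * \<alpha>) powr q' * (\<alpha> * q') * R powr (0 + 1)) \<le> fock_integral \<alpha> 2 q' g"
    proof (rule fock_integral_peak_lower)
      fix r :: real assume r: "R \<le> r" "r \<le> R + 1"
      define x where "x = r - R"
      have x: "0 \<le> x" "x \<le> 1" "r = R + x" using r by (auto simp: x_def)
      have "x / R - (x / R)\<^sup>2 \<le> ln (1 + x / R)"
        using x R by (intro ln_one_plus_pos_lower_bound) auto
      then have "\<alpha> * R\<^sup>2 * (x / R - (x / R)\<^sup>2) \<le> real n * ln (1 + x / R)"
        unfolding nR using pos by (intro mult_left_mono) auto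
      moreover have "1 + x / R = r / R" using R x by (simp add: field_simps)
      moreover have "\<alpha> * R\<^sup>2 * (x / R - (x / R)\<^sup>2) = \<alpha> * R * x - \<alpha> * x\<^sup>2"
        using R by (simp add: power2_eq_square field_simps)
      moreover have "real n / 2 - (\<alpha> / 2) * r\<^sup>2 = - (\<alpha> * R * x) - \<alpha> * x\<^sup>2 / 2"
        unfolding x(3) power2_sum by (simp add: nR algebra_simps)
      \<comment> \<open>The logarithm loses \<open>\<alpha> * x\<^sup>2\<close> and the weight half
        as much, hence the factor 3/2.\<close>
      moreover have "\<alpha> * x\<^sup>2 \<le> \<alpha>" using x pos by (simp add: power_le_one)
      ultimately have "- (3 / 2) * \<alpha> \<le> real n / 2 + real n * ln (r / R) - (\<alpha> / 2) * r\<^sup>2" by simp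
      then have "exp (- (3 / 2) * \<alpha>) \<le> gauss_mean \<alpha> 2 g r"
        using mean[of 2 r] weighted[of r] r R by simp
      then show "exp (- (3 / 2) * \<alpha>) powr q' * R powr 0 \<le> (gauss_mean \<alpha> 2 g r) powr q'"
        using R pos by (simp add: powr_mono2)
    qed (use pos R in auto)
    show "\<exists>R\<ge>R0. \<exists>a g. R \<ge> 1 \<and> (\<forall>n. a n \<ge> (0::real)) \<and> everywhere_sums (\<lambda>n. of_real (a n)) g
      \<and> fock_integral \<alpha> p q g \<le> ennreal (C * R powr 1) \<and> ennreal (D * R powr 1) \<le> fock_integral \<alpha> 2 q' g"
    proof (intro exI conjI)
      show "R \<ge> R0" "R \<ge> 1" using R by auto
      show "everywhere_sums (\<lambda>k. of_real (if k = n then A else 0)) g" by (rule sums)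
      show "\<forall>k. 0 \<le> (if k = n then A else 0)" using A by simp
      show "fock_integral \<alpha> p q g \<le> ennreal (C * R powr 1)" using up by simp
      show "ennreal (D * R powr 1) \<le> fock_integral \<alpha> 2 q' g" using low by (simp add: D_def)
    qed
  qed
qed

section \<open>Angular concentration of the exponential kernels\<close>

lemma one_minus_cos_lower:
  fixes t :: real
  assumes "0 \<le> t" "t \<le> pi"
  shows "t\<^sup>2 / 18 \<le> 1 - cos t"
proof -
  \<comment> \<open>Half angle: \<open>1 - cos t = 2 * (sin x)\<^sup>2\<close>, and
    \<open>sin x \<ge> x / 3\<close> for \<open>x\<close> in \<open>{0..2}\<close>, since the cubic
    error is at most \<open>2 / 3 * x\<close>. The constant 18 is 9 times 4 over 2.\<close>
  define x where "x = t / 2"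
  have x: "0 \<le> x" "x \<le> 2" using assms pi_less_4 by (auto simp: x_def)
  have "\<bar>sin x - (\<Sum>m<3. sin_coeff m * x ^ m)\<bar> \<le> inverse (fact 3) * \<bar>x\<bar> ^ 3"
    by (rule Maclaurin_sin_bound)
  moreover have "(\<Sum>m<3. sin_coeff m * x ^ m) = x"
    by (simp add: sin_coeff_def numeral_3_eq_3)
  moreover have "inverse (fact 3) * \<bar>x\<bar> ^ 3 \<le> (2 / 3) * x"
  proof -
    have "x ^ 3 = x * x\<^sup>2" by (simp add: power2_eq_square power3_eq_cube)
    also have "\<dots> \<le> x * 2\<^sup>2" using x by (intro mult_left_mono power_mono) auto
    finally show ?thesis using x by (simp add: fact_numeral)
  qed
  ultimately have "x / 3 \<le> sin x" by (simp add: abs_le_iff)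
  then have "(x / 3)\<^sup>2 \<le> (sin x)\<^sup>2" using x by (intro power_mono) auto
  moreover have "cos t = 1 - 2 * (sin x)\<^sup>2"
    using cos_double_sin[of x] by (simp add: x_def)
  ultimately show ?thesis by (simp add: x_def power_divide)
qed

lemma one_minus_cos_upper: "1 - cos t \<le> t\<^sup>2 / 2" for t :: real
proof -
  have "(sin (t / 2))\<^sup>2 \<le> (t / 2)\<^sup>2"
    using power_mono[OF abs_sin_x_le_abs_x[of "t / 2"], of 2] by (simp only: power2_abs abs_ge_zero)
  then show ?thesis using cos_double_sin[of "t / 2"] by (simp add: power_divide)
qed

text \<open>This is \<open>exp (- \<kappa>)\<close> times the modified Bessel function of order 0 at
  \<kappa>, of order \<open>\<kappa> powr (- 1 / 2)\<close> for large \<kappa>.\<close>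

definition circle_concentration :: "real \<Rightarrow> real" where
  "circle_concentration \<kappa> = (\<integral>t. exp (- \<kappa> * (1 - cos t)) \<partial>circ)"

lemma integrable_circle_concentration: "integrable circ (\<lambda>t. exp (- \<kappa> * (1 - cos t)))" for \<kappa> :: real
  by (intro integrable_circ_continuous continuous_intros)

lemma circle_concentration_nonneg: "circle_concentration \<kappa> \<ge> 0"
  unfolding circle_concentration_def by (rule Bochner_Integration.integral_nonneg) auto

lemma circle_concentration_le_1:
  assumes "\<kappa> \<ge> 0"
  shows "circle_concentration \<kappa> \<le> 1"
proof -
  have "circle_concentration \<kappa> \<le> (\<integral>t. 1 \<partial>circ)"
    unfolding circle_concentration_def using assms
    by (intro integral_mono integrable_circle_concentration) auto
  then show ?thesis using circ.prob_space by simp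
qed

text \<open>On \<open>{0..2 * pi}\<close> the integrand peaks at both endpoints; each half is
  dominated by a Gaussian, which is then integrated over the whole line.\<close>

lemma circle_concentration_upper:
  assumes \<kappa>: "\<kappa> > 0"
  shows "circle_concentration \<kappa> \<le> sqrt (18 * pi / \<kappa>) / pi"
proof -
  have pt: "exp (- \<kappa> * (1 - cos t)) \<le> exp (- (\<kappa> / 18) * (t - 0)\<^sup>2) + exp (- (\<kappa> / 18) * (t - 2 * pi)\<^sup>2)"
    if t: "t \<in> {0..2 * pi}" for t
  proof (cases "t \<le> pi")
    case True
    have "\<kappa> * (t\<^sup>2 / 18) \<le> \<kappa> * (1 - cos t)"
      using one_minus_cos_lower[of t] True t \<kappa> by (intro mult_left_mono) auto
    then show ?thesis by (simp add: add_increasing2)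
  next
    case False
    have "\<kappa> * ((2 * pi - t)\<^sup>2 / 18) \<le> \<kappa> * (1 - cos (2 * pi - t))"
      using False t \<kappa> by (intro mult_left_mono one_minus_cos_lower) auto
    then have "exp (- \<kappa> * (1 - cos t)) \<le> exp (- (\<kappa> / 18) * (t - 2 * pi)\<^sup>2)"
      by (simp add: cos_diff power2_commute)
    then show ?thesis by (simp add: add_increasing)
  qed
  have "ennreal (circle_concentration \<kappa>) = (\<integral>\<^sup>+t. ennreal (exp (- \<kappa> * (1 - cos t))) \<partial>circ)"
    unfolding circle_concentration_def
    by (rule nn_integral_eq_integral[OF integrable_circle_concentration, symmetric]) auto
  also have "\<dots> = (\<integral>\<^sup>+t. ennreal (indicator {0..2 * pi} t / (2 * pi)) * ennreal (exp (- \<kappa> * (1 - cos t))) \<partial>lborel)"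
    unfolding circ_density by (rule nn_integral_density) measurable
  also have "\<dots> \<le> (\<integral>\<^sup>+t. ennreal (1 / (2 * pi)) * (ennreal (exp (- (\<kappa> / 18) * (t - 0)\<^sup>2)) + ennreal (exp (- (\<kappa> / 18) * (t - 2 * pi)\<^sup>2))) \<partial>lborel)"
  proof (rule nn_integral_mono)
    fix t :: real
    show "ennreal (indicator {0..2 * pi} t / (2 * pi)) * ennreal (exp (- \<kappa> * (1 - cos t)))
      \<le> ennreal (1 / (2 * pi)) * (ennreal (exp (- (\<kappa> / 18) * (t - 0)\<^sup>2)) + ennreal (exp (- (\<kappa> / 18) * (t - 2 * pi)\<^sup>2)))"
    proof (cases "t \<in> {0..2 * pi}")
      case True
      have "ennreal (exp (- \<kappa> * (1 - cos t))) \<le> ennreal (exp (- (\<kappa> / 18) * (t - 0)\<^sup>2)) + ennreal (exp (- (\<kappa> / 18) * (t - 2 * pi)\<^sup>2))"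
        using ennreal_leI[OF pt[OF True]] by simp
      then show ?thesis using True by (intro mult_mono) auto
    qed auto
  qed
  also have "\<dots> = ennreal (1 / (2 * pi)) * (ennreal (sqrt (pi / (\<kappa> / 18))) + ennreal (sqrt (pi / (\<kappa> / 18))))"
    using \<kappa> by (subst nn_integral_cmult, measurable, subst nn_integral_add, measurable)
      (subst (1 2) nn_integral_gaussian, auto)
  also have "\<dots> = ennreal (1 / (2 * pi) * (sqrt (pi / (\<kappa> / 18)) + sqrt (pi / (\<kappa> / 18))))"
    using \<kappa> by (subst ennreal_mult, simp, simp, subst ennreal_plus) auto
  finally have "circle_concentration \<kappa> \<le> 1 / (2 * pi) * (sqrt (pi / (\<kappa> / 18)) + sqrt (pi / (\<kappa> / 18)))"
    using \<kappa> by (subst (asm) ennreal_le_iff) auto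
  also have "\<dots> = sqrt (18 * pi / \<kappa>) / pi" by (simp add: mult.commute)
  finally show ?thesis .
qed

text \<open>Restriction to an arc of length \<open>1 / R\<close>, where \<kappa> times
  \<open>1 - cos t\<close> is at most \<open>\<kappa> / (2 * R\<^sup>2)\<close>. For \<kappa> of
  order \<open>R\<^sup>2\<close> the bound has the right order \<open>1 / R\<close>.\<close>

lemma circle_concentration_lower:
  assumes \<kappa>: "\<kappa> \<ge> 0" and R: "R \<ge> 1"
  shows "exp (- \<kappa> / (2 * R\<^sup>2)) / (2 * pi * R) \<le> circle_concentration \<kappa>"
proof -
  have R1: "0 < 1 / R" "1 / R \<le> 2 * pi"
    using R pi_ge_two by (auto simp: field_simps intro: order_trans[of 1 "2 * pi"] mult_ge1_I)
  have m: "measure circ {0..1 / R} = 1 / (2 * pi * R)"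
  proof -
    have "{0..2 * pi} \<inter> {0..1 / R} = {0..1 / R}" using R1 by auto
    then show ?thesis
      unfolding circ_def using R1 by (subst measure_uniform_measure) (auto simp: field_simps)
  qed
  have "exp (- \<kappa> / (2 * R\<^sup>2)) / (2 * pi * R) = (\<integral>t. exp (- \<kappa> / (2 * R\<^sup>2)) * indicator {0..1 / R} t \<partial>circ)"
    by (simp add: m)
  also have "\<dots> \<le> circle_concentration \<kappa>"
    unfolding circle_concentration_def
  proof (rule integral_mono[OF _ integrable_circle_concentration])
    show "integrable circ (\<lambda>t. exp (- \<kappa> / (2 * R\<^sup>2)) * indicator {0..1 / R} t)"
      by (rule integrable_circ[where B = "exp (- \<kappa> / (2 * R\<^sup>2))"]) (auto simp: indicator_def)
    fix t :: real
    show "exp (- \<kappa> / (2 * R\<^sup>2)) * indicator {0..1 / R} t \<le> exp (- \<kappa> * (1 - cos t))"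
    proof (cases "t \<in> {0..1 / R}")
      case True
      have "1 - cos t \<le> t\<^sup>2 / 2" by (rule one_minus_cos_upper)
      also have "\<dots> \<le> (1 / R)\<^sup>2 / 2" using True by (intro divide_right_mono power_mono) auto
      finally have "\<kappa> * (1 - cos t) \<le> \<kappa> * ((1 / R)\<^sup>2 / 2)" using \<kappa> by (intro mult_left_mono) auto
      then show ?thesis using True by (simp add: power_divide mult.commute)
    qed auto
  qed
  finally show ?thesis .
qed

text \<open>Writing \<open>cos t\<close> as \<open>1 - (1 - cos t)\<close> separates the angular
  from the radial part, and completing the square gives the Gaussian. \<open>g\<close> is the
  reproducing kernel at \<open>R\<close>, normalized by the constant in the exponent.\<close>

lemma kernel_mean:
  fixes \<alpha> R p r :: real
  assumes p: "p > 0"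
  defines "g \<equiv> \<lambda>z. exp (of_real (\<alpha> * R) * z - of_real (\<alpha> / 2 * R\<^sup>2) :: complex)"
  shows "gauss_mean \<alpha> p g r powr p
    = exp (- (\<alpha> * p / 2) * (r - R)\<^sup>2) * circle_concentration (\<alpha> * p * r * R)"
proof -
  have meas: "g \<in> borel_measurable borel"
    unfolding g_def by (intro borel_measurable_continuous_onI continuous_intros)
  have "norm (g (of_real r * cis t)) powr p = exp (- (\<alpha> * p / 2) * (R\<^sup>2 - 2 * r * R)) * exp (- (\<alpha> * p * r * R) * (1 - cos t))" for t
    by (simp add: g_def exp_powr_real flip: exp_add) (simp add: field_simps)
  then have "integral_mean p g r powr p = exp (- (\<alpha> * p / 2) * (R\<^sup>2 - 2 * r * R)) * circle_concentration (\<alpha> * p * r * R)"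
    unfolding integral_mean_powr[OF meas p] circle_concentration_def by simp
  then have "gauss_mean \<alpha> p g r powr p
    = exp (- (\<alpha> * p / 2) * (R\<^sup>2 - 2 * r * R)) * circle_concentration (\<alpha> * p * r * R) * exp (- (\<alpha> / 2) * r\<^sup>2 * p)"
    by (simp add: powr_mult exp_powr_real mult_ac)
  also have "\<dots> = (exp (- (\<alpha> * p / 2) * (R\<^sup>2 - 2 * r * R)) * exp (- (\<alpha> / 2) * r\<^sup>2 * p)) * circle_concentration (\<alpha> * p * r * R)"
    by (simp only: mult_ac)
  also have "exp (- (\<alpha> * p / 2) * (R\<^sup>2 - 2 * r * R)) * exp (- (\<alpha> / 2) * r\<^sup>2 * p) = exp (- (\<alpha> * p / 2) * (r - R)\<^sup>2)"
    unfolding power2_diff by (simp add: algebra_simps flip: exp_add)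
  finally show ?thesis .
qed

text \<open>Near \<open>r = R\<close> the kernel lives on an arc of length about
  \<open>1 / R\<close>, so its \<open>p\<close>-mean to the power \<open>q\<close> has order
  \<open>R powr (- q / p)\<close>. Including the radial factor, the exponents are
  \<open>1 - q / p\<close> and \<open>1 - q' / 2\<close>; divided by \<open>q\<close> and
  \<open>q'\<close>, their comparison is \<open>big\<close>.\<close>

lemma kernel_noninclusion:
  fixes \<alpha> p q q' :: real
  assumes pos: "\<alpha> > 0" "p > 0" "q > 0" "q' > 0" and big: "1 / 2 < 1 / p + 1 / q' - 1 / q"
  shows "\<exists>f \<in> fock_space \<alpha> p q. f \<notin> fock_space \<alpha> 2 q'"
proof -
  \<comment> \<open>The 2 covers radii below \<open>R / 2\<close>, where
    \<open>1 \<le> 2 * \<bar>r - R\<bar> / R\<close>; the root covers the others.\<close>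
  define D0 where "D0 = 2 + sqrt (36 * pi / (\<alpha> * p)) / pi"
  have D0: "D0 > 0" using pos by (simp add: D0_def add_pos_nonneg)
  obtain C where C: "C > 0" and upper: "\<And>g R w. R \<ge> 1 \<Longrightarrow>
     (\<And>r. r > 0 \<Longrightarrow> (gauss_mean \<alpha> p g r) powr q
       \<le> D0 powr (q / p) * R powr w * (1 + \<bar>r - R\<bar>) powr (q / p) * exp (- (\<alpha> * q / 2) * (r - R)\<^sup>2)) \<Longrightarrow>
     fock_integral \<alpha> p q g \<le> ennreal (C * R powr (w + 1))"
    using fock_integral_peak_upper[of \<alpha> q "D0 powr (q / p)" "q / p" p] pos D0 by auto
  \<comment> \<open>On \<open>{R..R + 1}\<close> a factor \<open>exp (- \<alpha>)\<close> is lost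
    radially and \<open>exp (- 2 * \<alpha>)\<close> on the arc, where
    \<open>r \<le> 2 * R\<close>.\<close>
  define D1 where "D1 = exp (- 3 * \<alpha>) / (2 * pi)"
  have D1: "D1 > 0" by (simp add: D1_def)
  define D where "D = D1 powr (q' / 2) * (\<alpha> * q')"
  have D: "D > 0" using pos D1 by (simp add: D_def)
  show ?thesis
  proof (rule fock_space_noninclusion[OF pos C D])
    show "(- q / p + 1) / q < (- q' / 2 + 1) / q'"
    proof -
      have "(- q / p + 1) / q = 1 / q - 1 / p" "(- q' / 2 + 1) / q' = 1 / q' - 1 / 2"
        using pos by (simp_all add: field_simps)
      then show ?thesis using big by linarith
    qed
    fix R0 :: real
    define R where "R = max R0 1"
    have R: "R \<ge> R0" "R \<ge> 1" by (auto simp: R_def)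
    define g where "g = (\<lambda>z. exp (of_real (\<alpha> * R) * z - of_real (\<alpha> / 2 * R\<^sup>2) :: complex))"
    define a where "a n = exp (- (\<alpha> / 2 * R\<^sup>2)) * ((\<alpha> * R) ^ n / fact n)" for n
    have a: "a n \<ge> 0" for n using pos R by (simp add: a_def)
    have sums: "everywhere_sums (\<lambda>n. of_real (a n)) g"
      unfolding everywhere_sums_def
    proof
      fix z :: complex
      have "(\<lambda>n. exp (- of_real (\<alpha> / 2 * R\<^sup>2)) * ((of_real (\<alpha> * R) * z) ^ n /\<^sub>R fact n)) sums
        (exp (- of_real (\<alpha> / 2 * R\<^sup>2)) * exp (of_real (\<alpha> * R) * z))"
        by (intro sums_mult exp_converges)
      moreover have "exp (- of_real (\<alpha> / 2 * R\<^sup>2)) * ((of_real (\<alpha> * R) * z) ^ n /\<^sub>R fact n) = of_real (a n) * z ^ n" for n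
        by (simp add: a_def scaleR_conv_of_real power_mult_distrib field_simps exp_of_real[symmetric])
      moreover have "exp (- of_real (\<alpha> / 2 * R\<^sup>2)) * exp (of_real (\<alpha> * R) * z) = g z"
        by (simp add: g_def flip: exp_add)
      ultimately show "(\<lambda>n. of_real (a n) * z ^ n) sums g z" by simp
    qed
    have up: "fock_integral \<alpha> p q g \<le> ennreal (C * R powr (- q / p + 1))"
    proof (rule upper[OF R(2)])
      fix r :: real assume r: "r > 0"
      define J where "J = circle_concentration (\<alpha> * p * r * R)"
      have J0: "J \<ge> 0" unfolding J_def by (rule circle_concentration_nonneg)
      have "J \<le> D0 * (1 + \<bar>r - R\<bar>) / R"
      proof (cases "r \<ge> R / 2")
        case True
        have "J \<le> sqrt (18 * pi / (\<alpha> * p * r * R)) / pi"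
          unfolding J_def using pos r R by (intro circle_concentration_upper) auto
        also have "\<dots> \<le> sqrt (36 * pi / (\<alpha> * p) / R\<^sup>2) / pi"
        proof (intro divide_right_mono real_sqrt_le_mono)
          have "18 * pi / (\<alpha> * p * r * R) \<le> 18 * pi / (\<alpha> * p * (R / 2) * R)"
            using True pos R by (intro divide_left_mono mult_right_mono mult_left_mono) auto
          also have "\<dots> = 36 * pi / (\<alpha> * p) / R\<^sup>2" by (simp add: power2_eq_square mult.assoc)
          finally show "18 * pi / (\<alpha> * p * r * R) \<le> 36 * pi / (\<alpha> * p) / R\<^sup>2" .
        qed simp
        also have "\<dots> = sqrt (36 * pi / (\<alpha> * p)) / pi * 1 / R"
          using R by (simp add: real_sqrt_divide real_sqrt_mult)
        also have "\<dots> \<le> D0 * (1 + \<bar>r - R\<bar>) / R"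
          using R pos by (intro divide_right_mono mult_mono) (auto simp: D0_def)
        finally show ?thesis .
      next
        case False
        have "J \<le> 1" unfolding J_def using pos r R by (intro circle_concentration_le_1) auto
        also have "\<dots> \<le> 2 * \<bar>r - R\<bar> / R" using False R by (simp add: field_simps)
        also have "\<dots> \<le> D0 * (1 + \<bar>r - R\<bar>) / R"
          using R pos by (intro divide_right_mono mult_mono) (auto simp: D0_def)
        finally show ?thesis .
      qed
      then have "gauss_mean \<alpha> p g r powr p \<le> exp (- (\<alpha> * p / 2) * (r - R)\<^sup>2) * (D0 * (1 + \<bar>r - R\<bar>) / R)"
        unfolding g_def kernel_mean[OF pos(2)] J_def by (intro mult_left_mono) auto
      then have "(gauss_mean \<alpha> p g r powr p) powr (q / p)
        \<le> (exp (- (\<alpha> * p / 2) * (r - R)\<^sup>2) * (D0 * (1 + \<bar>r - R\<bar>) / R)) powr (q / p)"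
        using pos by (intro powr_mono2) auto
      moreover have "(gauss_mean \<alpha> p g r powr p) powr (q / p) = gauss_mean \<alpha> p g r powr q"
        using pos by (simp add: powr_powr)
      moreover have "(exp (- (\<alpha> * p / 2) * (r - R)\<^sup>2) * (D0 * (1 + \<bar>r - R\<bar>) / R)) powr (q / p)
        = exp (- (\<alpha> * p / 2) * (r - R)\<^sup>2 * (q / p)) * (D0 powr (q / p) * (1 + \<bar>r - R\<bar>) powr (q / p) / R powr (q / p))"
        using D0 R by (simp only: powr_mult powr_divide exp_powr_real)
      moreover have "- (\<alpha> * p / 2) * (r - R)\<^sup>2 * (q / p) = - (\<alpha> * q / 2) * (r - R)\<^sup>2" using pos by simp
      moreover have "R powr (- q / p) = 1 / R powr (q / p)" by (simp add: powr_minus_divide)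
      ultimately show "gauss_mean \<alpha> p g r powr q
        \<le> D0 powr (q / p) * R powr (- q / p) * (1 + \<bar>r - R\<bar>) powr (q / p) * exp (- (\<alpha> * q / 2) * (r - R)\<^sup>2)"
        using pos by (simp add: mult_ac)
    qed
    have low: "ennreal (D1 powr (q' / 2) * (\<alpha> * q') * R powr (- q' / 2 + 1)) \<le> fock_integral \<alpha> 2 q' g"
    proof (rule fock_integral_peak_lower)
      fix r :: real assume r: "R \<le> r" "r \<le> R + 1"
      define J where "J = circle_concentration (\<alpha> * 2 * r * R)"
      have "exp (- (2 * \<alpha>)) / (2 * pi * R) \<le> exp (- (\<alpha> * 2 * r * R) / (2 * R\<^sup>2)) / (2 * pi * R)"
      proof (intro divide_right_mono)
        have "r \<le> 2 * R" using r R by simp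
        then have "r / R \<le> 2" using R by (simp add: field_simps)
        then have "\<alpha> * (r / R) \<le> \<alpha> * 2" using pos by (intro mult_left_mono) auto
        moreover have "- (\<alpha> * 2 * r * R) / (2 * R\<^sup>2) = - (\<alpha> * (r / R))" using R by (simp add: power2_eq_square)
        ultimately show "exp (- (2 * \<alpha>)) \<le> exp (- (\<alpha> * 2 * r * R) / (2 * R\<^sup>2))" by simp
      qed (use R in auto)
      also have "\<dots> \<le> J" unfolding J_def using pos r R by (intro circle_concentration_lower) auto
      finally have J: "exp (- (2 * \<alpha>)) / (2 * pi * R) \<le> J" .
      have "(r - R)\<^sup>2 \<le> 1" using r by (simp add: power_le_one)
      then have x: "exp (- \<alpha>) \<le> exp (- (\<alpha> * 2 / 2) * (r - R)\<^sup>2)" using pos by simp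
      have "D1 / R = exp (- \<alpha>) * (exp (- (2 * \<alpha>)) / (2 * pi * R))"
        by (simp add: D1_def flip: exp_add)
      also have "\<dots> \<le> exp (- (\<alpha> * 2 / 2) * (r - R)\<^sup>2) * J"
        using J x R by (intro mult_mono) auto
      also have "\<dots> = gauss_mean \<alpha> 2 g r powr 2"
        unfolding g_def J_def by (rule kernel_mean[symmetric]) simp
      finally have "(D1 / R) powr (q' / 2) \<le> (gauss_mean \<alpha> 2 g r powr 2) powr (q' / 2)"
        using D1 R pos by (intro powr_mono2) auto
      also have "\<dots> = gauss_mean \<alpha> 2 g r powr q'"
        unfolding powr_powr by simp
      also have "(D1 / R) powr (q' / 2) = D1 powr (q' / 2) * R powr (- q' / 2)"
        using D1 R by (simp add: powr_divide powr_minus_divide)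
      finally show "D1 powr (q' / 2) * R powr (- q' / 2) \<le> (gauss_mean \<alpha> 2 g r) powr q'" .
    qed (use pos R in auto)
    show "\<exists>R\<ge>R0. \<exists>a g. R \<ge> 1 \<and> (\<forall>n. a n \<ge> (0::real)) \<and> everywhere_sums (\<lambda>n. of_real (a n)) g
      \<and> fock_integral \<alpha> p q g \<le> ennreal (C * R powr (- q / p + 1)) \<and> ennreal (D * R powr (- q' / 2 + 1)) \<le> fock_integral \<alpha> 2 q' g"
      using R a sums up low unfolding D_def by blast
  qed
qed

theorem theorem3p3:
  fixes M :: "'w measure" and X :: "nat \<Rightarrow> 'w \<Rightarrow> complex"
    and p\<^sub>1 p\<^sub>2 q\<^sub>1 q\<^sub>2 \<alpha> \<beta> :: real
  assumes "prob_space M"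
    and "standard_random_sequence M X"
    and "p\<^sub>1 > 0" "p\<^sub>2 > 0" "q\<^sub>1 > 0" "q\<^sub>2 > 0" "\<alpha> > 0" "\<beta> > 0"
  shows "randomly_embeds M X (fock_space \<alpha> p\<^sub>1 q\<^sub>1) (fock_space \<beta> p\<^sub>2 q\<^sub>2) \<longleftrightarrow>
    \<alpha> < \<beta> \<or> (\<alpha> = \<beta> \<and> q\<^sub>1 \<le> q\<^sub>2 \<and> 1 / p\<^sub>1 + 1 / q\<^sub>2 - 1 / q\<^sub>1 \<le> 1 / 2)"
    (is "?L \<longleftrightarrow> ?R")
proof -
  note pos = assms(3-8)
  interpret standard_sequence M X
    using assms(1,2) by (simp add: standard_sequence_def standard_sequence_axioms_def)
  have iff: "?L \<longleftrightarrow> fock_space \<alpha> p\<^sub>1 q\<^sub>1 \<subseteq> fock_space \<beta> 2 q\<^sub>2"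
  proof
    assume L: ?L
    show "fock_space \<alpha> p\<^sub>1 q\<^sub>1 \<subseteq> fock_space \<beta> 2 q\<^sub>2"
    proof
      fix f assume f: "f \<in> fock_space \<alpha> p\<^sub>1 q\<^sub>1"
      then have "AE \<omega> in M. randomization X f \<omega> \<in> fock_space \<beta> p\<^sub>2 q\<^sub>2"
        using L by (auto simp: randomly_embeds_def)
      then show "f \<in> fock_space \<beta> 2 q\<^sub>2"
        using f pos by (intro fock_integral_of_randomization[of f \<beta> p\<^sub>2 q\<^sub>2]) (auto simp: mem_fock_space_iff)
    qed
  next
    assume sub: "fock_space \<alpha> p\<^sub>1 q\<^sub>1 \<subseteq> fock_space \<beta> 2 q\<^sub>2"
    show ?L
      unfolding randomly_embeds_def
    proof
      fix f assume f: "f \<in> fock_space \<alpha> p\<^sub>1 q\<^sub>1"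
      then have "everywhere_sums (taylor_coeff f) f"
        by (intro everywhere_sums_taylor) (simp add: mem_fock_space_iff)
      then have "AE \<omega> in M. \<forall>z. summable (\<lambda>n. taylor_coeff f n * X n \<omega> * z ^ n)"
        by (rule AE_random_series_converges)
      moreover have "AE \<omega> in M. randomization X f \<omega> \<in> fock_space \<beta> p\<^sub>2 q\<^sub>2"
        using sub f pos by (intro randomization_in_fock_space) auto
      ultimately show "AE \<omega> in M. (\<forall>z. summable (\<lambda>n. taylor_coeff f n * X n \<omega> * z ^ n)) \<and>
          randomization X f \<omega> \<in> fock_space \<beta> p\<^sub>2 q\<^sub>2"
        by eventually_elim blast
    qed
  qed
  show ?thesis
    unfolding iff
  proof
    assume ?R
    then show "fock_space \<alpha> p\<^sub>1 q\<^sub>1 \<subseteq> fock_space \<beta> 2 q\<^sub>2"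
      using pos fock_embedding by blast
  next
    assume sub: "fock_space \<alpha> p\<^sub>1 q\<^sub>1 \<subseteq> fock_space \<beta> 2 q\<^sub>2"
    have "\<not> \<beta> < \<alpha>"
    proof
      assume "\<beta> < \<alpha>"
      \<comment> \<open>A strictly larger weight allows any second exponent;
        \<open>q\<^sub>1 / 2\<close> lies below \<open>q\<^sub>1\<close>, so the composed inclusion
        contradicts the monomial obstruction at weight \<alpha>.\<close>
      then have "fock_space \<beta> 2 q\<^sub>2 \<subseteq> fock_space \<alpha> 2 (q\<^sub>1 / 2)"
        using pos fock_embedding[of \<beta> \<alpha> 2 q\<^sub>2 "q\<^sub>1 / 2"] by auto
      then show False
        using sub monomial_noninclusion[of \<alpha> p\<^sub>1 q\<^sub>1 "q\<^sub>1 / 2"] pos by auto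
    qed
    moreover have "q\<^sub>1 \<le> q\<^sub>2" if "\<alpha> = \<beta>"
      using sub monomial_noninclusion[of \<alpha> p\<^sub>1 q\<^sub>1 q\<^sub>2] pos that by fastforce
    moreover have "1 / p\<^sub>1 + 1 / q\<^sub>2 - 1 / q\<^sub>1 \<le> 1 / 2" if "\<alpha> = \<beta>"
      using sub kernel_noninclusion[of \<alpha> p\<^sub>1 q\<^sub>1 q\<^sub>2] pos that by fastforce
    ultimately show ?R by linarith
  qed
qed

end
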